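(* Let $(\Sigma,\sigma)$ be a transitive countable Markov shift satisfying the $\mathcal{F}$-property. Then the space $\mathcal{M}_{\le 1}(\Sigma,\sigma)$ of $\sigma$-invariant sub-probability measures, endowed with the topology of convergence on cylinders, is affinely homeomorphic to the Poulsen simplex. In particular $\mathcal{M}_{\le 1}(\Sigma,\sigma)$ is compact with respect to the topology of convergence on cylinders.
   Context: Let $\mathbb{N}=\{1,2,\dots\}$ and let $B=(B(i,j))_{i,j\in\mathbb{N}}$ be a matrix with entries in $\{0,1\}$ having no zero row and no zero column. The (one-sided) countable Markov shift defined by $B$ is $\Sigma=\{(x_n)_{n\in\mathbb{N}}\in\mathbb{N}^{\mathbb{N}}: B(x_n,x_{n+1})=1 \text{ for all } n\}$ with the shift map $\sigma(x_1,x_2,\dots)=(x_2,x_3,\dots)$. A cylinder of length $n$ is $[a_1\dots a_n]=\{x\in\Sigma: x_j=a_j,\ 1\le j\le n\}$; $\Sigma$ has the topology generated by cylinders. A word $a_1\dots a_n$ is admissible if $[a_1\dots a_n]\neq\emptyset$. $(\Sigma,\sigma)$ is transitive if for all nonempty open $U,V\subset\Sigma$ there is $n\in\mathbb{N}$ with $U\cap\sigma^{-n}V\ne\emptyset$. $\mathcal{F}$-property: for every symbol $i\in\mathbb{N}$ and every $n\in\mathbb{N}$ there are only finitely many admissible words of length $n$ starting and ending at $i$. $\mathcal{M}_{\le 1}(\Sigma,\sigma)$ is the set of $\sigma$-invariant nonnegative Borel measures $\mu$ on $\Sigma$ with $\mu(\Sigma)\le 1$ (including the zero measure); it is a convex subset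 of the vector space of finite signed Borel measures. The topology of convergence on cylinders is the (metrizable) topology in which $\mu_n\to\mu$ iff $\mu_n(C)\to\mu(C)$ for every cylinder $C$; equivalently, the coarsest topology making $\mu\mapsto\mu(C)$ continuous for every cylinder $C$. A Poulsen simplex is a metrizable compact convex Choquet simplex with at least two points whose extreme points are dense; it is unique up to affine homeomorphism. *)

theory Defs
  imports "HOL-Analysis.Analysis" "HOL-Library.Function_Algebras"
begin

section \<open>Countable Markov shifts\<close>

text \<open>
  The alphabet is the type \<^typ>\<open>nat\<close>, and sequences and words are indexed from 0; this is
  a relabelling of the symbols and of the positions by 1, 2, 3, and so on.
\<close>

definition transition_matrix :: "(nat \<Rightarrow> nat \<Rightarrow> nat) \<Rightarrow> bool" where
  "transition_matrix B \<longleftrightarrow>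
     (\<forall>i j. B i j \<in> {0, 1}) \<and>
     (\<forall>i. \<exists>j. B i j \<noteq> 0) \<and>
     (\<forall>j. \<exists>i. B i j \<noteq> 0)"

definition markov_shift :: "(nat \<Rightarrow> nat \<Rightarrow> nat) \<Rightarrow> (nat \<Rightarrow> nat) set" where
  "markov_shift B = {x. \<forall>n. B (x n) (x (Suc n)) = 1}"

definition shift :: "(nat \<Rightarrow> nat) \<Rightarrow> (nat \<Rightarrow> nat)" where
  "shift x = (\<lambda>n. x (Suc n))"

definition cylinder :: "(nat \<Rightarrow> nat \<Rightarrow> nat) \<Rightarrow> nat list \<Rightarrow> (nat \<Rightarrow> nat) set" where
  "cylinder B w = {x \<in> markov_shift B. \<forall>j < length w. x j = w ! j}"

text \<open>Cylinders have length at least 1.\<close>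

definition cylinders :: "(nat \<Rightarrow> nat \<Rightarrow> nat) \<Rightarrow> (nat \<Rightarrow> nat) set set" where
  "cylinders B = {cylinder B w | w. w \<noteq> []}"

definition shift_topology :: "(nat \<Rightarrow> nat \<Rightarrow> nat) \<Rightarrow> (nat \<Rightarrow> nat) topology" where
  "shift_topology B = topology_generated_by (cylinders B)"

definition admissible :: "(nat \<Rightarrow> nat \<Rightarrow> nat) \<Rightarrow> nat list \<Rightarrow> bool" where
  "admissible B w \<longleftrightarrow> cylinder B w \<noteq> {}"

definition transitive_shift :: "(nat \<Rightarrow> nat \<Rightarrow> nat) \<Rightarrow> bool" where
  "transitive_shift B \<longleftrightarrow>
     (\<forall>U V. openin (shift_topology B) U \<and> U \<noteq> {} \<and> openin (shift_topology B) V \<and> V \<noteq> {} \<longrightarrow>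
        (\<exists>n\<ge>1. U \<inter> (shift ^^ n) -` V \<noteq> {}))"

definition F_property :: "(nat \<Rightarrow> nat \<Rightarrow> nat) \<Rightarrow> bool" where
  "F_property B \<longleftrightarrow>
     (\<forall>i. \<forall>n\<ge>1. finite {w. length w = n \<and> admissible B w \<and> hd w = i \<and> last w = i})"


section \<open>Invariant sub-probability measures\<close>

text \<open>
  The Borel \<open>\<sigma>\<close>-algebra of an abstract topology, presented as a (null) measure of which
  only the space and the measurable sets matter.
\<close>

definition borel_of :: "'a topology \<Rightarrow> 'a measure" where
  "borel_of X = sigma (topspace X) {U. openin X U}"

definition inv_subprob_measures :: "(nat \<Rightarrow> nat \<Rightarrow> nat) \<Rightarrow> (nat \<Rightarrow> nat) measure set" where
  "inv_subprob_measures B =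
     {\<mu>. sets \<mu> = sets (borel_of (shift_topology B)) \<and>
         emeasure \<mu> (markov_shift B) \<le> 1 \<and>
         (\<forall>A \<in> sets \<mu>. emeasure \<mu> (shift -` A \<inter> markov_shift B) = emeasure \<mu> A)}"

text \<open>
  The coarsest topology on the invariant sub-probability measures making
  \<open>\<mu> \<mapsto> \<mu>(C)\<close> continuous for every cylinder \<open>C\<close>.
\<close>

definition cylinder_convergence_topology ::
    "(nat \<Rightarrow> nat \<Rightarrow> nat) \<Rightarrow> (nat \<Rightarrow> nat) measure topology" where
  "cylinder_convergence_topology B =
     topology_generated_by
       {{\<mu> \<in> inv_subprob_measures B. measure \<mu> C \<in> U} | C U. C \<in> cylinders B \<and> open (U :: real set)}"

text \<open>
  The library's type of measures carries no addition, so the convex combination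
  \<open>(1 - t) \<mu> + t \<nu>\<close> of two measures on the same measurable space is built by hand.
\<close>

definition convex_comb_measure :: "real \<Rightarrow> 'a measure \<Rightarrow> 'a measure \<Rightarrow> 'a measure" where
  "convex_comb_measure t \<mu> \<nu> =
     measure_of (space \<mu>) (sets \<mu>)
       (\<lambda>A. ennreal (1 - t) * emeasure \<mu> A + ennreal t * emeasure \<nu> A)"

definition affine_on_measures :: "'a measure set \<Rightarrow> ('a measure \<Rightarrow> 'b::real_vector) \<Rightarrow> bool" where
  "affine_on_measures M h \<longleftrightarrow>
     (\<forall>\<mu>\<in>M. \<forall>\<nu>\<in>M. \<forall>t\<in>{0..1}.
        h (convex_comb_measure t \<mu> \<nu>) = (1 - t) *\<^sub>R h \<mu> + t *\<^sub>R h \<nu>)"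


section \<open>Choquet simplices and Poulsen simplices\<close>

definition locally_convex_space :: "'a::real_vector topology \<Rightarrow> bool" where
  "locally_convex_space X \<longleftrightarrow>
     topspace X = UNIV \<and>
     Hausdorff_space X \<and>
     continuous_map (prod_topology X X) X (\<lambda>(x, y). x + y) \<and>
     continuous_map (prod_topology euclideanreal X) X (\<lambda>(c, x). c *\<^sub>R x) \<and>
     (\<forall>U. openin X U \<and> 0 \<in> U \<longrightarrow> (\<exists>V. openin X V \<and> convex V \<and> 0 \<in> V \<and> V \<subseteq> U))"

text \<open>
  \<open>\<rho>\<close> is a Borel probability measure on \<open>K\<close> with barycenter \<open>x\<close>.
\<close>

definition represents :: "'a::real_vector topology \<Rightarrow> 'a set \<Rightarrow> 'a measure \<Rightarrow> 'a \<Rightarrow> bool" where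
  "represents X K \<rho> x \<longleftrightarrow>
     sets \<rho> = sets (borel_of (subtopology X K)) \<and>
     emeasure \<rho> K = 1 \<and>
     (\<forall>f. linear f \<and> continuous_map X euclideanreal f \<longrightarrow> f x = (LINT y|\<rho>. f y))"

text \<open>
  In a metrizable compact convex set the extreme points form a \<open>G\<^sub>\<delta>\<close> set, so
  \<open>{e. e extreme_point_of K}\<close> is measurable, and a representing measure is maximal in the
  Choquet order iff it gives this set full mass.
\<close>

definition metrizable_choquet_simplex :: "'a::real_vector topology \<Rightarrow> 'a set \<Rightarrow> bool" where
  "metrizable_choquet_simplex X K \<longleftrightarrow>
     locally_convex_space X \<and>
     compactin X K \<and> convex K \<and> metrizable_space (subtopology X K) \<and>
     (\<forall>x\<in>K. \<exists>!\<rho>. represents X K \<rho> x \<and> emeasure \<rho> {e. e extreme_point_of K} = 1)"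

definition poulsen_simplex :: "'a::real_vector topology \<Rightarrow> 'a set \<Rightarrow> bool" where
  "poulsen_simplex X K \<longleftrightarrow>
     metrizable_choquet_simplex X K \<and>
     (\<exists>x\<in>K. \<exists>y\<in>K. x \<noteq> y) \<and>
     K \<subseteq> X closure_of {e. e extreme_point_of K}"


section \<open>The vector space of real sequences\<close>

text \<open>
  Pointwise scalar multiplication makes the type \<^typ>\<open>nat \<Rightarrow> real\<close> a real vector space. Every
  metrizable compact convex subset of a locally convex space is affinely homeomorphic to a
  subset of this space with the product topology, so it is large enough to contain the Poulsen
  simplex.
\<close>

instantiation "fun" :: (type, real_vector) real_vector
begin

definition scaleR_fun :: "real \<Rightarrow> ('a \<Rightarrow> 'b) \<Rightarrow> 'a \<Rightarrow> 'b" where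
  "scaleR_fun c f = (\<lambda>x. c *\<^sub>R f x)"

instance
  by standard
    (simp_all add: scaleR_fun_def fun_eq_iff scaleR_add_right scaleR_add_left)

end

end

theory Submission
  imports Defs "HOL-Probability.Projective_Family" "HOL-Library.Transitive_Closure_Table"
begin

text \<open>
  An invariant measure is determined by its values on cylinders, so listing these values embeds
  the invariant sub-probability measures affinely and homeomorphically as a convex set \<open>K\<close> of real
  sequences. For each of these measures the set of points that start at \<open>i\<close> and do not return to
  \<open>i\<close> within \<open>k\<close> steps has measure at most \<open>1 / (k + 1)\<close>; by the F-property only finitely many
  symbols can follow \<open>i\<close> on the remaining points starting at \<open>i\<close>. Hence no mass of a cylinder is
  lost in a limit, and \<open>K\<close> is compact.

  By Birkhoff's theorem almost every point has a vector of limit frequencies. This vector lies in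
  \<open>K\<close>, being a limit of periodic orbit measures, and it is almost surely ergodic; its distribution
  is the ergodic decomposition. Hence the extreme points are 0 and the ergodic measures, and a
  representing measure on them is the distribution of the frequency vector away from 0 and carries
  the missing mass at 0.

  Concatenating loops at a fixed symbol shows that the closure of the periodic orbit measures is
  convex. It contains 0, as the F-property yields long loops visiting each symbol at most twice,
  and it contains all limit frequency vectors, hence their barycenters, which exhaust \<open>K\<close>.
\<close>

text \<open>The total mass is not one of the coordinates: \<open>S\<close> is not the cylinder of a
  nonempty word, and periodic orbit measures of mass 1 can converge to 0. Mass may thus escape to
  infinity, and what has to survive in a limit is the identity
  \<open>y w = (\<Sum>a. y (w @ [a]))\<close> for nonempty \<open>w\<close>, which makes the limit
  values come from a measure. The uniform tail bound preserves this identity. Compactness comes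
  before the ergodic decomposition: a frequency vector is a limit of loop frequencies, and the
  closedness of \<open>K\<close> turns it into an invariant measure. Since this happens for every
  point, \<open>measure_at (freq x)\<close> is a kernel from the start, and it depends on the point
  alone and not on the measure under study. Averaging it over the restriction of \<mu> to an
  invariant set therefore gives back that restriction, which yields both mass 1 and ergodicity of
  almost every component. All loops pass through one fixed symbol because any two of them can then
  be concatenated, and transitivity closes up an arbitrary piece of an orbit to such a loop.\<close>

section \<open>Linear combinations of two measures\<close>

lemma emeasure_measure_of_combination:
  fixes a b :: ennreal
  assumes "sets N = sets M" and A: "A \<in> sets M"
  shows "emeasure (measure_of (space M) (sets M) (\<lambda>A. a * emeasure M A + b * emeasure N A)) A
    = a * emeasure M A + b * emeasure N A"
proof (rule emeasure_measure_of_sigma)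
  show "sigma_algebra (space M) (sets M)" by (rule sets.sigma_algebra_axioms)
  show "positive (sets M) (\<lambda>A. a * emeasure M A + b * emeasure N A)"
    by (simp add: positive_def)
  show "countably_additive (sets M) (\<lambda>A. a * emeasure M A + b * emeasure N A)"
  proof (rule countably_additiveI)
    fix F :: "nat \<Rightarrow> 'a set"
    assume "range F \<subseteq> sets M" "disjoint_family F"
    then have "(\<Sum>i. emeasure M (F i)) = emeasure M (\<Union>i. F i)"
      "(\<Sum>i. emeasure N (F i)) = emeasure N (\<Union>i. F i)"
      using assms(1) by (auto intro!: suminf_emeasure)
    then show "(\<Sum>i. a * emeasure M (F i) + b * emeasure N (F i)) =
       a * emeasure M (\<Union>i. F i) + b * emeasure N (\<Union>i. F i)"
      by (simp add: suminf_add[symmetric] ennreal_suminf_cmult)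
  qed
qed fact

lemma nn_integral_measure_of_combination:
  fixes a b :: ennreal
  assumes N: "sets N = sets M" and f: "f \<in> borel_measurable M"
  shows "(\<integral>\<^sup>+x. f x \<partial>measure_of (space M) (sets M) (\<lambda>A. a * emeasure M A + b * emeasure N A))
    = a * (\<integral>\<^sup>+x. f x \<partial>M) + b * (\<integral>\<^sup>+x. f x \<partial>N)"
  (is "nn_integral ?L f = _")
proof -
  have sL: "sets ?L = sets M" by (rule sets.sets_measure_of_eq)
  have meas: "g \<in> borel_measurable ?L \<longleftrightarrow> g \<in> borel_measurable M"
    "g \<in> borel_measurable N \<longleftrightarrow> g \<in> borel_measurable M" for g :: "'a \<Rightarrow> ennreal"
    using measurable_cong_sets[OF sL refl] measurable_cong_sets[OF N refl] by blast+
  show ?thesis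
    using f
  proof (induction rule: borel_measurable_induct)
    case (cong f g)
    have sp: "space ?L = space M" "space N = space M"
      using sets_eq_imp_space_eq[OF sL] sets_eq_imp_space_eq[OF N] by auto
    have "nn_integral ?L f = nn_integral ?L g" "nn_integral M f = nn_integral M g"
      "nn_integral N f = nn_integral N g"
      using cong(3) sp by (auto intro!: nn_integral_cong)
    with cong(4) show ?case by simp
  next
    case (set A)
    then show ?case
      using sL N emeasure_measure_of_combination[OF N set] by simp
  next
    case (mult u c)
    then show ?case
      by (simp add: nn_integral_cmult meas algebra_simps)
  next
    case (add u v)
    then show ?case
      by (simp add: nn_integral_add meas algebra_simps)
  next
    case (seq U)
    have *: "nn_integral Q (Sup (range U)) = (SUP i. nn_integral Q (U i))"
      if "\<And>i. U i \<in> borel_measurable Q" for Q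
    proof -
      have "Sup (range U) = (\<lambda>x. SUP i. U i x)" by (auto simp: fun_eq_iff image_comp)
      then show ?thesis
        using nn_integral_monotone_convergence_SUP[OF \<open>incseq U\<close> that] by simp
    qed
    have inc: "incseq (\<lambda>i. nn_integral Q (U i))" for Q
      using \<open>incseq U\<close> by (auto simp: incseq_def le_fun_def intro!: nn_integral_mono)
    have "(SUP i. a * nn_integral M (U i) + b * nn_integral N (U i))
      = a * (SUP i. nn_integral M (U i)) + b * (SUP i. nn_integral N (U i))"
      by (subst ennreal_SUP_add)
        (auto simp: SUP_mult_left_ennreal inc[THEN incseqD] incseq_def intro!: mult_left_mono)
    then show ?case
      using seq by (simp only: * meas simp_thms)
  qed
qed

section \<open>Birkhoff's ergodic theorem for bounded functions on finite measure spaces\<close>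

definition birkhoff_sum :: "('a \<Rightarrow> 'a) \<Rightarrow> ('a \<Rightarrow> real) \<Rightarrow> nat \<Rightarrow> 'a \<Rightarrow> real" where
  "birkhoff_sum T f n x = (\<Sum>k<n. f ((T ^^ k) x))"

lemma birkhoff_sum_add:
  "birkhoff_sum T f (m + n) x = birkhoff_sum T f m x + birkhoff_sum T f n ((T ^^ m) x)"
proof -
  have "(\<Sum>k\<in>{m..<m+n}. f ((T ^^ k) x)) = (\<Sum>k<n. f ((T ^^ k) ((T ^^ m) x)))"
    by (rule sum.reindex_bij_witness[of _ "\<lambda>k. k + m" "\<lambda>k. k - m"])
      (auto simp: funpow_add[THEN fun_cong, unfolded comp_def, symmetric])
  moreover have "(\<Sum>k<m + n. f ((T ^^ k) x)) = (\<Sum>k<m. f ((T ^^ k) x)) + (\<Sum>k\<in>{m..<m+n}. f ((T ^^ k) x))"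
    by (subst sum.union_disjoint[symmetric]) (auto intro: sum.cong)
  ultimately show ?thesis by (simp add: birkhoff_sum_def)
qed

locale measure_preserving = finite_measure M for M :: "'a measure" +
  fixes T :: "'a \<Rightarrow> 'a"
  assumes T[measurable]: "T \<in> measurable M M"
    and distr_T: "distr M M T = M"
begin

lemma funpow_T[measurable]: "(T ^^ k) \<in> measurable M M"
  by (induction k) (auto simp: id_def intro: measurable_comp[OF _ T])

lemma funpow_space: "x \<in> space M \<Longrightarrow> (T ^^ k) x \<in> space M"
  using funpow_T[of k] by (auto simp: measurable_def)

lemma distr_funpow: "distr M M (T ^^ k) = M"
proof (induction k)
  case 0
  then show ?case by (simp add: distr_id id_def)
next
  case (Suc k)
  have "distr M M (T ^^ Suc k) = distr (distr M M T) M (T ^^ k)"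
    by (subst distr_distr) (auto simp only: funpow_Suc_right funpow_T T)
  then show ?case using Suc by (simp only: distr_T)
qed

lemma integral_funpow:
  fixes f :: "'a \<Rightarrow> real"
  assumes [measurable]: "f \<in> borel_measurable M"
  shows "(LINT x|M. f ((T ^^ k) x)) = (LINT x|M. f x)"
  using integral_distr[of "T ^^ k" M M f] by (simp add: distr_funpow)

lemma emeasure_funpow:
  assumes "A \<in> sets M"
  shows "emeasure M ((T ^^ k) -` A \<inter> space M) = emeasure M A"
  using emeasure_distr[of "T ^^ k" M M A] assms by (simp add: distr_funpow)

lemma measure_funpow:
  assumes "A \<in> sets M"
  shows "measure M ((T ^^ k) -` A \<inter> space M) = measure M A"
  using emeasure_funpow[OF assms] by (simp add: measure_def)

lemma measurable_birkhoff_sum[measurable]: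
  "f \<in> borel_measurable M \<Longrightarrow> birkhoff_sum T f n \<in> borel_measurable M"
  unfolding birkhoff_sum_def
  by (intro borel_measurable_sum measurable_compose[OF funpow_T])

lemma integrable_bounded:
  fixes f :: "'a \<Rightarrow> real"
  assumes "f \<in> borel_measurable M" "\<And>x. x \<in> space M \<Longrightarrow> \<bar>f x\<bar> \<le> c"
  shows "integrable M f"
  using assms by (intro integrable_const_bound[where B=c]) auto

text \<open>
  Truncating the waiting time for a nonnegative sum at \<open>m\<close> and raising \<open>f\<close> where the waiting
  time is longer, every orbit splits into blocks with nonnegative sums up to a tail of length \<open>m\<close>.
\<close>

lemma integral_nonneg_if_birkhoff_sums_nonneg:
  fixes f :: "'a \<Rightarrow> real"
  assumes f[measurable]: "f \<in> borel_measurable M"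
    and bd: "\<And>x. x \<in> space M \<Longrightarrow> \<bar>f x\<bar> \<le> c"
    and pos: "\<And>x. x \<in> space M \<Longrightarrow> \<exists>n\<ge>1. 0 \<le> birkhoff_sum T f n x"
  shows "0 \<le> (LINT x|M. f x)"
proof (cases "space M = {}")
  case True
  then show ?thesis by (simp add: Bochner_Integration.integral_empty)
next
  case False
  then have c0: "0 \<le> c" using bd abs_ge_zero order_trans by blast
  define E where "E m = {x \<in> space M. \<forall>n\<in>{1..m}. birkhoff_sum T f n x < 0}" for m
  have E[measurable]: "E m \<in> sets M" for m unfolding E_def by measurable
  have ineq: "- c * measure M (E m) \<le> (LINT x|M. f x)" if m: "1 \<le> m" for m
  proof -
    define g where "g x = f x + c * indicator (E m) x" for x
    have [measurable]: "g \<in> borel_measurable M" unfolding g_def by measurable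
    have gc: "- c \<le> g x" "f x \<le> g x" if "x \<in> space M" for x
      using bd[OF that] c0 by (auto simp: g_def indicator_def)
    have gS: "- (c * m) \<le> birkhoff_sum T g L x" if "x \<in> space M" for L x
      using that
    proof (induction L arbitrary: x rule: less_induct)
      case (less L)
      show ?case
      proof (cases "L \<le> m")
        case True
        have "- (c * m) \<le> (\<Sum>k<L. - c)" using True c0 by (simp add: mult.commute mult_left_mono)
        also have "\<dots> \<le> birkhoff_sum T g L x"
          unfolding birkhoff_sum_def using less.prems by (intro sum_mono gc funpow_space)
        finally show ?thesis .
      next
        case False
        obtain n where n: "1 \<le> n" "n \<le> m" "0 \<le> birkhoff_sum T g n x"
        proof (cases "x \<in> E m")
          case True
          then have "0 \<le> g x" using bd[OF less.prems] by (auto simp: g_def)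
          then show ?thesis using m by (intro that[of 1]) (auto simp: birkhoff_sum_def)
        next
          case False
          then obtain n where n: "1 \<le> n" "n \<le> m" "0 \<le> birkhoff_sum T f n x"
            using less.prems by (auto simp: E_def not_less)
          moreover have "birkhoff_sum T f n x \<le> birkhoff_sum T g n x"
            unfolding birkhoff_sum_def using less.prems by (intro sum_mono gc funpow_space)
          ultimately show ?thesis using that by force
        qed
        have "- (c * m) \<le> birkhoff_sum T g (L - n) ((T ^^ n) x)"
          using n False by (intro less.IH funpow_space less.prems) auto
        also have "\<dots> \<le> birkhoff_sum T g (n + (L - n)) x"
          using n(3) by (simp add: birkhoff_sum_add del: add_diff_inverse_nat)
        finally show ?thesis using n False by simp
      qed
    qed
    have gint: "integrable M g"
    proof (rule integrable_bounded[where c="2 * c"])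
      show "\<bar>g x\<bar> \<le> 2 * c" if "x \<in> space M" for x
        using bd[OF that] c0 by (auto simp: g_def indicator_def)
    qed measurable
    have gk: "integrable M (\<lambda>x. g ((T ^^ k) x))" for k
      using integrable_distr[of "T ^^ k" M M g] gint by (simp add: distr_funpow)
    have ge: "- (c * m) * measure M (space M) \<le> L * (LINT x|M. g x)" for L :: nat
    proof -
      have "(LINT x|M. - (c * m)) \<le> (LINT x|M. birkhoff_sum T g L x)"
        unfolding birkhoff_sum_def using gS gk
        by (intro integral_mono) (auto simp: birkhoff_sum_def)
      also have "\<dots> = (\<Sum>k<L. (LINT x|M. g ((T ^^ k) x)))"
        unfolding birkhoff_sum_def using gk by (subst Bochner_Integration.integral_sum) auto
      finally show ?thesis by (simp add: integral_funpow mult_ac)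
    qed
    \<comment> \<open>The lower bound in \<open>ge\<close> is the same for all \<open>L\<close>,
      while the right side is \<open>L\<close> times the integral.\<close>
    have "0 \<le> (LINT x|M. g x)"
    proof (rule ccontr)
      assume "\<not> 0 \<le> (LINT x|M. g x)"
      then have "0 < - (LINT x|M. g x)" by simp
      from reals_Archimedean3[OF this]
      obtain L :: nat where "c * m * measure M (space M) < L * - (LINT x|M. g x)"
        by blast
      then show False using ge[of L] by simp
    qed
    also have "(LINT x|M. g x) = (LINT x|M. f x) + c * measure M (E m)"
      unfolding g_def using bd by (subst Bochner_Integration.integral_add)
        (auto intro!: integrable_bounded[where c=c] simp: less_top[symmetric] c0)
    finally show ?thesis by simp
  qed
  have "(\<lambda>m. measure M (E m)) \<longlonglongrightarrow> measure M (\<Inter>m. E m)"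
    by (intro finite_Lim_measure_decseq) (auto simp: decseq_def E_def)
  moreover have "(\<Inter>m. E m) = {}"
    using pos by (force simp: E_def not_less[symmetric])
  ultimately have "(\<lambda>m. - c * measure M (E m)) \<longlonglongrightarrow> - c * 0"
    by (intro tendsto_mult_left) simp
  then show ?thesis
    using ineq by (intro LIMSEQ_le_const2[of "\<lambda>m. - c * measure M (E m)" 0]) auto
qed

text \<open>Shifting drops the first term of the sum and adds one new last term, a change of at most
  \<open>2 * c\<close> before division by \<open>n\<close>.\<close>

lemma birkhoff_average_shift:
  fixes f :: "'a \<Rightarrow> real"
  assumes bd: "\<And>x. x \<in> space M \<Longrightarrow> \<bar>f x\<bar> \<le> c" and x: "x \<in> space M"
  shows "(\<lambda>n. birkhoff_sum T f n (T x) / n - birkhoff_sum T f n x / n) \<longlonglongrightarrow> 0"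
proof (rule tendsto_rabs_zero_cancel, rule real_tendsto_sandwich[OF _ _ tendsto_const])
  have "\<bar>birkhoff_sum T f n (T x) / n - birkhoff_sum T f n x / n\<bar> \<le> 2 * c / n" for n
  proof -
    have "birkhoff_sum T f 1 x + birkhoff_sum T f n (T x) = birkhoff_sum T f n x + birkhoff_sum T f 1 ((T ^^ n) x)"
      using birkhoff_sum_add[of T f 1 n x] birkhoff_sum_add[of T f n 1 x] by simp
    then have "\<bar>birkhoff_sum T f n (T x) - birkhoff_sum T f n x\<bar> \<le> 2 * c"
      using bd[OF x] bd[OF funpow_space[OF x, of n]] by (simp add: birkhoff_sum_def)
    then show ?thesis
      by (cases "n = 0") (auto simp: diff_divide_distrib[symmetric] abs_divide intro: divide_right_mono)
  qed
  then show "\<forall>\<^sub>F n in sequentially. \<bar>birkhoff_sum T f n (T x) / n - birkhoff_sum T f n x / n\<bar> \<le> 2 * c / n"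
    by simp
  show "(\<lambda>n. 2 * c / real n) \<longlonglongrightarrow> 0" by (rule lim_const_over_n)
qed simp

text \<open>On the invariant set \<open>E\<close> where the lower limit is below \<open>a\<close>
  and the upper limit above \<open>b\<close>, with \<open>a < b\<close>, every point has a
  nonnegative sum of \<open>f - b\<close> and one of \<open>a - f\<close>. By the preceding integral
  inequality both functions have nonnegative integral over \<open>E\<close>; these integrals add up
  to \<open>(a - b) * measure M E\<close>, so \<open>E\<close> is a null set.\<close>

theorem birkhoff_averages_convergent:
  fixes f :: "'a \<Rightarrow> real"
  assumes f[measurable]: "f \<in> borel_measurable M"
    and bd: "\<And>x. x \<in> space M \<Longrightarrow> \<bar>f x\<bar> \<le> c"
  shows "AE x in M. convergent (\<lambda>n. birkhoff_sum T f n x / n)"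
proof -
  define A where "A n x = birkhoff_sum T f n x / n" for n x
  have [measurable]: "A n \<in> borel_measurable M" for n unfolding A_def by measurable
  define u where "u x = limsup (\<lambda>n. ereal (A n x))" for x
  define l where "l x = liminf (\<lambda>n. ereal (A n x))" for x
  have [measurable]: "u \<in> borel_measurable M" "l \<in> borel_measurable M"
    unfolding u_def l_def by measurable
  have inv: "u (T x) = u x" "l (T x) = l x" if "x \<in> space M" for x
  proof -
    have lim: "(\<lambda>n. ereal (A n (T x) - A n x)) \<longlonglongrightarrow> 0"
      using birkhoff_average_shift[OF bd that] by (simp add: A_def zero_ereal_def)
    have eq: "(\<lambda>n. ereal (A n (T x) - A n x) + ereal (A n x)) = (\<lambda>n. ereal (A n (T x)))" by simp
    show "u (T x) = u x" "l (T x) = l x"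
      using ereal_limsup_lim_add[OF lim, of "\<lambda>n. ereal (A n x)"]
        ereal_liminf_lim_add[OF lim, of "\<lambda>n. ereal (A n x)"]
      unfolding eq u_def l_def by auto
  qed
  have null: "AE x in M. \<not> (l x < ereal a \<and> ereal b < u x)" if ab: "a < b" for a b
  proof -
    define E where "E = {x \<in> space M. l x < ereal a \<and> ereal b < u x}"
    have E[measurable]: "E \<in> sets M" unfolding E_def by measurable
    have TE: "T x \<in> E \<longleftrightarrow> x \<in> E" if "x \<in> space M" for x
      using that inv[OF that] T by (auto simp: E_def measurable_def)
    have TkE: "(T ^^ k) x \<in> E \<longleftrightarrow> x \<in> E" if "x \<in> space M" for x k
      by (induction k) (use TE funpow_space[OF that] in auto)
    \<comment> \<open>The inequality is stated for the whole space. Cutting off with an invariant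
      set makes all sums outside it 0, so there the hypothesis holds trivially.\<close>
    have sums: "birkhoff_sum T (\<lambda>y. indicator E y * g y) n x
        = (if x \<in> E then birkhoff_sum T g n x else 0)" if "x \<in> space M" for g n x
      using TkE[OF that] by (auto simp: birkhoff_sum_def indicator_def)
    have nonneg: "0 \<le> (LINT x|M. indicator E x * g x)"
      if [measurable]: "g \<in> borel_measurable M" and "\<And>x. x \<in> space M \<Longrightarrow> \<bar>g x\<bar> \<le> d"
        and "\<And>x. x \<in> E \<Longrightarrow> \<exists>n\<ge>1. 0 \<le> birkhoff_sum T g n x" for g d
    proof (rule integral_nonneg_if_birkhoff_sums_nonneg[where c="\<bar>d\<bar>"])
      show "\<bar>indicator E x * g x\<bar> \<le> \<bar>d\<bar>" if "x \<in> space M" for x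
        using \<open>x \<in> space M \<Longrightarrow> \<bar>g x\<bar> \<le> d\<close> that by (auto simp: indicator_def)
      show "\<exists>n\<ge>1. 0 \<le> birkhoff_sum T (\<lambda>y. indicator E y * g y) n x" if "x \<in> space M" for x
        using sums[OF that, of g] \<open>x \<in> E \<Longrightarrow> \<exists>n\<ge>1. 0 \<le> birkhoff_sum T g n x\<close> by (cases "x \<in> E") auto
    qed measurable
    have dbd: "\<bar>f x - b\<bar> \<le> c + \<bar>b\<bar>" "\<bar>a - f x\<bar> \<le> \<bar>a\<bar> + c" if "x \<in> space M" for x
      using bd[OF that] by linarith+
    have "0 \<le> (LINT x|M. indicator E x * (f x - b))"
    proof (rule nonneg[where d="c + \<bar>b\<bar>"])
      fix x assume "x \<in> E"
      then have "ereal b < limsup (\<lambda>n. ereal (A n x))" by (simp add: E_def u_def)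
      then have "\<exists>\<^sub>F n in sequentially. ereal b < ereal (A n x)"
        using Limsup_bounded[of "\<lambda>n. ereal (A n x)" "ereal b" sequentially]
        by (auto simp: frequently_def not_less)
      then obtain n where n: "n \<ge> 1" "b < A n x"
        by (auto simp: frequently_sequentially)
      then have "0 \<le> birkhoff_sum T (\<lambda>x. f x - b) n x"
        by (simp add: A_def birkhoff_sum_def sum_subtractf field_simps)
      then show "\<exists>n\<ge>1. 0 \<le> birkhoff_sum T (\<lambda>x. f x - b) n x" using n by blast
    qed (use dbd(1) in auto)
    moreover have "0 \<le> (LINT x|M. indicator E x * (a - f x))"
    proof (rule nonneg[where d="\<bar>a\<bar> + c"])
      fix x assume "x \<in> E"
      then have "liminf (\<lambda>n. ereal (A n x)) < ereal a" by (simp add: E_def l_def)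
      then have "\<exists>\<^sub>F n in sequentially. ereal (A n x) < ereal a"
        using Liminf_bounded[of "ereal a" "\<lambda>n. ereal (A n x)" sequentially]
        by (auto simp: frequently_def not_less)
      then obtain n where n: "n \<ge> 1" "A n x < a"
        by (auto simp: frequently_sequentially)
      then have "0 \<le> birkhoff_sum T (\<lambda>x. a - f x) n x"
        by (simp add: A_def birkhoff_sum_def sum_subtractf field_simps)
      then show "\<exists>n\<ge>1. 0 \<le> birkhoff_sum T (\<lambda>x. a - f x) n x" using n by blast
    qed (use dbd(2) in auto)
    ultimately have "0 \<le> (LINT x|M. indicator E x * (f x - b)) + (LINT x|M. indicator E x * (a - f x))"
      by simp
    also have "\<dots> = (LINT x|M. indicator E x * (f x - b) + indicator E x * (a - f x))"
    proof (rule Bochner_Integration.integral_add[symmetric])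
      show "integrable M (\<lambda>x. indicator E x * (f x - b))"
        unfolding mult.commute[of "indicator _ _"]
        by (intro integrable_real_mult_indicator integrable_bounded[where c="c + \<bar>b\<bar>"] dbd) auto
      show "integrable M (\<lambda>x. indicator E x * (a - f x))"
        unfolding mult.commute[of "indicator _ _"]
        by (intro integrable_real_mult_indicator integrable_bounded[where c="\<bar>a\<bar> + c"] dbd) auto
    qed
    also have "\<dots> = (LINT x|M. (a - b) * indicator E x)"
      by (intro Bochner_Integration.integral_cong) (auto simp: indicator_def)
    also have "\<dots> = (a - b) * measure M E" by simp
    finally have "measure M E = 0"
      using ab measure_nonneg[of M E] by (auto simp: zero_le_mult_iff)
    then have "E \<in> null_sets M" by (auto simp: emeasure_eq_measure)
    then show ?thesis by (rule AE_I') (auto simp: E_def)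
  qed
  have "AE x in M. \<forall>a\<in>\<rat>. \<forall>b\<in>\<rat>. a < b \<longrightarrow> \<not> (l x < ereal a \<and> ereal b < u x)"
    using null by (auto simp: AE_ball_countable countable_rat)
  then show ?thesis
    using AE_space
  proof eventually_elim
    case (elim x)
    have bdA: "\<bar>A n x\<bar> \<le> c" for n
    proof (cases "n = 0")
      case True
      then show ?thesis using bd[OF elim(2)] abs_ge_zero[of "f x"] by (simp add: A_def)
    next
      case False
      have "\<bar>birkhoff_sum T f n x\<bar> \<le> (\<Sum>k<n. \<bar>f ((T ^^ k) x)\<bar>)"
        unfolding birkhoff_sum_def by (rule sum_abs)
      also have "\<dots> \<le> (\<Sum>k<n. c)" using bd funpow_space[OF elim(2)] by (intro sum_mono) auto
      finally show ?thesis using False by (simp add: A_def field_simps abs_divide)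
    qed
    have "ereal (- c) \<le> l x" "u x \<le> ereal c"
      unfolding l_def u_def using bdA[unfolded abs_le_iff]
      by (auto intro!: Liminf_bounded Limsup_bounded always_eventually simp: minus_le_iff[of _ c])
    moreover have "l x \<le> u x" unfolding l_def u_def by (intro Liminf_le_Limsup) simp
    moreover have "\<not> l x < u x"
    proof
      assume "l x < u x"
      then obtain a where a: "l x < real_of_rat a" "real_of_rat a < u x" using ereal_dense3 by blast
      then obtain b where b: "real_of_rat a < ereal (real_of_rat b)" "real_of_rat b < u x"
        using ereal_dense3[OF a(2)] by auto
      show False using elim(1) a b by (metis Rats_of_rat less_ereal.simps(1))
    qed
    ultimately obtain r where r: "l x = ereal r" "u x = ereal r"
      by (cases "l x"; cases "u x") auto
    then have "(\<lambda>n. ereal (A n x)) \<longlonglongrightarrow> ereal r"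
      unfolding l_def u_def by (subst tendsto_iff_Liminf_eq_Limsup) auto
    then show ?case by (auto simp: convergent_def A_def)
  qed
qed

end

section \<open>The shift space, its Borel sets, and the embedding of the measures into the real
  sequences\<close>

lemma shift_apply: "shift x n = x (Suc n)"
  by (simp add: shift_def)

lemma funpow_shift_apply[simp]: "(shift ^^ k) x n = x (k + n)"
  by (induction k arbitrary: n) (auto simp: shift_apply)

lemma map_take_upt: "map x [0..<n] = map y [0..<n] \<longleftrightarrow> (\<forall>j<n. x j = y j)"
  by auto

lemma map_upt_eq_iff: "map x [0..<length w] = w \<longleftrightarrow> (\<forall>j<length w. x j = w ! j)"
proof
  assume a: "map x [0..<length w] = w"
  have "x j = w ! j" if "j < length w" for j
    using arg_cong[OF a, of "\<lambda>l. l ! j"] nth_map_upt[of j "length w" 0 x] that by (metis add_0 diff_zero)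
  then show "\<forall>j<length w. x j = w ! j" by blast
next
  assume "\<forall>j<length w. x j = w ! j"
  then show "map x [0..<length w] = w" by (intro nth_equalityI) auto
qed

text \<open>Coding by head and tail leaves out the empty word: its cylinder is the whole space,
  which is not among the sets that define the topology.\<close>

definition word :: "nat \<Rightarrow> nat list" where
  "word n = (case from_nat n of (a, l) \<Rightarrow> a # l)"

lemma word_nonempty[simp]: "word n \<noteq> []"
  by (simp add: word_def split: prod.split)

lemma word_surj: "w \<noteq> [] \<Longrightarrow> \<exists>n. word n = w"
  by (rule exI[of _ "to_nat (hd w, tl w)"]) (simp add: word_def)

locale markov =
  fixes B :: "nat \<Rightarrow> nat \<Rightarrow> nat"
  assumes transition: "transition_matrix B"
begin

abbreviation "S \<equiv> markov_shift B"
abbreviation "cyl \<equiv> cylinder B"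
abbreviation "SB \<equiv> borel_of (shift_topology B)"
abbreviation "Inv \<equiv> inv_subprob_measures B"

lemma cyl_subset: "cyl w \<subseteq> S"
  by (auto simp: cylinder_def)

lemma cyl_Nil[simp]: "cyl [] = S"
  by (auto simp: cylinder_def)

lemma mem_cyl_prefix: "x \<in> S \<Longrightarrow> x \<in> cyl (map x [0..<n])"
  by (simp add: cylinder_def)

lemma mem_cyl_iff: "x \<in> cyl w \<longleftrightarrow> x \<in> S \<and> map x [0..<length w] = w"
  by (simp only: cylinder_def mem_Collect_eq map_upt_eq_iff)

lemma shift_in_S: "x \<in> S \<Longrightarrow> shift x \<in> S"
  by (simp add: markov_shift_def shift_apply)

lemma funpow_shift_in_S: "x \<in> S \<Longrightarrow> (shift ^^ k) x \<in> S"
  by (simp add: markov_shift_def)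

lemma topspace_shift[simp]: "topspace (shift_topology B) = S"
proof -
  have "\<exists>w. x \<in> cyl w \<and> w \<noteq> []" if "x \<in> S" for x
    using mem_cyl_prefix[OF that, of 1] by (intro exI[of _ "map x [0..<1]"]) simp
  moreover have "\<Union>(cylinders B) = (\<Union>w\<in>{w. w \<noteq> []}. cyl w)"
    unfolding cylinders_def by blast
  ultimately show ?thesis
    unfolding shift_topology_def topology_generated_by_topspace using cyl_subset by blast
qed

lemma openin_cyl: "w \<noteq> [] \<Longrightarrow> openin (shift_topology B) (cyl w)"
  by (auto simp: shift_topology_def cylinders_def intro: topology_generated_by_Basis)

lemma openin_shiftD:
  assumes "openin (shift_topology B) U" "x \<in> U"
  shows "\<exists>n. cyl (map x [0..<Suc n]) \<subseteq> U"
proof -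
  have "generate_topology_on (cylinders B) U"
    using assms(1) by (simp add: shift_topology_def openin_topology_generated_by_iff)
  then show ?thesis
    using assms(2)
  proof (induction U)
    case (Int a b)
    then obtain n m where "cyl (map x [0..<Suc n]) \<subseteq> a" "cyl (map x [0..<Suc m]) \<subseteq> b"
      by blast
    moreover have "cyl (map x [0..<Suc (max n m)]) \<subseteq> cyl (map x [0..<Suc n]) \<inter> cyl (map x [0..<Suc m])"
      by (auto simp: cylinder_def simp del: upt_Suc)
    ultimately show ?case by blast
  next
    case (UN K)
    then show ?case by blast
  next
    case (Basis s)
    then obtain w where w: "s = cyl w" "w \<noteq> []" by (auto simp: cylinders_def)
    then have "cyl (map x [0..<Suc (length w - 1)]) = s"
      using Basis(2) by (simp only: mem_cyl_iff) simp
    then show ?case by blast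
  qed auto
qed

text \<open>There are countably many words, so every open set is a countable union of
  cylinders.\<close>

lemma sets_SB: "sets SB = sigma_sets S (cylinders B)"
proof -
  have "sets SB = sigma_sets S {U. openin (shift_topology B) U}"
    unfolding borel_of_def topspace_shift
    using openin_subset by (intro sets_measure_of) fastforce
  also have "\<dots> = sigma_sets S (cylinders B)"
  proof (rule sigma_sets_eqI)
    fix U assume U: "U \<in> {U. openin (shift_topology B) U}"
    have "U = (\<Union>w\<in>{w. w \<noteq> [] \<and> cyl w \<subseteq> U}. cyl w)"
    proof (intro equalityI subsetI)
      fix x assume x: "x \<in> U"
      then obtain n where "cyl (map x [0..<Suc n]) \<subseteq> U" using openin_shiftD U by blast
      moreover have "x \<in> S" using U x openin_subset[of "shift_topology B" U] by auto
      ultimately show "x \<in> (\<Union>w\<in>{w. w \<noteq> [] \<and> cyl w \<subseteq> U}. cyl w)"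
        by (intro UN_I[of "map x [0..<Suc n]"] mem_cyl_prefix) (auto simp del: upt_Suc)
    qed auto
    also have "\<dots> \<in> sigma_sets S (cylinders B)"
      by (intro sigma_sets_UNION) (auto simp: cylinders_def intro!: sigma_sets.Basic)
    finally show "U \<in> sigma_sets S (cylinders B)" .
  next
    fix C assume "C \<in> cylinders B"
    then show "C \<in> sigma_sets S {U. openin (shift_topology B) U}"
      using openin_cyl by (auto simp: cylinders_def)
  qed
  finally show ?thesis .
qed

lemma space_SB[simp]: "space SB = S"
  by (simp add: borel_of_def space_measure_of_conv)

lemma cyl_sets[measurable]: "cyl w \<in> sets SB"
proof (cases "w = []")
  case True
  then show ?thesis using sets.top[of SB] by simp
next
  case False
  then show ?thesis by (auto simp: sets_SB cylinders_def)
qed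

lemma measurable_coordinate[measurable]: "(\<lambda>x. x n) \<in> measurable SB (count_space UNIV)"
proof -
  have "(\<lambda>x. x n) -` {a} \<inter> S \<in> sets SB" for a
  proof -
    have "(\<lambda>x. x n) -` {a} \<inter> S = (\<Union>w\<in>{w. length w = Suc n \<and> w ! n = a}. cyl w)"
    proof (intro equalityI subsetI)
      fix x assume "x \<in> (\<lambda>x. x n) -` {a} \<inter> S"
      then show "x \<in> (\<Union>w\<in>{w. length w = Suc n \<and> w ! n = a}. cyl w)"
        by (intro UN_I[of "map x [0..<Suc n]"] mem_cyl_prefix) (auto simp del: upt_Suc)
    qed (auto simp: cylinder_def)
    also have "\<dots> \<in> sets SB" by (intro sets.countable_UN'') auto
    finally show ?thesis .
  qed
  then show ?thesis by (subst measurable_count_space_eq2_countable) auto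
qed

lemma measurable_shift[measurable]: "shift \<in> measurable SB SB"
proof (rule measurable_sigma_sets[OF sets_SB])
  show "cylinders B \<subseteq> Pow S" using cyl_subset by (auto simp: cylinders_def)
  show "shift \<in> space SB \<rightarrow> S" using shift_in_S by auto
  fix C assume "C \<in> cylinders B"
  then obtain w where C: "C = cyl w" by (auto simp: cylinders_def)
  have "shift -` C \<inter> space SB = {x \<in> space SB. \<forall>j<length w. x (Suc j) = w ! j}"
    using shift_in_S by (auto simp: C cylinder_def shift_apply)
  also have "\<dots> \<in> sets SB" by measurable
  finally show "shift -` C \<inter> space SB \<in> sets SB" .
qed

lemma cyl_Int: "cyl w \<inter> cyl v \<in> {{}, cyl w, cyl v}"
proof -
  have *: "cyl w \<inter> cyl v \<in> {{}, cyl v}" if "length w \<le> length v" for w v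
  proof (cases "take (length w) v = w")
    case True
    then have "w ! j = v ! j" if "j < length w" for j using that by (metis nth_take)
    with that have "cyl w \<inter> cyl v = cyl v" by (auto simp: cylinder_def)
    then show ?thesis by simp
  next
    case False
    moreover have "take (length w) v = w" if "\<forall>j<length w. w ! j = v ! j"
      using that \<open>length w \<le> length v\<close> by (intro nth_equalityI) auto
    ultimately obtain j where "j < length w" "w ! j \<noteq> v ! j" by blast
    with that have "cyl w \<inter> cyl v = {}" by (force simp: cylinder_def)
    then show ?thesis by simp
  qed
  show ?thesis
    using *[of w v] *[of v w] by (cases "length w \<le> length v") (auto simp: Int_commute)
qed

text \<open>Two cylinders are nested or disjoint. The empty set is inserted for the disjoint case,
  since it need not be a cylinder itself.\<close>

lemma Int_stable_cylinders: "Int_stable (insert {} (cylinders B))"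
proof (rule Int_stableI)
  fix a b assume "a \<in> insert {} (cylinders B)" "b \<in> insert {} (cylinders B)"
  moreover from this have "a \<inter> b \<in> {{}, a, b}"
    using cyl_Int unfolding cylinders_def by blast
  ultimately show "a \<inter> b \<in> insert {} (cylinders B)"
    by (metis empty_iff insert_iff)
qed

lemma sets_SB': "sets SB = sigma_sets S (insert {} (cylinders B))"
  unfolding sets_SB by (rule sigma_sets_eqI) (auto intro: sigma_sets.Empty)

lemma measure_eqI_cyl:
  assumes \<mu>: "sets \<mu> = sets SB" and \<nu>: "sets \<nu> = sets SB" and fin: "emeasure \<mu> S \<noteq> \<infinity>"
    and eq: "\<And>w. w \<noteq> [] \<Longrightarrow> emeasure \<mu> (cyl w) = emeasure \<nu> (cyl w)"
  shows "\<mu> = \<nu>"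
proof (rule measure_eqI_generator_eq[OF Int_stable_cylinders])
  show "insert {} (cylinders B) \<subseteq> Pow S" using cyl_subset by (auto simp: cylinders_def)
  show "emeasure \<mu> X = emeasure \<nu> X" if "X \<in> insert {} (cylinders B)" for X
    using that eq by (auto simp: cylinders_def)
  show "sets \<mu> = sigma_sets S (insert {} (cylinders B))"
    "sets \<nu> = sigma_sets S (insert {} (cylinders B))"
    using \<mu> \<nu> sets_SB' by auto
  show "range (\<lambda>a. cyl [a]) \<subseteq> insert {} (cylinders B)" by (auto simp: cylinders_def)
  show "(\<Union>a. cyl [a]) = S" by (auto simp: cylinder_def)
  show "emeasure \<mu> (cyl [a]) \<noteq> \<infinity>" for a
    using emeasure_mono[of "cyl [a]" S \<mu>] fin cyl_subset \<mu> cyl_sets[of "[]"]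
    by (auto simp: top_unique)
qed

lemma
  assumes "\<mu> \<in> Inv"
  shows sets_Inv: "sets \<mu> = sets SB"
    and space_Inv: "space \<mu> = S"
    and emeasure_Inv_le: "emeasure \<mu> S \<le> 1"
    and subprob_space_emeasure_Inv: "emeasure \<mu> A \<le> 1"
    and finite_measure_Inv: "finite_measure \<mu>"
    and distr_Inv: "distr \<mu> \<mu> shift = \<mu>"
    and measure_preserving_Inv: "measure_preserving \<mu> shift"
proof -
  show s: "sets \<mu> = sets SB" and le: "emeasure \<mu> S \<le> 1"
    using assms by (auto simp: inv_subprob_measures_def)
  then show sp: "space \<mu> = S" using sets_eq_imp_space_eq[OF s] by simp
  show "emeasure \<mu> A \<le> 1" using emeasure_space[of \<mu> A] le sp by simp
  show f: "finite_measure \<mu>" using le sp by (intro finite_measureI) (auto simp: top_unique)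
  have m: "shift \<in> measurable \<mu> \<mu>" by (simp add: measurable_cong_sets[OF s s])
  show d: "distr \<mu> \<mu> shift = \<mu>"
  proof (rule measure_eqI)
    fix A assume "A \<in> sets (distr \<mu> \<mu> shift)"
    then show "emeasure (distr \<mu> \<mu> shift) A = emeasure \<mu> A"
      using assms m by (simp add: emeasure_distr sp inv_subprob_measures_def)
  qed simp
  show "measure_preserving \<mu> shift"
    using f m d by (simp add: measure_preserving_def measure_preserving_axioms_def)
qed

text \<open>The push-forward under the shift and the measure itself are then equal on an
  intersection-stable generator, hence everywhere.\<close>

lemma InvI:
  assumes s: "sets \<mu> = sets SB" and le: "emeasure \<mu> S \<le> 1"
    and eq: "\<And>w. w \<noteq> [] \<Longrightarrow> emeasure \<mu> (shift -` cyl w \<inter> S) = emeasure \<mu> (cyl w)"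
  shows "\<mu> \<in> Inv"
proof -
  have m: "shift \<in> measurable \<mu> SB" by (simp add: measurable_cong_sets[OF s refl])
  have sp: "space \<mu> = S" using sets_eq_imp_space_eq[OF s] by simp
  have "distr \<mu> SB shift = \<mu>"
  proof (rule measure_eqI_cyl)
    have "shift -` S \<inter> space \<mu> = space \<mu>" using shift_in_S sp by auto
    then show "emeasure (distr \<mu> SB shift) S \<noteq> \<infinity>"
      using le sp m emeasure_distr[OF m, of S] sets.top[of SB] by (auto simp: top_unique)
  qed (use s sp eq m in \<open>auto simp: emeasure_distr\<close>)
  then have "emeasure \<mu> (shift -` A \<inter> S) = emeasure \<mu> A" if "A \<in> sets \<mu>" for A
    using emeasure_distr[OF m, of A] that s sp by simp
  then show ?thesis using s le by (simp add: inv_subprob_measures_def)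
qed

lemma measure_eqI_Inv:
  assumes "\<mu> \<in> Inv" "\<nu> \<in> Inv" "\<And>w. w \<noteq> [] \<Longrightarrow> measure \<mu> (cyl w) = measure \<nu> (cyl w)"
  shows "\<mu> = \<nu>"
proof (rule measure_eqI_cyl[OF sets_Inv sets_Inv])
  show "emeasure \<mu> S \<noteq> \<infinity>" using emeasure_Inv_le[OF assms(1)] by (auto simp: top_unique)
  show "emeasure \<mu> (cyl w) = emeasure \<nu> (cyl w)" if "w \<noteq> []" for w
    using assms(3)[OF that] finite_measure.emeasure_eq_measure[OF finite_measure_Inv] assms by simp
qed fact+

definition coords :: "(nat \<Rightarrow> nat) measure \<Rightarrow> nat \<Rightarrow> real" where
  "coords \<mu> = (\<lambda>n. measure \<mu> (cyl (word n)))"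

definition "K = coords ` Inv"

lemma inj_coords: "inj_on coords Inv"
proof (rule inj_onI)
  fix \<mu> \<nu> assume *: "\<mu> \<in> Inv" "\<nu> \<in> Inv" "coords \<mu> = coords \<nu>"
  show "\<mu> = \<nu>"
  proof (rule measure_eqI_Inv[OF *(1,2)])
    fix w :: "nat list" assume "w \<noteq> []"
    then obtain n where "word n = w" using word_surj by blast
    then show "measure \<mu> (cyl w) = measure \<nu> (cyl w)"
      using fun_cong[OF *(3), of n] by (simp add: coords_def)
  qed
qed

lemma measure_Inv_le_1: "\<mu> \<in> Inv \<Longrightarrow> measure \<mu> A \<le> 1"
  using subprob_space_emeasure_Inv[of \<mu> A] by (simp add: measure_def enn2real_leI)

lemma K_bounds: "y \<in> K \<Longrightarrow> 0 \<le> y n \<and> y n \<le> 1"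
  by (auto simp: K_def coords_def measure_Inv_le_1)

section \<open>Convexity and the topology of convergence on cylinders\<close>

lemma
  assumes \<mu>: "\<mu> \<in> Inv" and \<nu>: "\<nu> \<in> Inv" and t: "0 \<le> t" "t \<le> 1"
  shows convex_comb_Inv: "convex_comb_measure t \<mu> \<nu> \<in> Inv"
    and coords_convex_comb: "coords (convex_comb_measure t \<mu> \<nu>) = (1 - t) *\<^sub>R coords \<mu> + t *\<^sub>R coords \<nu>"
proof -
  let ?c = "convex_comb_measure t \<mu> \<nu>"
  have s: "sets \<nu> = sets \<mu>" using sets_Inv \<mu> \<nu> by simp
  have sc: "sets ?c = sets SB"
    unfolding convex_comb_measure_def sets_Inv[OF \<mu>, symmetric] by (rule sets.sets_measure_of_eq)
  have e: "emeasure ?c A = ennreal (1 - t) * emeasure \<mu> A + ennreal t * emeasure \<nu> A"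
    if "A \<in> sets SB" for A
    unfolding convex_comb_measure_def using emeasure_measure_of_combination[OF s] that sets_Inv[OF \<mu>] by simp
  have eS: "emeasure ?c S \<le> 1"
  proof -
    have "emeasure ?c S = ennreal (1 - t) * emeasure \<mu> S + ennreal t * emeasure \<nu> S"
      using e[of S] sets.top[of SB] by simp
    also have "\<dots> \<le> ennreal (1 - t) * 1 + ennreal t * 1"
      using emeasure_Inv_le \<mu> \<nu> by (intro add_mono mult_left_mono) auto
    also have "\<dots> = 1" using t by (simp add: ennreal_plus[symmetric] del: ennreal_plus)
    finally show ?thesis .
  qed
  show "?c \<in> Inv"
  proof (rule InvI[OF sc eS])
    fix w
    have "shift -` cyl w \<inter> S \<in> sets SB" using measurable_sets[OF measurable_shift cyl_sets[of w]] by simp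
    then show "emeasure ?c (shift -` cyl w \<inter> S) = emeasure ?c (cyl w)"
      using \<mu> \<nu> sets_Inv[OF \<mu>] sets_Inv[OF \<nu>] by (simp add: e inv_subprob_measures_def)
  qed
  have "measure ?c A = (1 - t) * measure \<mu> A + t * measure \<nu> A" if "A \<in> sets SB" for A
    using e[OF that] t unfolding measure_def
    by (simp add: finite_measure.emeasure_eq_measure[OF finite_measure_Inv[OF \<mu>]]
        finite_measure.emeasure_eq_measure[OF finite_measure_Inv[OF \<nu>]]
        ennreal_mult'[symmetric] ennreal_plus[symmetric] del: ennreal_plus)
  then show "coords ?c = (1 - t) *\<^sub>R coords \<mu> + t *\<^sub>R coords \<nu>"
    by (simp add: coords_def fun_eq_iff scaleR_fun_def)
qed

lemma affine_coords: "affine_on_measures Inv coords"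
  by (auto simp: affine_on_measures_def coords_convex_comb)

lemma convex_K: "convex K"
  unfolding convex_alt
proof safe
  fix x y :: "nat \<Rightarrow> real" and u :: real
  assume "x \<in> K" "y \<in> K" and u: "0 \<le> u" "u \<le> 1"
  then obtain \<mu> \<nu> where \<mu>: "\<mu> \<in> Inv" "x = coords \<mu>" and \<nu>: "\<nu> \<in> Inv" "y = coords \<nu>"
    by (auto simp: K_def)
  show "(1 - u) *\<^sub>R x + u *\<^sub>R y \<in> K"
    unfolding \<mu> \<nu> coords_convex_comb[OF \<mu>(1) \<nu>(1) u, symmetric] K_def
    using convex_comb_Inv[OF \<mu>(1) \<nu>(1) u] by simp
qed

lemma openin_cylinder_convergence:
  assumes "w \<noteq> []" "open (U :: real set)"
  shows "openin (cylinder_convergence_topology B) {\<mu> \<in> Inv. measure \<mu> (cyl w) \<in> U}"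
  unfolding cylinder_convergence_topology_def
proof (rule topology_generated_by_Basis, intro CollectI exI conjI)
  show "cyl w \<in> cylinders B" using assms by (auto simp: cylinders_def)
  show "open U" by fact
qed (rule refl)

lemma topspace_cylinder_convergence[simp]: "topspace (cylinder_convergence_topology B) = Inv"
proof
  show "topspace (cylinder_convergence_topology B) \<subseteq> Inv"
    unfolding cylinder_convergence_topology_def topology_generated_by_topspace by blast
  show "Inv \<subseteq> topspace (cylinder_convergence_topology B)"
    using openin_subset[OF openin_cylinder_convergence[of "[0]" UNIV]] by simp
qed

text \<open>The coordinates of the product topology are the evaluations on cylinders, so both
  topologies are the coarsest ones for the same family of functions.\<close>

lemma homeomorphic_map_coords:
  "homeomorphic_map (cylinder_convergence_topology B) (subtopology euclidean K) coords"
proof -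
  let ?T = "cylinder_convergence_topology B"
  have "homeomorphic_maps ?T (subtopology euclidean K) coords (inv_into Inv coords)"
    unfolding homeomorphic_maps_def
  proof safe
    show "continuous_map ?T (subtopology euclidean K) coords"
    proof (rule continuous_map_into_subtopology)
      show "coords \<in> topspace ?T \<rightarrow> K" by (auto simp: K_def)
      have "continuous_map ?T (product_topology (\<lambda>_. euclidean) UNIV) coords"
        unfolding continuous_map_componentwise_UNIV
      proof
        fix n
        show "continuous_map ?T euclidean (\<lambda>\<mu>. coords \<mu> n)"
          unfolding continuous_map_def
        proof safe
          fix U :: "real set" assume "openin euclidean U"
          then show "openin ?T {\<mu> \<in> topspace ?T. coords \<mu> n \<in> U}"
            unfolding topspace_cylinder_convergence coords_def open_openin[symmetric]
            by (intro openin_cylinder_convergence) auto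
        qed auto
      qed
      then show "continuous_map ?T euclidean coords" by (simp add: euclidean_product_topology)
    qed
    show "continuous_map (subtopology euclidean K) ?T (inv_into Inv coords)"
      unfolding cylinder_convergence_topology_def
    proof (rule continuous_on_generated_topo)
      fix V assume "V \<in> {{\<mu> \<in> Inv. measure \<mu> C \<in> U} | C U. C \<in> cylinders B \<and> open (U :: real set)}"
      then obtain w U where V: "V = {\<mu> \<in> Inv. measure \<mu> (cyl w) \<in> U}" "w \<noteq> []" "open U"
        by (auto simp: cylinders_def)
      obtain n where n: "word n = w" using word_surj V by auto
      have "V = {\<mu> \<in> Inv. coords \<mu> n \<in> U}" by (simp add: V coords_def n)
      then have "inv_into Inv coords -` V \<inter> topspace (subtopology euclidean K) = K \<inter> (\<lambda>y. y n) -` U"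
        by (auto simp: K_def inv_into_f_f[OF inj_coords])
      moreover have "open ((\<lambda>y::nat \<Rightarrow> real. y n) -` U)"
        using V(3) by (intro open_vimage continuous_on_product_coordinates)
      ultimately show "openin (subtopology euclidean K) (inv_into Inv coords -` V \<inter> topspace (subtopology euclidean K))"
        by (simp add: openin_open_Int)
    next
      show "inv_into Inv coords ` topspace (subtopology euclidean K) \<subseteq> 
        \<Union>{{\<mu> \<in> Inv. measure \<mu> C \<in> U} | C U. C \<in> cylinders B \<and> open (U :: real set)}"
        using inv_into_into[of _ coords Inv]
        unfolding topology_generated_by_topspace[symmetric] cylinder_convergence_topology_def[symmetric]
        by (auto simp: K_def)
    qed
  qed (auto simp: K_def inv_into_f_f[OF inj_coords] f_inv_into_f)
  then show ?thesis using homeomorphic_map_maps by blast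
qed

end

section \<open>Measures with prescribed weights on cylinders\<close>

lemma map_fun_upd_upt: "map (fun_upd \<omega> n a) [0..<Suc n] = map \<omega> [0..<n] @ [a]"
  by (auto intro: map_cong)

text \<open>The Ionescu-Tulcea theorem, applied to the process that continues the word
  \<open>w\<close> with the symbol \<open>a\<close> with probability
  \<open>y (w @ [a]) / y w\<close>.\<close>

lemma ex_prob_measure_of_word_weights:
  fixes y :: "nat list \<Rightarrow> real"
  assumes nonneg: "\<And>w. 0 \<le> y w"
    and sums: "\<And>w. (\<lambda>a. y (w @ [a])) sums y w"
    and one: "y [] = 1"
  shows "\<exists>N. sets N = sets (PiM UNIV (\<lambda>_::nat. count_space (UNIV::nat set))) \<and>
    (\<forall>w. emeasure N {x. map x [0..<length w] = w} = ennreal (y w))"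
proof -
  define M :: "nat \<Rightarrow> nat measure" where "M = (\<lambda>_. count_space UNIV)"
  \<comment> \<open>After a word of weight 0 the quotient makes no sense, and any probability
    measure will do: all extensions of such a word have weight 0 as well, so the formula
    \<open>mult_p\<close> below holds in both cases.\<close>
  define p :: "nat list \<Rightarrow> nat measure" where
    "p w = (if 0 < y w then density (count_space UNIV) (\<lambda>a. ennreal (y (w @ [a]) / y w))
      else return (count_space UNIV) 0)" for w
  have sets_p: "sets (p w) = sets (count_space UNIV)" for w by (simp add: p_def)
  have prob_p: "prob_space (p w)" for w
  proof (cases "0 < y w")
    case True
    have "(\<lambda>a. y (w @ [a]) / y w) sums (y w / y w)" using sums by (rule sums_divide)
    then have s: "(\<lambda>a. y (w @ [a]) / y w) sums 1" using True by simp
    have "(\<integral>\<^sup>+a. ennreal (y (w @ [a]) / y w) \<partial>count_space UNIV) = (\<Sum>a. ennreal (y (w @ [a]) / y w))"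
      by (rule nn_integral_count_space_nat)
    also have "\<dots> = ennreal 1"
      using s True nonneg by (intro suminf_ennreal_eq) auto
    finally show ?thesis
      using True by (intro prob_spaceI) (simp add: p_def emeasure_density)
  next
    case False
    then show ?thesis by (simp add: p_def prob_space_return)
  qed
  have mult_p: "ennreal (y w) * emeasure (p w) {a} = ennreal (y (w @ [a]))" for w a
  proof (cases "0 < y w")
    case True
    then show ?thesis
      using nonneg by (simp add: p_def emeasure_density nn_integral_count_space_indicator[symmetric]
          one_ennreal_def[symmetric] ennreal_mult'[symmetric] nn_integral_count_space_finite
          nn_integral_indicator_singleton')
  next
    case False
    then have "y w = 0" using nonneg[of w] by simp
    moreover have "y (w @ [a]) \<le> y w"
      using sum_le_suminf[of "\<lambda>a. y (w @ [a])" "{a}"] sums[of w] nonneg by (auto simp: sums_iff)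
    ultimately show ?thesis using nonneg[of "w @ [a]"] by simp
  qed
  define P where "P i \<omega> = p (map \<omega> [0..<i])" for i and \<omega> :: "nat \<Rightarrow> nat"
  have PiM_eq: "PiM {0..<i} M = count_space (PiE {0..<i} (\<lambda>_. UNIV))" for i
    unfolding M_def by (intro count_space_PiM_finite) auto
  interpret Ionescu_Tulcea P M
  proof (rule Ionescu_Tulcea.intro)
    fix i
    have "P i \<omega> \<in> space (subprob_algebra (M i))" for \<omega>
      using prob_p[of "map \<omega> [0..<i]"] sets_p
      by (auto simp: P_def M_def space_subprob_algebra intro: prob_space_imp_subprob_space)
    then show "P i \<in> measurable (PiM {0..<i} M) (subprob_algebra (M i))"
      unfolding PiM_eq by simp
  qed (simp add: P_def prob_p)
  \<comment> \<open>The only point of the product over the empty index set, from which the kernels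
    start.\<close>
  let ?u = "\<lambda>_::nat. undefined :: nat"
  define Z where "Z w = {x \<in> PiE {0..<length w} (\<lambda>_. UNIV). map x [0..<length w] = w}" for w :: "nat list"
  have Z_sets[measurable]: "Z w \<in> sets (PiM {0..<length w} M)" for w
    unfolding PiM_eq by (auto simp: Z_def)
  have CZ: "emeasure (C 0 (length w) ?u) (Z w) = ennreal (y w)" for w
  proof (induction w rule: rev_induct)
    case Nil
    then show ?case
      using Z_sets[of "[]"] by (simp add: one Z_def emeasure_return indicator_def)
  next
    case (snoc a w)
    have u: "?u \<in> space (PiM {0..<0} M)" by (simp add: space_PiM)
    have [measurable_cong]: "sets (C 0 (length w) ?u) = sets (PiM {0..<length w} M)"
      using sets_C[OF u] by simp
    have sp: "space (C 0 (length w) ?u) = PiE {0..<length w} (\<lambda>_. UNIV)"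
      using space_C[OF u] by (simp add: PiM_eq)
    have eP_meas: "eP (length w) \<in> measurable (C 0 (length w) ?u) (subprob_algebra (PiM {0..<Suc (length w)} M))"
      using measurable_eP by measurable
    have eP: "emeasure (eP (length w) \<omega>) (Z (w @ [a])) = emeasure (p w) {a} * indicator (Z w) \<omega>"
      if "\<omega> \<in> PiE {0..<length w} (\<lambda>_. UNIV)" for \<omega>
    proof -
      have "emeasure (eP (length w) \<omega>) (Z (w @ [a]))
        = P (length w) \<omega> ((\<lambda>x. fun_upd \<omega> (length w) x) -` Z (w @ [a]) \<inter> space (M (length w)))"
        using that Z_sets[of "w @ [a]"] by (intro emeasure_eP) (auto simp: PiM_eq)
      also have "(\<lambda>x. fun_upd \<omega> (length w) x) -` Z (w @ [a]) \<inter> space (M (length w))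
        = (if \<omega> \<in> Z w then {a} else {})"
        using that
        by (auto simp: Z_def M_def map_fun_upd_upt PiE_iff extensional_def simp del: upt_Suc)
      also have "P (length w) \<omega> (if \<omega> \<in> Z w then {a} else {}) = p w {a} * indicator (Z w) \<omega>"
        by (auto simp: P_def Z_def)
      finally show ?thesis .
    qed
    have "emeasure (C 0 (Suc (length w)) ?u) (Z (w @ [a]))
      = (\<integral>\<^sup>+\<omega>. emeasure (eP (length w) \<omega>) (Z (w @ [a])) \<partial>C 0 (length w) ?u)"
      using eP_meas sp Z_sets[of "w @ [a]"] by (simp add: emeasure_bind[where N="PiM {0..<Suc (length w)} M"] PiE_eq_empty_iff)
    also have "\<dots> = (\<integral>\<^sup>+\<omega>. emeasure (p w) {a} * indicator (Z w) \<omega> \<partial>C 0 (length w) ?u)"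
      using sp eP by (intro nn_integral_cong) auto
    also have "\<dots> = emeasure (p w) {a} * emeasure (C 0 (length w) ?u) (Z w)"
      by (intro nn_integral_cmult_indicator) measurable
    finally show ?case using snoc mult_p[of w a] by (simp add: mult.commute)
  qed
  have "emeasure PF.lim {x. map x [0..<length w] = w} = ennreal (y w)" for w
  proof -
    have "{x. map x [0..<length w] = w} = PF.emb UNIV {0..<length w} (Z w)"
    proof (rule set_eqI)
      fix x :: "nat \<Rightarrow> nat"
      have "map (restrict x {0..<length w}) [0..<length w] = map x [0..<length w]"
        by (intro map_cong) auto
      then show "x \<in> {x. map x [0..<length w] = w} \<longleftrightarrow> x \<in> PF.emb UNIV {0..<length w} (Z w)"
        unfolding prod_emb_def Z_def M_def
        by (simp only: vimage_eq Int_iff mem_Collect_eq restrict_PiE_iff space_count_space PiE_UNIV_domain)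
          simp
    qed
    then have "emeasure PF.lim {x. map x [0..<length w] = w} = emeasure (CI {0..<length w}) (Z w)"
      using lim[of "{0..<length w}" "Z w"] by simp
    also have "\<dots> = emeasure (C 0 (length w) ?u) (PF.emb {0..<length w} {0..<length w} (Z w))"
      by (intro emeasure_CI) auto
    also have "PF.emb {0..<length w} {0..<length w} (Z w) = Z w"
      using sets.sets_into_space[OF Z_sets] by (intro prod_emb_id) (auto simp: space_PiM PiM_eq M_def)
    finally show ?thesis using CZ by simp
  qed
  moreover have "sets PF.lim = sets (PiM UNIV (\<lambda>_. count_space UNIV))"
    using PF.sets_lim unfolding M_def .
  ultimately show ?thesis by blast
qed

context markov
begin

lemma ex_in_S_starting_at: "\<exists>x\<in>S. x 0 = i"
proof -
  define f where "f i = (SOME j. B i j \<noteq> 0)" for i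
  have "B i (f i) \<noteq> 0" for i
    unfolding f_def using transition by (intro someI_ex[of "\<lambda>j. B i j \<noteq> 0"]) (simp add: transition_matrix_def)
  moreover have "B i (f i) \<in> {0, 1}" for i using transition unfolding transition_matrix_def by blast
  ultimately have "B i (f i) = 1" for i by (metis insertE singletonD)
  then have "(\<lambda>n. (f ^^ n) i) \<in> S" by (simp add: markov_shift_def)
  then show ?thesis by (intro bexI[of _ "\<lambda>n. (f ^^ n) i"]) simp_all
qed

lemma S_nonempty: "S \<noteq> {}"
  using ex_in_S_starting_at by blast

text \<open>Normalise the weights and take the resulting probability measure on all sequences.
  Almost no sequence has a prefix with empty cylinder, and a sequence without such a prefix lies in
  \<open>S\<close>. Finally move the measure to \<open>S\<close> and undo the normalisation.\<close>

lemma ex_measure_of_word_weights: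
  assumes nonneg: "\<And>w. 0 \<le> y w"
    and sums: "\<And>w. (\<lambda>a. y (w @ [a])) sums y w"
    and supp: "\<And>w. cyl w = {} \<Longrightarrow> y w = 0"
  shows "\<exists>\<mu>. sets \<mu> = sets SB \<and> (\<forall>w. emeasure \<mu> (cyl w) = ennreal (y w))"
proof (cases "y [] = 0")
  case True
  have "y w = 0" for w
  proof (induction w rule: rev_induct)
    case (snoc a w)
    have "y (w @ [a]) \<le> y w"
      using sum_le_suminf[of "\<lambda>a. y (w @ [a])" "{a}"] sums[of w] nonneg by (auto simp: sums_iff)
    then show ?case using snoc nonneg[of "w @ [a]"] by simp
  qed (rule True)
  then show ?thesis by (intro exI[of _ "null_measure SB"]) simp
next
  case False
  then have t: "0 < y []" using nonneg[of "[]"] by simp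
  obtain N where sN: "sets N = sets (PiM UNIV (\<lambda>_::nat. count_space (UNIV::nat set)))"
    and N: "\<And>w. emeasure N {x. map x [0..<length w] = w} = ennreal (y w / y [])"
    using ex_prob_measure_of_word_weights[of "\<lambda>w. y w / y []"] nonneg t sums_divide[OF sums] by auto
  have [measurable]: "(\<lambda>x. x n) \<in> measurable N (count_space UNIV)" for n
    unfolding measurable_cong_sets[OF sN refl] by (rule measurable_component_singleton) simp
  have spN: "space N = UNIV" using sets_eq_imp_space_eq[OF sN] by (simp add: space_PiM)
  have word_sets: "{x. map x [0..<length w] = w} \<in> sets N" for w
  proof -
    have "{x. map x [0..<length w] = w} = {x \<in> space N. \<forall>j<length w. x j = w ! j}"
      by (simp only: map_upt_eq_iff spN UNIV_I simp_thms)
    also have "\<dots> \<in> sets N" by measurable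
    finally show ?thesis .
  qed
  have S_sets: "S \<in> sets N"
  proof -
    have "S = {x \<in> space N. \<forall>n. B (x n) (x (Suc n)) = 1}" by (simp add: markov_shift_def spN)
    also have "\<dots> \<in> sets N" by measurable
    finally show ?thesis .
  qed
  have "AE x in N. \<forall>w. cyl w = {} \<longrightarrow> map x [0..<length w] \<noteq> w"
    unfolding AE_all_countable
  proof
    fix w
    have "{x. map x [0..<length w] = w} \<in> null_sets N" if "cyl w = {}"
      using supp[OF that] N[of w] word_sets by auto
    then show "AE x in N. cyl w = {} \<longrightarrow> map x [0..<length w] \<noteq> w"
      by (cases "cyl w = {}") (auto intro: AE_I')
  qed
  then have AE_S: "AE x in N. x \<in> S"
  proof eventually_elim
    case (elim x)
    have "B (x n) (x (Suc n)) = 1" for n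
    proof -
      let ?w = "map x [0..<Suc (Suc n)]"
      have "cyl ?w \<noteq> {}" using elim[rule_format, of ?w] by (auto simp del: upt_Suc)
      then obtain z where z: "z \<in> S" "map z [0..<length ?w] = ?w"
        using mem_cyl_iff by blast
      then have "\<forall>j<Suc (Suc n). z j = x j"
        unfolding length_map length_upt diff_zero map_take_upt by simp
      then have "z n = x n" "z (Suc n) = x (Suc n)" by auto
      moreover have "B (z n) (z (Suc n)) = 1" using z(1) by (simp add: markov_shift_def)
      ultimately show ?thesis by simp
    qed
    then show ?case by (simp add: markov_shift_def)
  qed
  obtain x0 where x0: "x0 \<in> S" using S_nonempty by blast
  \<comment> \<open>A retraction onto \<open>S\<close>; the points sent to \<open>x0\<close> form a
    null set, so the push-forward has the same values on cylinders.\<close>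
  define f where "f x = (if x \<in> S then x else x0)" for x
  have f: "f \<in> measurable N SB"
  proof (rule measurable_sigma_sets[OF sets_SB])
    show "cylinders B \<subseteq> Pow S" using cyl_subset by (auto simp: cylinders_def)
    show "f \<in> space N \<rightarrow> S" using x0 by (auto simp: f_def)
    fix C assume "C \<in> cylinders B"
    then obtain w where C: "C = cyl w" by (auto simp: cylinders_def)
    have "f -` C \<inter> space N = (S \<inter> {x. map x [0..<length w] = w}) \<union> (if x0 \<in> C then space N - S else {})"
      using x0 by (auto simp: C f_def spN mem_cyl_iff split: if_splits)
    then show "f -` C \<inter> space N \<in> sets N" using S_sets word_sets by auto
  qed
  have "emeasure (distr N SB f) (cyl w) = ennreal (y w / y [])" for w
  proof -
    have "emeasure (distr N SB f) (cyl w) = emeasure N (f -` cyl w \<inter> space N)"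
      using f by (simp add: emeasure_distr)
    also have "\<dots> = emeasure N {x. map x [0..<length w] = w}"
    proof (rule emeasure_eq_AE)
      show "AE x in N. (x \<in> f -` cyl w \<inter> space N) = (x \<in> {x. map x [0..<length w] = w})"
        using AE_S by eventually_elim (simp add: f_def mem_cyl_iff spN)
    qed (use measurable_sets[OF f cyl_sets] word_sets in auto)
    finally show ?thesis by (simp add: N)
  qed
  then show ?thesis
    using t nonneg
    by (intro exI[of _ "scale_measure (ennreal (y [])) (distr N SB f)"])
      (simp add: ennreal_mult'[symmetric])
qed

lemma shift_vimage_cyl: "shift -` cyl w \<inter> S = (\<Union>a. cyl (a # w))"
proof (intro equalityI subsetI)
  fix x assume "x \<in> shift -` cyl w \<inter> S"
  then have "x \<in> cyl (x 0 # w)" by (auto simp: cylinder_def nth_Cons shift_apply split: nat.split)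
  then show "x \<in> (\<Union>a. cyl (a # w))" by blast
next
  fix x assume "x \<in> (\<Union>a. cyl (a # w))"
  then obtain a where x: "x \<in> S" "\<forall>j<length (a # w). x j = (a # w) ! j" by (auto simp: cylinder_def)
  then have "x (Suc j) = w ! j" if "j < length w" for j using that by force
  then show "x \<in> shift -` cyl w \<inter> S" using x(1) shift_in_S by (auto simp: cylinder_def shift_apply)
qed

lemma disjoint_cyl: "length v = length w \<Longrightarrow> v \<noteq> w \<Longrightarrow> cyl v \<inter> cyl w = {}"
  by (force simp: mem_cyl_iff)

text \<open>
  A finite measure whose push-forward does not exceed it on cylinders is invariant, because
  both measures have the same mass.
\<close>

lemma ex_Inv_of_word_weights:
  fixes y :: "nat list \<Rightarrow> real"
  assumes nonneg: "\<And>w. w \<noteq> [] \<Longrightarrow> 0 \<le> y w"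
    and sums: "\<And>w. w \<noteq> [] \<Longrightarrow> (\<lambda>a. y (w @ [a])) sums y w"
    and total: "summable (\<lambda>a. y [a])" "(\<Sum>a. y [a]) \<le> 1"
    and left: "\<And>w n. w \<noteq> [] \<Longrightarrow> (\<Sum>a<n. y (a # w)) \<le> y w"
    and supp: "\<And>w. w \<noteq> [] \<Longrightarrow> cyl w = {} \<Longrightarrow> y w = 0"
  shows "\<exists>\<mu>\<in>Inv. \<forall>w. w \<noteq> [] \<longrightarrow> measure \<mu> (cyl w) = y w"
proof -
  \<comment> \<open>The weight of the empty word is not among the data; additivity leaves the sum
    over the one-letter words as its only possible value.\<close>
  define Y where "Y w = (if w = [] then (\<Sum>a. y [a]) else y w)" for w
  have Y0: "0 \<le> Y []" using nonneg total by (simp add: Y_def suminf_nonneg)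
  have "\<exists>\<mu>. sets \<mu> = sets SB \<and> (\<forall>w. emeasure \<mu> (cyl w) = ennreal (Y w))"
  proof (rule ex_measure_of_word_weights)
    show "0 \<le> Y w" for w using nonneg Y0 by (cases "w = []") (auto simp: Y_def)
    show "(\<lambda>a. Y (w @ [a])) sums Y w" for w
      using sums total by (cases "w = []") (auto simp: Y_def summable_sums)
    show "Y w = 0" if "cyl w = {}" for w using that supp S_nonempty by (cases "w = []") (auto simp: Y_def)
  qed
  then obtain \<mu> where s: "sets \<mu> = sets SB" and \<mu>: "\<And>w. emeasure \<mu> (cyl w) = ennreal (Y w)" by blast
  have sp: "space \<mu> = S" using sets_eq_imp_space_eq[OF s] by simp
  have eS: "emeasure \<mu> S = ennreal (Y [])" using \<mu>[of "[]"] by simp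
  interpret finite_measure \<mu> using eS sp by (intro finite_measureI) simp
  have m: "shift \<in> measurable \<mu> SB" by (simp add: measurable_cong_sets[OF s refl])
  define \<nu> where "\<nu> = distr \<mu> SB shift"
  have \<nu>: "emeasure \<nu> A = emeasure \<mu> (shift -` A \<inter> S)" if "A \<in> sets SB" for A
    using emeasure_distr[OF m that] by (simp add: \<nu>_def sp)
  have \<nu>S: "emeasure \<nu> S = emeasure \<mu> S"
  proof -
    have "shift -` S \<inter> S = S" using shift_in_S by auto
    then show ?thesis using \<nu>[of S] sets.top[of SB] by simp
  qed
  interpret N: finite_measure \<nu>
    using eS \<nu>S by (intro finite_measureI) (simp add: \<nu>_def)
  have le: "emeasure \<nu> (cyl w) \<le> emeasure \<mu> (cyl w)" if "w \<noteq> []" for w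
  proof -
    have "emeasure \<nu> (cyl w) = emeasure \<mu> (\<Union>a. cyl (a # w))"
      by (simp add: \<nu> shift_vimage_cyl)
    also have "\<dots> = (\<Sum>a. emeasure \<mu> (cyl (a # w)))"
      using disjoint_cyl by (intro suminf_emeasure[symmetric]) (auto simp: disjoint_family_on_def s)
    also have "\<dots> = (\<Sum>a. ennreal (y (a # w)))" by (simp add: \<mu> Y_def)
    also have "\<dots> \<le> ennreal (y w)"
      using left[OF that] nonneg by (intro suminf_le_const) (auto simp: sum_ennreal intro!: ennreal_leI)
    also have "\<dots> = emeasure \<mu> (cyl w)" using that by (simp add: \<mu> Y_def)
    finally show ?thesis .
  qed
  have eq: "emeasure \<nu> (cyl w) = emeasure \<mu> (cyl w)" if "w \<noteq> []" for w
  proof -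
    \<comment> \<open>The complement of a cylinder is the union of the other cylinders of the same
      length, on which the inequality holds too. With equal total masses, a strict inequality on one
      of them is impossible.\<close>
    define I where "I = {v. length v = length w \<and> v \<noteq> w}"
    have un: "S - cyl w = (\<Union>v\<in>I. cyl v)"
    proof (intro equalityI subsetI)
      fix x assume x: "x \<in> S - cyl w"
      then have "map x [0..<length w] \<in> I" by (auto simp: I_def mem_cyl_iff)
      then show "x \<in> (\<Union>v\<in>I. cyl v)" using x mem_cyl_prefix by blast
    qed (use disjoint_cyl cyl_subset in \<open>auto simp: I_def\<close>)
    have "emeasure \<nu> (S - cyl w) = (\<integral>\<^sup>+v. emeasure \<nu> (cyl v) \<partial>count_space I)"
      unfolding un using disjoint_cyl
      by (intro emeasure_UN_countable) (auto simp: disjoint_family_on_def I_def \<nu>_def)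
    also have "\<dots> \<le> (\<integral>\<^sup>+v. emeasure \<mu> (cyl v) \<partial>count_space I)"
      using that by (intro nn_integral_mono le) (auto simp: I_def)
    also have "\<dots> = emeasure \<mu> (S - cyl w)"
      unfolding un using disjoint_cyl
      by (intro emeasure_UN_countable[symmetric]) (auto simp: disjoint_family_on_def I_def s)
    finally have "measure \<nu> (S - cyl w) \<le> measure \<mu> (S - cyl w)"
      by (simp add: N.emeasure_eq_measure emeasure_eq_measure)
    moreover have "measure \<nu> S = measure \<mu> S" using \<nu>S by (simp add: measure_def)
    moreover have "measure \<nu> (S - cyl w) = measure \<nu> S - measure \<nu> (cyl w)"
      using sets.top[of SB] by (intro N.finite_measure_Diff cyl_subset) (auto simp: \<nu>_def)
    moreover have "measure \<mu> (S - cyl w) = measure \<mu> S - measure \<mu> (cyl w)"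
      using sets.top[of SB] by (intro finite_measure_Diff cyl_subset) (auto simp: s)
    moreover have "measure \<nu> (cyl w) \<le> measure \<mu> (cyl w)"
      using le[OF that] by (simp add: N.emeasure_eq_measure emeasure_eq_measure)
    ultimately show ?thesis by (simp add: N.emeasure_eq_measure emeasure_eq_measure)
  qed
  have "\<mu> \<in> Inv"
    using eq \<nu> s eS total by (intro InvI) (auto simp: Y_def)
  moreover have "measure \<mu> (cyl w) = y w" if "w \<noteq> []" for w
    using \<mu>[of w] that nonneg by (simp add: measure_def Y_def)
  ultimately show ?thesis by blast
qed

section \<open>Uniform tail bounds and compactness\<close>

definition no_return :: "nat \<Rightarrow> nat \<Rightarrow> (nat \<Rightarrow> nat) set" where
  "no_return i k = {x \<in> S. x 0 = i \<and> (\<forall>j\<in>{1..k}. x j \<noteq> i)}"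

lemma no_return_sets[measurable]: "no_return i k \<in> sets SB"
proof -
  have "no_return i k = {x \<in> space SB. x 0 = i \<and> (\<forall>j\<in>{1..k}. x j \<noteq> i)}" by (simp add: no_return_def)
  also have "\<dots> \<in> sets SB" by measurable
  finally show ?thesis .
qed

text \<open>
  The events that the last visit to \<open>i\<close> before time \<open>k\<close> takes place at time \<open>t\<close> are disjoint,
  and each has at least the measure of \<open>no_return i k\<close>.
\<close>

lemma measure_no_return_le:
  assumes \<mu>: "\<mu> \<in> Inv"
  shows "measure \<mu> (no_return i k) \<le> 1 / (real k + 1)"
proof -
  interpret measure_preserving \<mu> shift by (rule measure_preserving_Inv[OF \<mu>])
  have sp: "space \<mu> = S" and s: "sets \<mu> = sets SB" using space_Inv sets_Inv \<mu> by auto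
  define D where "D t = (shift ^^ t) -` no_return i (k - t) \<inter> space \<mu>" for t
  have D: "D t \<in> sets \<mu>" for t
    unfolding D_def using s by (intro measurable_sets[OF funpow_T]) simp
  have "disjoint_family_on D {..k}"
  proof -
    have "D s \<inter> D t = {}" if "s < t" "t \<le> k" for s t
    proof (rule ccontr)
      assume "D s \<inter> D t \<noteq> {}"
      then obtain x where "x \<in> D s" "x \<in> D t" by blast
      then have "\<forall>j\<in>{1..k - s}. x (s + j) \<noteq> i" "x t = i"
        by (auto simp: D_def no_return_def)
      moreover have "t - s \<in> {1..k - s}" "s + (t - s) = t" using that by auto
      ultimately show False by metis
    qed
    then show ?thesis
      unfolding disjoint_family_on_def by (metis Int_commute atMost_iff linorder_neqE_nat)
  qed
  then have "(\<Sum>t\<le>k. measure \<mu> (D t)) = measure \<mu> (\<Union>t\<le>k. D t)"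
    using D by (intro finite_measure_finite_Union[symmetric]) auto
  also have "\<dots> \<le> 1" by (rule measure_Inv_le_1[OF \<mu>])
  finally have sum: "(\<Sum>t\<le>k. measure \<mu> (D t)) \<le> 1" .
  have "(\<Sum>t\<le>k. measure \<mu> (no_return i k)) \<le> (\<Sum>t\<le>k. measure \<mu> (D t))"
  proof (rule sum_mono)
    fix t
    have "no_return i k \<subseteq> no_return i (k - t)" by (auto simp: no_return_def)
    then have "measure \<mu> (no_return i k) \<le> measure \<mu> (no_return i (k - t))"
      using s by (intro finite_measure_mono) simp_all
    also have "\<dots> = measure \<mu> (D t)"
      unfolding D_def using s by (intro measure_funpow[symmetric]) simp
    finally show "measure \<mu> (no_return i k) \<le> measure \<mu> (D t)" .
  qed
  with sum show ?thesis by (simp add: field_simps)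
qed

definition loop_successors :: "nat \<Rightarrow> nat \<Rightarrow> nat set" where
  "loop_successors i n = {x 1 | x. x \<in> S \<and> x 0 = i \<and> (\<exists>k\<in>{1..n}. x k = i)}"

text \<open>A return after \<open>k\<close> steps is witnessed by an admissible word of length
  \<open>k + 1\<close> from \<open>i\<close> to \<open>i\<close>, and the F-property leaves finitely
  many of these for each \<open>k\<close>.\<close>

lemma finite_loop_successors:
  assumes "F_property B"
  shows "finite (loop_successors i n)"
proof -
  let ?W = "\<lambda>k. {w. length w = Suc k \<and> admissible B w \<and> hd w = i \<and> last w = i}"
  have "loop_successors i n \<subseteq> (\<Union>k\<in>{1..n}. (\<lambda>w. w ! 1) ` ?W k)"
  proof
    fix a assume "a \<in> loop_successors i n"
    then obtain x k where x: "x \<in> S" "x 0 = i" "x k = i" "k \<in> {1..n}" "a = x 1"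
      by (auto simp: loop_successors_def)
    let ?w = "map x [0..<Suc k]"
    have "x \<in> cyl ?w" by (rule mem_cyl_prefix[OF x(1)])
    then have "?w \<in> ?W k"
      using x by (auto simp: admissible_def hd_map simp del: upt_Suc) (auto simp: hd_append)
    moreover have "a = ?w ! 1" using x by (simp add: nth_append nth_map_upt del: upt_Suc)
    ultimately show "a \<in> (\<Union>k\<in>{1..n}. (\<lambda>w. w ! 1) ` ?W k)" using x(4) by blast
  qed
  moreover have "finite (?W k)" for k using assms unfolding F_property_def by simp
  ultimately show ?thesis by (meson finite_UN_I finite_atLeastAtMost finite_imageI finite_subset)
qed

text \<open>Uniform tightness: neither the finite set of successors nor the error depends on \<mu>.
  A point of the cylinder whose orbit comes back to the last symbol of \<open>w\<close> within
  \<open>n\<close> steps continues with a loop successor; by invariance, the other points have at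
  most the measure of \<open>no_return (last w) n\<close>.\<close>

lemma measure_cyl_le:
  assumes \<mu>: "\<mu> \<in> Inv" and F: "F_property B" and w: "w \<noteq> []"
  shows "measure \<mu> (cyl w) \<le> (\<Sum>a\<in>loop_successors (last w) n. measure \<mu> (cyl (w @ [a]))) + 1 / (real n + 1)"
proof -
  interpret measure_preserving \<mu> shift by (rule measure_preserving_Inv[OF \<mu>])
  have sp: "space \<mu> = S" and s: "sets \<mu> = sets SB" using space_Inv sets_Inv \<mu> by auto
  let ?m = "length w - 1"
  let ?A = "loop_successors (last w) n"
  let ?R = "(shift ^^ ?m) -` no_return (last w) n \<inter> space \<mu>"
  have R: "?R \<in> sets \<mu>" using s by (intro measurable_sets[OF funpow_T]) simp
  have "cyl w \<subseteq> (\<Union>a\<in>?A. cyl (w @ [a])) \<union> ?R"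
  proof
    fix x assume x: "x \<in> cyl w"
    then have xS: "x \<in> S" and xw: "\<And>j. j < length w \<Longrightarrow> x j = w ! j" by (auto simp: cylinder_def)
    let ?z = "(shift ^^ ?m) x"
    have z: "?z \<in> S" "?z 0 = last w" using funpow_shift_in_S[OF xS] xw w by (auto simp: last_conv_nth)
    show "x \<in> (\<Union>a\<in>?A. cyl (w @ [a])) \<union> ?R"
    proof (cases "?z \<in> no_return (last w) n")
      case True
      then show ?thesis using xS sp by simp
    next
      case False
      then have "\<exists>k\<in>{1..n}. ?z k = last w" using z by (auto simp: no_return_def)
      then have "?z 1 \<in> ?A" using z unfolding loop_successors_def by blast
      moreover have "x \<in> cyl (w @ [?z 1])"
        using xS xw w by (auto simp: cylinder_def nth_append less_Suc_eq)
      ultimately show ?thesis by blast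
    qed
  qed
  then have "measure \<mu> (cyl w) \<le> measure \<mu> ((\<Union>a\<in>?A. cyl (w @ [a])) \<union> ?R)"
    using R finite_loop_successors[OF F] s by (intro finite_measure_mono) auto
  also have "\<dots> \<le> measure \<mu> (\<Union>a\<in>?A. cyl (w @ [a])) + measure \<mu> ?R"
    using R finite_loop_successors[OF F] s by (intro measure_Un_le) auto
  also have "measure \<mu> (\<Union>a\<in>?A. cyl (w @ [a])) \<le> (\<Sum>a\<in>?A. measure \<mu> (cyl (w @ [a])))"
    using finite_loop_successors[OF F] s by (intro measure_UNION_le) auto
  also have "measure \<mu> ?R = measure \<mu> (no_return (last w) n)"
    using s by (intro measure_funpow) simp
  also have "\<dots> \<le> 1 / (real n + 1)" by (rule measure_no_return_le[OF \<mu>])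
  finally show ?thesis by simp
qed

definition index :: "nat list \<Rightarrow> nat" where
  "index w = (SOME n. word n = w)"

lemma word_index[simp]: "w \<noteq> [] \<Longrightarrow> word (index w) = w"
  unfolding index_def using word_surj by (rule someI_ex)

lemma coords_index: "w \<noteq> [] \<Longrightarrow> coords \<mu> (index w) = measure \<mu> (cyl w)"
  by (simp add: coords_def)

lemma cyl_append_subset: "cyl (w @ v) \<subseteq> cyl w"
proof
  fix x assume "x \<in> cyl (w @ v)"
  then have "x \<in> S" and *: "\<And>j. j < length (w @ v) \<Longrightarrow> x j = (w @ v) ! j"
    by (auto simp: cylinder_def)
  moreover have "x j = w ! j" if "j < length w" for j using *[of j] that by (simp add: nth_append)
  ultimately show "x \<in> cyl w" by (simp add: cylinder_def)
qed

lemma Inv_sum_right_le: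
  assumes "\<mu> \<in> Inv" "finite A"
  shows "(\<Sum>a\<in>A. measure \<mu> (cyl (w @ [a]))) \<le> measure \<mu> (cyl w)"
proof -
  interpret finite_measure \<mu> by (rule finite_measure_Inv[OF assms(1)])
  have "(\<Sum>a\<in>A. measure \<mu> (cyl (w @ [a]))) = measure \<mu> (\<Union>a\<in>A. cyl (w @ [a]))"
    using assms disjoint_cyl sets_Inv
    by (intro finite_measure_finite_Union[symmetric]) (auto simp: disjoint_family_on_def)
  also have "\<dots> \<le> measure \<mu> (cyl w)"
    using sets_Inv[OF assms(1)] cyl_append_subset by (intro finite_measure_mono) auto
  finally show ?thesis .
qed

lemma Inv_sum_left_le:
  assumes "\<mu> \<in> Inv" "finite A"
  shows "(\<Sum>a\<in>A. measure \<mu> (cyl (a # w))) \<le> measure \<mu> (cyl w)"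
proof -
  interpret measure_preserving \<mu> shift by (rule measure_preserving_Inv[OF assms(1)])
  have "(\<Sum>a\<in>A. measure \<mu> (cyl (a # w))) = measure \<mu> (\<Union>a\<in>A. cyl (a # w))"
    using assms disjoint_cyl sets_Inv
    by (intro finite_measure_finite_Union[symmetric]) (auto simp: disjoint_family_on_def)
  also have "\<dots> \<le> measure \<mu> (shift -` cyl w \<inter> space \<mu>)"
    using sets_Inv[OF assms(1)] space_Inv[OF assms(1)] shift_vimage_cyl[of w]
    by (intro finite_measure_mono measurable_sets[OF T]) auto
  also have "\<dots> = measure \<mu> (cyl w)"
    using measure_funpow[of "cyl w" 1] sets_Inv[OF assms(1)] by simp
  finally show ?thesis .
qed

text \<open>Only inequalities between finite sums pass directly to a coordinatewise limit. For
  extensions of a word to the right the tail bound restores equality. For extensions to the left one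
  inequality remains, and this is all that \<open>ex_Inv_of_word_weights\<close> asks for.\<close>

lemma closed_K:
  assumes F: "F_property B"
  shows "closed K"
  unfolding closed_sequential_limits
proof (intro allI impI, elim conjE)
  fix Y :: "nat \<Rightarrow> nat \<Rightarrow> real" and y
  assume "\<forall>n. Y n \<in> K" and lim: "Y \<longlonglongrightarrow> y"
  then have "\<forall>n. \<exists>\<mu>\<in>Inv. Y n = coords \<mu>" by (auto simp: K_def)
  then obtain m where m: "\<And>n. m n \<in> Inv" "\<And>n. Y n = coords (m n)" by metis
  have limn: "(\<lambda>k. Y k n) \<longlonglongrightarrow> y n" for n
    using continuous_on_tendsto_compose[OF continuous_on_product_coordinates[of n] lim] by simp
  define v where "v w = y (index w)" for w
  have limw: "(\<lambda>k. measure (m k) (cyl w)) \<longlonglongrightarrow> v w" if "w \<noteq> []" for w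
    using limn[of "index w"] that by (simp add: v_def m coords_index)
  have nonneg: "0 \<le> v w" if "w \<noteq> []" for w
    using limw[OF that] by (rule LIMSEQ_le_const) simp
  have right_le: "(\<Sum>a\<in>A. v (w @ [a])) \<le> v w" if "w \<noteq> []" "finite A" for w A
  proof (rule LIMSEQ_le[OF _ limw[OF that(1)]])
    show "(\<lambda>k. \<Sum>a\<in>A. measure (m k) (cyl (w @ [a]))) \<longlonglongrightarrow> (\<Sum>a\<in>A. v (w @ [a]))"
      by (intro tendsto_sum limw) simp
  qed (use that Inv_sum_right_le[OF m(1)] in auto)
  have left_le: "(\<Sum>a\<in>A. v (a # w)) \<le> v w" if "w \<noteq> []" "finite A" for w A
  proof (rule LIMSEQ_le[OF _ limw[OF that(1)]])
    show "(\<lambda>k. \<Sum>a\<in>A. measure (m k) (cyl (a # w))) \<longlonglongrightarrow> (\<Sum>a\<in>A. v (a # w))"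
      by (intro tendsto_sum limw) simp
  qed (use that Inv_sum_left_le[OF m(1)] in auto)
  have tot_le: "(\<Sum>a\<in>A. v [a]) \<le> 1" if "finite A" for A
  proof (rule LIMSEQ_le_const2)
    show "(\<lambda>k. \<Sum>a\<in>A. measure (m k) (cyl [a])) \<longlonglongrightarrow> (\<Sum>a\<in>A. v [a])"
      by (intro tendsto_sum limw) simp
    show "\<exists>N. \<forall>n\<ge>N. (\<Sum>a\<in>A. measure (m n) (cyl [a])) \<le> 1"
      using order_trans[OF Inv_sum_right_le[OF m(1) that, where w="[]"] measure_Inv_le_1[OF m(1)]]
      by simp
  qed
  have tail: "v w \<le> (\<Sum>a\<in>loop_successors (last w) n. v (w @ [a])) + 1 / (real n + 1)" if "w \<noteq> []" for w n
  proof (rule LIMSEQ_le[OF limw[OF that]])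
    let ?A = "loop_successors (last w) n"
    show "(\<lambda>k. (\<Sum>a\<in>?A. measure (m k) (cyl (w @ [a]))) + 1 / (real n + 1))
      \<longlonglongrightarrow> (\<Sum>a\<in>?A. v (w @ [a])) + 1 / (real n + 1)"
      by (intro tendsto_intros limw) simp
  qed (use measure_cyl_le[OF m(1) F that] in auto)
  have "\<exists>\<mu>\<in>Inv. \<forall>w. w \<noteq> [] \<longrightarrow> measure \<mu> (cyl w) = v w"
  proof (rule ex_Inv_of_word_weights)
    show "(\<lambda>a. v (w @ [a])) sums v w" if w: "w \<noteq> []" for w
    proof -
      have summ: "summable (\<lambda>a. v (w @ [a]))"
        using right_le[OF w] nonneg by (intro summableI_nonneg_bounded[of _ "v w"]) auto
      have "(\<Sum>a. v (w @ [a])) \<le> v w"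
        using right_le[OF w] by (intro suminf_le_const summ) auto
      moreover have "v w \<le> (\<Sum>a. v (w @ [a]))"
      proof (rule LIMSEQ_le_const)
        show "(\<lambda>n. (\<Sum>a. v (w @ [a])) + 1 / (real n + 1)) \<longlonglongrightarrow> (\<Sum>a. v (w @ [a]))"
          using LIMSEQ_inverse_real_of_nat_add[of "\<Sum>a. v (w @ [a])"]
          by (simp add: inverse_eq_divide add.commute)
        have "(\<Sum>a\<in>loop_successors (last w) n. v (w @ [a])) \<le> (\<Sum>a. v (w @ [a]))" for n
          using finite_loop_successors[OF F] nonneg by (intro sum_le_suminf summ) auto
        then show "\<exists>N. \<forall>n\<ge>N. v w \<le> (\<Sum>a. v (w @ [a])) + 1 / (real n + 1)"
          using tail[OF w] by (meson add_right_mono order_trans)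
      qed
      ultimately show ?thesis using summ by (simp add: sums_iff)
    qed
    show "summable (\<lambda>a. v [a])"
      using tot_le nonneg by (intro summableI_nonneg_bounded[of _ 1]) auto
    then show "(\<Sum>a. v [a]) \<le> 1" using tot_le by (intro suminf_le_const) auto
    show "v w = 0" if "w \<noteq> []" "cyl w = {}" for w
      using limw[OF that(1)] that(2) LIMSEQ_unique[OF _ tendsto_const] by fastforce
  qed (use nonneg left_le in auto)
  then obtain \<mu> where \<mu>: "\<mu> \<in> Inv" "\<And>w. w \<noteq> [] \<Longrightarrow> measure \<mu> (cyl w) = v w" by blast
  have "coords \<mu> n = y n" for n
  proof -
    have "(\<lambda>k. Y k n) \<longlonglongrightarrow> v (word n)" using limw[of "word n"] by (simp add: m coords_def)
    then show ?thesis using LIMSEQ_unique[OF limn[of n]] \<mu>(2)[of "word n"] by (simp add: coords_def)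
  qed
  then have "y = coords \<mu>" by (simp add: fun_eq_iff)
  then show "y \<in> K" using \<mu>(1) by (simp add: K_def)
qed

lemma compact_K:
  assumes "F_property B"
  shows "compact K"
proof -
  let ?I = "PiE UNIV (\<lambda>_::nat. {0..1::real})"
  have "compactin (product_topology (\<lambda>_::nat. euclideanreal) UNIV) ?I"
    by (subst compactin_PiE) auto
  then have "compact ?I" by (simp add: euclidean_product_topology)
  moreover have "K = K \<inter> ?I" using K_bounds by (auto simp: PiE_iff)
  ultimately show ?thesis using closed_K[OF assms] by (metis closed_Int_compact)
qed

lemma compact_space_cylinder_convergence:
  assumes "F_property B"
  shows "compact_space (cylinder_convergence_topology B)"
proof -
  have "compact_space (subtopology euclidean K)"
    using compact_K[OF assms] by (simp add: compact_space_subtopology)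
  then show ?thesis
    using homeomorphic_map_coords homeomorphic_compact_space homeomorphic_map_imp_homeomorphic_space by blast
qed

end

section \<open>Criteria for limits and closures in the space of real sequences\<close>

lemma LIMSEQ_of_le_inverse:
  fixes f :: "nat \<Rightarrow> real"
  assumes "\<And>k. \<bar>f k - l\<bar> \<le> c / (real k + 1)"
  shows "f \<longlonglongrightarrow> l"
proof (rule LIM_zero_cancel, rule tendsto_rabs_zero_cancel, rule real_tendsto_sandwich[OF _ _ tendsto_const])
  show "(\<lambda>k. c / (real k + 1)) \<longlonglongrightarrow> 0"
    using tendsto_mult_left[OF LIMSEQ_inverse_real_of_nat, of c] by (simp add: divide_inverse add.commute)
qed (use assms in auto)

lemma in_closure_coordinatewise:
  fixes y :: "nat \<Rightarrow> real"
  assumes "\<And>k. z k \<in> A" and "\<And>n. (\<lambda>k. z k n) \<longlonglongrightarrow> y n"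
  shows "y \<in> closure A"
proof -
  have "limitin (product_topology (\<lambda>_. euclidean) UNIV) z y sequentially"
    using assms(2) by (simp add: limitin_componentwise)
  then have "z \<longlonglongrightarrow> y" by (simp add: euclidean_product_topology)
  then show ?thesis using assms(1) closure_sequential by blast
qed

lemma convex_closure_if_combinations_in_closure:
  fixes A :: "(nat \<Rightarrow> real) set"
  assumes "\<And>x y t. x \<in> A \<Longrightarrow> y \<in> A \<Longrightarrow> 0 \<le> t \<Longrightarrow> t \<le> 1 \<Longrightarrow> (1 - t) *\<^sub>R x + t *\<^sub>R y \<in> closure A"
  shows "convex (closure A)"
  unfolding convex_alt
proof (intro ballI allI impI, elim conjE)
  fix x y :: "nat \<Rightarrow> real" and t :: real
  assume "x \<in> closure A" "y \<in> closure A" and t: "0 \<le> t" "t \<le> 1"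
  then obtain f g where f: "\<And>k. f k \<in> A" "f \<longlonglongrightarrow> x" and g: "\<And>k. g k \<in> A" "g \<longlonglongrightarrow> y"
    unfolding closure_sequential by blast
  have "(\<lambda>k. ((1 - t) *\<^sub>R f k + t *\<^sub>R g k) n) \<longlonglongrightarrow> ((1 - t) *\<^sub>R x + t *\<^sub>R y) n" for n
  proof -
    have "(\<lambda>k. f k n) \<longlonglongrightarrow> x n" "(\<lambda>k. g k n) \<longlonglongrightarrow> y n"
      using continuous_on_tendsto_compose[OF continuous_on_product_coordinates[of n] f(2)]
        continuous_on_tendsto_compose[OF continuous_on_product_coordinates[of n] g(2)] by auto
    then show ?thesis by (simp add: scaleR_fun_def) (intro tendsto_intros)
  qed
  moreover have "(1 - t) *\<^sub>R f k + t *\<^sub>R g k \<in> closure A" for k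
    by (intro assms f g t)
  ultimately have "(1 - t) *\<^sub>R x + t *\<^sub>R y \<in> closure (closure A)"
    by (rule in_closure_coordinatewise[where z="\<lambda>k. (1 - t) *\<^sub>R f k + t *\<^sub>R g k", rotated])
  then show "(1 - t) *\<^sub>R x + t *\<^sub>R y \<in> closure A" by simp
qed

context markov
begin

section \<open>Occurrence counts and loops\<close>

text \<open>Only the starting position of an occurrence has to lie below \<open>n\<close>; the
  occurrence may reach beyond. This is why two orbits that agree up to time \<open>n\<close> can
  have counts that differ, by at most \<open>length w\<close>.\<close>

definition cnt :: "nat list \<Rightarrow> (nat \<Rightarrow> nat) \<Rightarrow> nat \<Rightarrow> real" where
  "cnt w x n = birkhoff_sum shift (indicator (cyl w)) n x"

lemma cnt_add: "cnt w x (m + n) = cnt w x m + cnt w ((shift ^^ m) x) n"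
  by (simp add: cnt_def birkhoff_sum_add)

lemma cnt_0[simp]: "cnt w x 0 = 0"
  by (simp add: cnt_def birkhoff_sum_def)

lemma cnt_bounds: "0 \<le> cnt w x n" "cnt w x n \<le> n"
proof -
  have "(\<Sum>k<n. indicator (cyl w) ((shift ^^ k) x)) \<le> (\<Sum>k<n. 1::real)"
    by (intro sum_mono) (simp add: indicator_def)
  then show "cnt w x n \<le> n" by (simp add: cnt_def birkhoff_sum_def)
  show "0 \<le> cnt w x n" unfolding cnt_def birkhoff_sum_def by (intro sum_nonneg) simp
qed

lemma cnt_le_hd_visits:
  assumes "w \<noteq> []"
  shows "cnt w x n \<le> card {k. k < n \<and> x k = hd w}"
proof -
  have "cnt w x n \<le> (\<Sum>k<n. of_bool (x k = hd w))"
    unfolding cnt_def birkhoff_sum_def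
  proof (rule sum_mono)
    fix k
    have "x k = hd w" if "(shift ^^ k) x \<in> cyl w"
    proof -
      have "(shift ^^ k) x 0 = w ! 0" using that assms by (auto simp only: cylinder_def)
      then show ?thesis using assms by (simp add: hd_conv_nth)
    qed
    then show "indicator (cyl w) ((shift ^^ k) x) \<le> (of_bool (x k = hd w) :: real)"
      by (auto simp: indicator_def)
  qed
  also have "\<dots> = card ({..<n} \<inter> {k. x k = hd w})" by simp
  also have "{..<n} \<inter> {k. x k = hd w} = {k. k < n \<and> x k = hd w}" by auto
  finally show ?thesis .
qed

lemma cnt_le_if_agree:
  assumes x: "x \<in> S" and y: "y \<in> S" and agree: "\<And>j. j < n \<Longrightarrow> x j = y j"
  shows "cnt w x n \<le> cnt w y n + length w"
proof -
  have "cnt w x n \<le> (\<Sum>k<n. indicator (cyl w) ((shift ^^ k) y) + of_bool (n < k + length w))"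
    unfolding cnt_def birkhoff_sum_def
  proof (rule sum_mono)
    fix k
    have "(shift ^^ k) y \<in> cyl w" if "(shift ^^ k) x \<in> cyl w" "\<not> n < k + length w"
    proof -
      have "(shift ^^ k) y j = w ! j" if "j < length w" for j
      proof -
        have "(shift ^^ k) x j = w ! j" using \<open>(shift ^^ k) x \<in> cyl w\<close> that unfolding cylinder_def by blast
        then show ?thesis using agree[of "k + j"] that \<open>\<not> n < k + length w\<close> by simp
      qed
      then show ?thesis using funpow_shift_in_S[OF y] unfolding cylinder_def by blast
    qed
    then show "indicator (cyl w) ((shift ^^ k) x)
      \<le> indicator (cyl w) ((shift ^^ k) y) + (of_bool (n < k + length w) :: real)"
      by (auto simp: indicator_def)
  qed
  also have "\<dots> = cnt w y n + card ({..<n} \<inter> {k. n < k + length w})"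
    by (simp add: cnt_def birkhoff_sum_def sum.distrib)
  also have "card ({..<n} \<inter> {k. n < k + length w}) \<le> card {n - length w..<n}"
    by (intro card_mono) auto
  also have "\<dots> \<le> length w" by simp
  finally show ?thesis by simp
qed

lemma abs_cnt_diff_le_if_agree:
  assumes "x \<in> S" "y \<in> S" "\<And>j. j < n \<Longrightarrow> x j = y j"
  shows "\<bar>cnt w x n - cnt w y n\<bar> \<le> length w"
  using cnt_le_if_agree[of x y n w] cnt_le_if_agree[of y x n w] assms by (simp add: abs_le_iff)

definition walk :: "nat \<Rightarrow> nat list \<Rightarrow> nat \<Rightarrow> bool" where
  "walk i l j \<longleftrightarrow> l \<noteq> [] \<and> hd l = i \<and> last l = j \<and> successively (\<lambda>a b. B a b = 1) l"

lemma walk_glue: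
  assumes "walk i l j" "walk j m k"
  shows "walk i (butlast l @ m) k"
proof -
  have l: "butlast l @ [j] = l" using assms(1) append_butlast_last_id by (fastforce simp: walk_def)
  have "successively (\<lambda>a b. B a b = 1) (butlast l @ [j])" using assms(1) by (simp add: l walk_def)
  then have "successively (\<lambda>a b. B a b = 1) (butlast l @ m)"
    using assms(2) by (auto simp: successively_append_iff walk_def)
  moreover have "hd (butlast l @ m) = i"
  proof (cases "butlast l = []")
    case True
    then have "l = [j]" using l by simp
    then show ?thesis using assms by (simp add: walk_def)
  next
    case False
    then have "hd (butlast l @ [j]) = hd (butlast l @ m)" by (simp add: hd_append)
    then show ?thesis using assms(1) by (simp add: l walk_def)
  qed
  ultimately show ?thesis using assms(2) by (simp add: walk_def)
qed

lemma walk_orbit: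
  assumes "x \<in> S"
  shows "walk (x 0) (map x [0..<Suc n]) (x n)"
proof -
  have "successively (\<lambda>a b. B a b = 1) (map x [0..<Suc n])"
  proof (induction n)
    case (Suc n)
    have "map x [0..<Suc (Suc n)] = map x [0..<Suc n] @ [x (Suc n)]" by simp
    moreover have "B (last (map x [0..<Suc n])) (x (Suc n)) = 1"
      using assms by (simp add: markov_shift_def)
    ultimately show ?case using Suc by (simp only: successively_append_iff) simp
  qed simp
  moreover have "hd (map x [0..<Suc n]) = x 0" by (simp add: hd_map del: upt_Suc)
  ultimately show ?thesis by (simp add: walk_def)
qed

text \<open>The final 0 is not stored, so that appending lists concatenates loops and the length of
  the list is a period of the orbit.\<close>

definition loop :: "nat list \<Rightarrow> bool" where
  "loop u \<longleftrightarrow> u \<noteq> [] \<and> walk 0 (u @ [0]) 0"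

definition periodic :: "nat list \<Rightarrow> nat \<Rightarrow> nat" where
  "periodic u n = u ! (n mod length u)"

lemma periodic_in_S:
  assumes "loop u"
  shows "periodic u \<in> S"
proof -
  have u: "u \<noteq> []" "u ! 0 = 0" using assms by (auto simp: loop_def walk_def hd_append hd_conv_nth)
  have edge: "B ((u @ [0]) ! i) ((u @ [0]) ! Suc i) = 1" if "i < length u" for i
    using assms that unfolding loop_def walk_def
  proof (elim conjE)
    assume s: "successively (\<lambda>a b. B a b = 1) (u @ [0])"
    have "successively P xs \<Longrightarrow> Suc j < length xs \<Longrightarrow> P (xs ! j) (xs ! Suc j)" for P xs and j :: nat
    proof (induction xs arbitrary: j)
      case (Cons a xs)
      then show ?case by (cases j) (auto simp: successively_Cons hd_conv_nth)
    qed simp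
    from this[OF s] show ?thesis using that by simp
  qed
  have "B (periodic u n) (periodic u (Suc n)) = 1" for n
  proof -
    let ?i = "n mod length u"
    have i: "?i < length u" using u by simp
    show ?thesis
    proof (cases "Suc ?i = length u")
      case True
      then have "Suc n mod length u = 0" by (simp add: mod_Suc)
      then show ?thesis using edge[OF i] True u i by (simp add: periodic_def nth_append)
    next
      case False
      then have "Suc n mod length u = Suc ?i" by (simp add: mod_Suc)
      then show ?thesis using edge[OF i] False i by (simp add: periodic_def nth_append)
    qed
  qed
  then show ?thesis by (simp add: markov_shift_def)
qed

lemma shift_periodic: "u \<noteq> [] \<Longrightarrow> (shift ^^ (a * length u)) (periodic u) = periodic u"
  by (simp add: fun_eq_iff periodic_def)

lemma loop_append:
  assumes "loop u" "loop v"
  shows "loop (u @ v)"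
  using walk_glue[of 0 "u @ [0]" 0 "v @ [0]" 0] assms by (simp add: loop_def)

lemma loop_power: "loop u \<Longrightarrow> loop (concat (replicate (Suc a) u))"
  by (induction a) (auto intro: loop_append)

lemma length_concat_replicate: "length (concat (replicate a u)) = a * length u"
  by (induction a) auto

lemma nth_concat_replicate:
  "j < a * length u \<Longrightarrow> concat (replicate a u) ! j = periodic u j"
proof (induction a arbitrary: j)
  case (Suc a)
  show ?case
  proof (cases "j < length u")
    case True
    then show ?thesis by (simp add: nth_append periodic_def)
  next
    case False
    then have "concat (replicate a u) ! (j - length u) = periodic u (j - length u)"
      using Suc by (intro Suc.IH) auto
    then show ?thesis using False by (simp add: nth_append periodic_def le_mod_geq)
  qed
qed simp

definition loop_freq :: "nat list \<Rightarrow> nat \<Rightarrow> real" where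
  "loop_freq u n = cnt (word n) (periodic u) (length u) / length u"

text \<open>These are coordinate vectors of the uniform measures on periodic orbits through the
  symbol 0, as \<open>ex_orbit_measure\<close> shows.\<close>

definition "P = loop_freq ` Collect loop"

lemma loop_freq_bounds: "0 \<le> loop_freq u n \<and> loop_freq u n \<le> 1"
  using cnt_bounds[of "word n" "periodic u" "length u"]
  by (cases "u = []") (auto simp: loop_freq_def divide_simps)

lemma cnt_periodic_mult:
  assumes "u \<noteq> []"
  shows "cnt (word n) (periodic u) (a * length u) = a * length u * loop_freq u n"
proof (induction a)
  case (Suc a)
  have "cnt (word n) (periodic u) (a * length u + length u) = (a * length u + length u) * loop_freq u n"
    using assms unfolding cnt_add shift_periodic[OF assms] Suc
    by (simp add: loop_freq_def field_simps)
  then show ?case by (simp add: add.commute)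
qed simp

text \<open>
  Repeating \<open>u\<close> about \<open>k (1 - t) |v|\<close> times and then \<open>v\<close> about \<open>k t |u|\<close> times approximates the
  convex combination with weight \<open>t\<close>.
\<close>

lemma convex_combination_in_closure_P:
  assumes u: "loop u" and v: "loop v" and t: "0 \<le> t" "t \<le> 1"
  shows "(1 - t) *\<^sub>R loop_freq u + t *\<^sub>R loop_freq v \<in> closure P"
proof -
  have ne: "u \<noteq> []" "v \<noteq> []" using u v by (auto simp: loop_def)
  let ?lu = "real (length u)" and ?lv = "real (length v)"
  \<comment> \<open>The factors \<open>?lv\<close> and \<open>?lu\<close> make up for the different
    lengths of the loops: the two blocks get lengths close to \<open>(1 - t) * N\<close> and
    \<open>t * N\<close> for the same \<open>N\<close>. The \<open>Suc\<close> keeps both blocks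
    nonempty even for \<open>t = 0\<close> and \<open>t = 1\<close>.\<close>
  define a where "a k = Suc (nat \<lfloor>(real k + 1) * (1 - t) * ?lv\<rfloor>)" for k
  define b where "b k = Suc (nat \<lfloor>(real k + 1) * t * ?lu\<rfloor>)" for k
  define c where "c k = concat (replicate (a k) u) @ concat (replicate (b k) v)" for k
  have loop_c: "loop (c k)" for k
    unfolding c_def a_def b_def by (intro loop_append loop_power u v)
  have ab: "(real k + 1) * (1 - t) * ?lv \<le> a k" "a k \<le> (real k + 1) * (1 - t) * ?lv + 1"
    "(real k + 1) * t * ?lu \<le> b k" "b k \<le> (real k + 1) * t * ?lu + 1" for k
  proof -
    have *: "x \<le> Suc (nat \<lfloor>x\<rfloor>)" "Suc (nat \<lfloor>x\<rfloor>) \<le> x + 1" if "0 \<le> x" for x :: real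
      using that by linarith+
    show "(real k + 1) * (1 - t) * ?lv \<le> a k" "a k \<le> (real k + 1) * (1 - t) * ?lv + 1"
      "(real k + 1) * t * ?lu \<le> b k" "b k \<le> (real k + 1) * t * ?lu + 1"
      unfolding a_def b_def using t by (intro *; simp)+
  qed
  have bound: "\<bar>loop_freq (c k) n - ((1 - t) * loop_freq u n + t * loop_freq v n)\<bar>
      \<le> (2 * length (word n) + 2 * ?lu + 2 * ?lv) / (real k + 1)" for k n
  proof -
    let ?w = "word n" and ?c = "periodic (c k)" and ?A = "a k * length u" and ?B = "b k * length v"
    let ?fu = "loop_freq u n" and ?fv = "loop_freq v n"
    let ?g = "(1 - t) * ?fu + t * ?fv"
    define N where "N = (real k + 1) * ?lu * ?lv"
    have len: "length (c k) = ?A + ?B" by (simp add: c_def length_concat_replicate)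
    have cS: "?c \<in> S" by (rule periodic_in_S[OF loop_c])
    have "?c j = periodic u j" if "j < ?A" for j
      using that len by (simp add: periodic_def[of "c k"])
        (simp add: c_def nth_append length_concat_replicate nth_concat_replicate)
    then have 1: "\<bar>cnt ?w ?c ?A - cnt ?w (periodic u) ?A\<bar> \<le> length ?w"
      by (intro abs_cnt_diff_le_if_agree cS periodic_in_S[OF u])
    have "(shift ^^ ?A) ?c j = periodic v j" if "j < ?B" for j
      using that len by (simp add: periodic_def[of "c k"])
        (simp add: c_def nth_append length_concat_replicate nth_concat_replicate)
    then have 2: "\<bar>cnt ?w ((shift ^^ ?A) ?c) ?B - cnt ?w (periodic v) ?B\<bar> \<le> length ?w"
      by (intro abs_cnt_diff_le_if_agree funpow_shift_in_S cS periodic_in_S[OF v])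
    have 3: "cnt ?w ?c (length (c k)) = cnt ?w ?c ?A + cnt ?w ((shift ^^ ?A) ?c) ?B"
      by (simp only: len cnt_add)
    have A: "(1 - t) * N \<le> ?A" "?A \<le> (1 - t) * N + ?lu"
      using mult_right_mono[OF ab(1)[of k], of ?lu] mult_right_mono[OF ab(2)[of k], of ?lu]
      by (simp_all add: N_def algebra_simps)
    have B: "t * N \<le> ?B" "?B \<le> t * N + ?lv"
      using mult_right_mono[OF ab(3)[of k], of ?lv] mult_right_mono[OF ab(4)[of k], of ?lv]
      by (simp_all add: N_def algebra_simps)
    have fu: "0 \<le> ?fu" "?fu \<le> 1" and fv: "0 \<le> ?fv" "?fv \<le> 1" using loop_freq_bounds by auto
    have g: "0 \<le> ?g" "?g \<le> 1"
      using fu fv t convex_bound_le[of ?fu 1 ?fv "1 - t" t] by auto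
    define L where "L = real ?A + real ?B"
    have L: "N \<le> L" "L \<le> N + ?lu + ?lv" using A B by (auto simp: L_def algebra_simps)
    have kN: "real k + 1 \<le> N"
    proof -
      have "1 \<le> ?lu" "1 \<le> ?lv" using ne by (simp_all add: Suc_le_eq)
      then have "1 * 1 \<le> ?lu * ?lv" by (intro mult_mono) auto
      then have "(real k + 1) * 1 \<le> (real k + 1) * (?lu * ?lv)" by (intro mult_left_mono) auto
      then show ?thesis by (simp add: N_def mult.assoc)
    qed
    have "cnt ?w (periodic u) ?A = ?A * ?fu" "cnt ?w (periodic v) ?B = ?B * ?fv"
      using cnt_periodic_mult ne by simp_all
    with 1 2 3 have c1: "\<bar>cnt ?w ?c (length (c k)) - (?A * ?fu + ?B * ?fv)\<bar> \<le> 2 * length ?w" by linarith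
    \<comment> \<open>Since \<open>N * ?g\<close> is the combination of
      \<open>(1 - t) * N * ?fu\<close> and \<open>t * N * ?fv\<close>, the main terms cancel and
      only these three rounding errors are left.\<close>
    define X where "X = (?A - (1 - t) * N) * ?fu"
    define Y where "Y = (?B - t * N) * ?fv"
    define Z where "Z = (L - N) * ?g"
    have "X \<le> ?lu * 1" "0 \<le> X"
      unfolding X_def using A fu by (intro mult_mono mult_nonneg_nonneg; simp)+
    moreover have "Y \<le> ?lv * 1" "0 \<le> Y"
      unfolding Y_def using B fv by (intro mult_mono mult_nonneg_nonneg; simp)+
    moreover have "Z \<le> (?lu + ?lv) * 1" "0 \<le> Z"
      unfolding Z_def using L g by (intro mult_mono mult_nonneg_nonneg; linarith)+
    ultimately have "\<bar>X + Y - Z\<bar> \<le> ?lu + ?lv" by (intro abs_leI) simp_all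
    moreover have "?A * ?fu + ?B * ?fv - L * ?g = X + Y - Z"
      by (simp add: X_def Y_def Z_def algebra_simps)
    ultimately have "\<bar>?A * ?fu + ?B * ?fv - L * ?g\<bar> \<le> ?lu + ?lv" by (simp only:)
    with c1 have c2: "\<bar>cnt ?w ?c (length (c k)) - L * ?g\<bar> \<le> 2 * length ?w + 2 * ?lu + 2 * ?lv" by linarith
    have L0: "0 < L" using L kN by linarith
    have "loop_freq (c k) n - ?g = (cnt ?w ?c (length (c k)) - L * ?g) / L"
      using L0 by (simp add: loop_freq_def len L_def field_simps)
    then have "\<bar>loop_freq (c k) n - ?g\<bar> = \<bar>cnt ?w ?c (length (c k)) - L * ?g\<bar> / L"
      using L0 by (simp add: abs_divide)
    also have "\<dots> \<le> (2 * length ?w + 2 * ?lu + 2 * ?lv) / (real k + 1)"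
      using c2 L0 L kN by (intro frac_le) auto
    finally show ?thesis .
  qed
  show ?thesis
  proof (rule in_closure_coordinatewise)
    show "loop_freq (c k) \<in> P" for k using loop_c by (auto simp: P_def)
    show "(\<lambda>k. loop_freq (c k) n) \<longlonglongrightarrow> ((1 - t) *\<^sub>R loop_freq u + t *\<^sub>R loop_freq v) n" for n
      using LIMSEQ_of_le_inverse[OF bound] by (simp add: scaleR_fun_def)
  qed
qed

lemma convex_closure_P: "convex (closure P)"
  using convex_combination_in_closure_P
  by (intro convex_closure_if_combinations_in_closure) (auto simp: P_def)

end

text \<open>Brings error bounds of the form \<open>c / k\<close> into the shape that
  \<open>LIMSEQ_of_le_inverse\<close> expects.\<close>

lemma divide_le_double_divide_Suc:
  fixes c :: real
  assumes "0 < k" "0 \<le> c"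
  shows "c / real k \<le> 2 * c / (real k + 1)"
proof -
  have "c * (real k + 1) \<le> c * (2 * real k)" using assms by (intro mult_left_mono) auto
  then show ?thesis using assms by (simp add: field_simps)
qed

context markov
begin

section \<open>Loops with low frequencies\<close>

lemma mem_cyl_singleton: "x \<in> cyl [a] \<longleftrightarrow> x \<in> S \<and> x 0 = a"
  by (simp add: cylinder_def)

lemma ex_walk:
  assumes "transitive_shift B"
  shows "\<exists>l. walk i l j"
proof -
  have "cyl [a] \<noteq> {}" for a
  proof -
    obtain x where "x \<in> S" "x 0 = a" using ex_in_S_starting_at by blast
    then show ?thesis using mem_cyl_singleton by blast
  qed
  then have "\<exists>n\<ge>1. cyl [i] \<inter> (shift ^^ n) -` cyl [j] \<noteq> {}"
    by (intro assms[unfolded transitive_shift_def, rule_format] conjI openin_cyl) simp_all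
  then obtain n where "cyl [i] \<inter> (shift ^^ n) -` cyl [j] \<noteq> {}" by (elim exE conjE)
  then obtain x where "x \<in> cyl [i]" "(shift ^^ n) x \<in> cyl [j]" by blast
  then have x: "x \<in> S" "x 0 = i" "x n = j" by (simp_all add: mem_cyl_singleton)
  show ?thesis using walk_orbit[OF x(1), of n] x by blast
qed

lemma ex_distinct_walk:
  assumes "transitive_shift B"
  shows "\<exists>l. walk i l j \<and> distinct l"
proof -
  have 1: "successively E (i # xs) \<Longrightarrow> rtrancl_path E i xs (last (i # xs))" for E and i :: nat and xs
  proof (induction xs arbitrary: i)
    case (Cons a xs)
    then show ?case by (auto intro: rtrancl_path.step simp: successively_Cons)
  qed (simp add: rtrancl_path.base)
  have 2: "walk i (i # xs) j" if "rtrancl_path (\<lambda>a b. B a b = 1) i xs j" for i xs j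
    using that by induction (auto simp: walk_def successively_Cons)
  obtain l where l: "walk i l j" using ex_walk[OF assms] by blast
  then obtain xs where "l = i # xs" by (cases l) (auto simp: walk_def)
  with l have "rtrancl_path (\<lambda>a b. B a b = 1) i xs j" using 1[of _ i xs] by (auto simp: walk_def)
  then obtain ys where "rtrancl_path (\<lambda>a b. B a b = 1) i ys j" "distinct (i # ys)"
    by (rule rtrancl_path_distinct)
  then show ?thesis using 2 by blast
qed

lemma loop_butlast:
  assumes "walk 0 p a" "walk a q 0" "butlast p @ butlast q \<noteq> []"
  shows "loop (butlast p @ butlast q)"
proof -
  have "q \<noteq> []" "last q = 0" using assms(2) by (auto simp: walk_def)
  then have "butlast q @ [0] = q" using append_butlast_last_id by metis
  then show ?thesis using walk_glue[OF assms(1,2)] assms(3) by (simp add: loop_def)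
qed

lemma loop_admissible:
  assumes "loop u"
  shows "admissible B (u @ [0])"
proof -
  have u: "u \<noteq> []" "u ! 0 = 0" using assms by (auto simp: loop_def walk_def hd_append hd_conv_nth)
  have "periodic u \<in> cyl (u @ [0])"
    using periodic_in_S[OF assms] u by (auto simp: cylinder_def periodic_def nth_append less_Suc_eq)
  then show ?thesis by (auto simp: admissible_def)
qed

text \<open>
  Concatenate simple walks from 0 to \<open>a\<close> and back: every symbol is visited at most twice, and
  by the F-property the loop is long for all but finitely many \<open>a\<close>.
\<close>

lemma ex_long_loop:
  assumes tr: "transitive_shift B" and F: "F_property B"
  shows "\<exists>u. loop u \<and> n < length u \<and> (\<forall>w. w \<noteq> [] \<longrightarrow> cnt w (periodic u) (length u) \<le> 2)"
proof -
  let ?W = "\<lambda>m. {w. length w = m \<and> admissible B w \<and> hd w = 0 \<and> last w = 0}"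
  \<comment> \<open>The bound is \<open>Suc n\<close> and not \<open>n\<close> because a loop
    \<open>u\<close> of length at most \<open>n\<close> gives the word \<open>u @ [0]\<close>, which
    is one letter longer.\<close>
  have "finite (\<Union>m\<in>{1..Suc n}. \<Union>w\<in>?W m. set w)"
  proof (intro finite_UN_I finite_atLeastAtMost finite_set)
    show "finite (?W m)" if "m \<in> {1..Suc n}" for m
      using F that unfolding F_property_def by (auto simp only: atLeastAtMost_iff)
  qed
  then have fin: "finite (insert 0 (\<Union>m\<in>{1..Suc n}. \<Union>w\<in>?W m. set w))" by simp
  obtain a where a_new: "a \<notin> insert 0 (\<Union>m\<in>{1..Suc n}. \<Union>w\<in>?W m. set w)"
    using ex_new_if_finite[OF infinite_UNIV_nat fin] by (elim exE)
  then have a: "a \<noteq> 0" "\<And>m w. m \<in> {1..Suc n} \<Longrightarrow> w \<in> ?W m \<Longrightarrow> a \<notin> set w"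
    unfolding insert_iff UN_iff by meson+
  obtain p q where p: "walk 0 p a" "distinct p" and q: "walk a q 0" "distinct q"
    using ex_distinct_walk[OF tr] by blast
  have "hd q = a" "last q = 0" "q \<noteq> []" using q by (auto simp: walk_def)
  then obtain q' where q': "q = a # q'" "q' \<noteq> []" using a(1) by (cases q) (auto split: if_splits)
  define u where "u = butlast p @ butlast q"
  have a_u: "a \<in> set u" using q' by (simp add: u_def)
  then have "u \<noteq> []" by auto
  then have loop: "loop u" using loop_butlast p q by (simp add: u_def)
  have hd_u: "hd u = 0" using loop \<open>u \<noteq> []\<close> by (simp add: loop_def walk_def hd_append)
  have "n < length u"
  proof (rule ccontr)
    assume "\<not> n < length u"
    then have "length u + 1 \<in> {1..Suc n}" by simp
    moreover have "u @ [0] \<in> ?W (length u + 1)"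
      using loop_admissible[OF loop] hd_u \<open>u \<noteq> []\<close> by simp
    ultimately have "a \<notin> set (u @ [0])" by (rule a(2))
    then show False using a_u by simp
  qed
  moreover have "cnt w (periodic u) (length u) \<le> 2" if "w \<noteq> []" for w
  proof -
    have le1: "length (filter (\<lambda>x. x = hd w) l) \<le> 1" if "distinct l" for l :: "nat list"
    proof -
      have "length (filter (\<lambda>x. x = hd w) l) = card ({x. x = hd w} \<inter> set l)"
        by (rule distinct_length_filter[OF that])
      also have "\<dots> \<le> card {hd w}" by (intro card_mono) auto
      finally show ?thesis by simp
    qed
    have "{k. k < length u \<and> periodic u k = hd w} = {k. k < length u \<and> u ! k = hd w}"
      by (auto simp: periodic_def)
    then have "card {k. k < length u \<and> periodic u k = hd w} = length (filter (\<lambda>x. x = hd w) u)"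
      by (simp add: length_filter_conv_card)
    also have "\<dots> \<le> 1 + 1"
      unfolding u_def filter_append length_append using p q by (intro add_mono le1 distinct_butlast)
    finally show ?thesis
      using cnt_le_hd_visits[OF that, of "periodic u" "length u"] by simp
  qed
  ultimately show ?thesis using loop by blast
qed

lemma zero_in_closure_P:
  assumes "transitive_shift B" "F_property B"
  shows "0 \<in> closure P"
proof -
  obtain u where u: "\<And>k. loop (u k)" "\<And>k::nat. k < length (u k)"
    "\<And>k w. w \<noteq> [] \<Longrightarrow> cnt w (periodic (u k)) (length (u k)) \<le> 2"
    using ex_long_loop[OF assms] by metis
  have "\<bar>loop_freq (u k) n - 0\<bar> \<le> 2 / (real k + 1)" for k n
  proof -
    have "loop_freq (u k) n \<le> 2 / length (u k)"
      unfolding loop_freq_def using u(3) by (intro divide_right_mono) auto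
    also have "\<dots> \<le> 2 / (real k + 1)"
      using u(2)[of k] by (intro divide_left_mono mult_pos_pos) auto
    finally show ?thesis using loop_freq_bounds by simp
  qed
  then have "(\<lambda>k. loop_freq (u k) n) \<longlonglongrightarrow> 0" for n by (rule LIMSEQ_of_le_inverse)
  then show ?thesis using u(1) by (intro in_closure_coordinatewise[where z="\<lambda>k. loop_freq (u k)"]) (auto simp: P_def)
qed

section \<open>Limit frequencies\<close>

definition generic :: "(nat \<Rightarrow> nat) \<Rightarrow> bool" where
  "generic x \<longleftrightarrow> x \<in> S \<and> (\<forall>n. convergent (\<lambda>k. cnt (word n) x k / k))"

text \<open>The default 0 is itself a point of \<open>K\<close> and of \<open>closure P\<close>, so
  that \<open>freq x\<close> lies there for every \<open>x\<close> and not only almost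
  everywhere.\<close>

definition freq :: "(nat \<Rightarrow> nat) \<Rightarrow> nat \<Rightarrow> real" where
  "freq x n = (if generic x then lim (\<lambda>k. cnt (word n) x k / k) else 0)"

lemma generic_LIMSEQ:
  assumes "generic x"
  shows "(\<lambda>k. cnt (word n) x k / k) \<longlonglongrightarrow> freq x n"
proof -
  have "convergent (\<lambda>k. cnt (word n) x k / k)" using assms by (simp add: generic_def)
  then show ?thesis unfolding convergent_LIMSEQ_iff by (simp add: freq_def assms)
qed

lemma freq_eqI:
  assumes "x \<in> S" "\<And>n. (\<lambda>k. cnt (word n) x k / k) \<longlonglongrightarrow> l n"
  shows "generic x" "freq x = l"
proof -
  show g: "generic x" using assms by (auto simp: generic_def convergent_def)
  show "freq x = l" by (rule ext) (rule LIMSEQ_unique[OF generic_LIMSEQ[OF g] assms(2)])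
qed

lemma cnt_quotient_bounds: "0 \<le> cnt w x k / k" "cnt w x k / k \<le> 1"
  using cnt_bounds[of w x k] by (cases "k = 0"; simp)+

lemma freq_bounds: "0 \<le> freq x n" "freq x n \<le> 1"
proof -
  have "0 \<le> freq x n \<and> freq x n \<le> 1"
  proof (cases "generic x")
    case True
    then show ?thesis
      using LIMSEQ_le_const[OF generic_LIMSEQ[OF True]] LIMSEQ_le_const2[OF generic_LIMSEQ[OF True]]
        cnt_quotient_bounds by meson
  qed (simp add: freq_def)
  then show "0 \<le> freq x n" "freq x n \<le> 1" by auto
qed

text \<open>Shifting changes each count by at most 1, and therefore preserves genericity in both
  directions. The equality holds at every point of \<open>S\<close>, so sets defined by frequencies
  are strictly invariant and not merely invariant up to null sets.\<close>

lemma freq_shift: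
  assumes x: "x \<in> S"
  shows "freq (shift x) = freq x"
proof -
  have diff: "(\<lambda>k. cnt w (shift x) k / k - cnt w x k / k) \<longlonglongrightarrow> 0" for w
  proof (rule LIMSEQ_of_le_inverse)
    fix k :: nat
    have "cnt w x 1 + cnt w (shift x) k = cnt w x k + cnt w ((shift ^^ k) x) 1"
      using cnt_add[of w x 1 k] cnt_add[of w x k 1] by simp
    then have "\<bar>cnt w (shift x) k - cnt w x k\<bar> \<le> 1"
      using cnt_bounds[of w x 1] cnt_bounds[of w "(shift ^^ k) x" 1] by simp
    then have *: "\<bar>cnt w (shift x) k / k - cnt w x k / k\<bar> \<le> 1 / k"
      by (simp add: diff_divide_distrib[symmetric] abs_divide divide_right_mono)
    show "\<bar>cnt w (shift x) k / k - cnt w x k / k - 0\<bar> \<le> 2 / (real k + 1)"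
      using * divide_le_double_divide_Suc[of k 1] by (cases "k = 0") auto
  qed
  have 1: "(\<lambda>k. cnt w (shift x) k / k) \<longlonglongrightarrow> l" if "(\<lambda>k. cnt w x k / k) \<longlonglongrightarrow> l" for w l
    using tendsto_add[OF diff[of w] that] by simp
  have 2: "(\<lambda>k. cnt w x k / k) \<longlonglongrightarrow> l" if "(\<lambda>k. cnt w (shift x) k / k) \<longlonglongrightarrow> l" for w l
    using tendsto_diff[OF that diff[of w]] by simp
  show ?thesis
  proof (cases "generic x")
    case True
    then show ?thesis by (intro freq_eqI(2) shift_in_S x 1 generic_LIMSEQ)
  next
    case False
    then have "\<not> generic (shift x)"
      using 2 x by (auto simp: generic_def convergent_def)
    then show ?thesis using False by (simp add: freq_def fun_eq_iff)
  qed
qed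

text \<open>Cut an orbit at visits to a symbol of positive frequency and close it up to a loop.\<close>

lemma freq_in_closure_P:
  assumes tr: "transitive_shift B" and F: "F_property B"
  shows "freq x \<in> closure P"
proof (cases "generic x \<and> (\<exists>a. infinite {k. x k = a})")
  case False
  \<comment> \<open>If no symbol recurs infinitely often, then the occurrences of each word are
    bounded in number by the visits to its first symbol, and its frequency is 0.\<close>
  have "freq x n = 0" for n
  proof (cases "generic x")
    case True
    then have fin: "finite {k. x k = hd (word n)}" using False by blast
    have "(\<lambda>k. cnt (word n) x k / k) \<longlonglongrightarrow> 0"
    proof (rule LIMSEQ_of_le_inverse)
      fix k :: nat
      let ?C = "card {k. x k = hd (word n)}"
      have "cnt (word n) x k \<le> card {i. i < k \<and> x i = hd (word n)}" by (simp add: cnt_le_hd_visits)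
      also have "\<dots> \<le> real ?C" using fin by (intro of_nat_mono card_mono) auto
      finally have *: "cnt (word n) x k \<le> ?C" .
      show "\<bar>cnt (word n) x k / k - 0\<bar> \<le> 2 * real ?C / (real k + 1)"
      proof (cases "k = 0")
        case False
        have "cnt (word n) x k / k \<le> ?C / k" using * by (intro divide_right_mono) auto
        also have "\<dots> \<le> 2 * real ?C / (real k + 1)" using False by (intro divide_le_double_divide_Suc) auto
        finally show ?thesis using cnt_bounds(1)[of "word n" x k] by simp
      qed simp
    qed
    then show ?thesis using generic_LIMSEQ[OF True] LIMSEQ_unique by blast
  qed (simp add: freq_def)
  then have "freq x = 0" by (simp add: fun_eq_iff)
  then show ?thesis using zero_in_closure_P[OF tr F] by simp
next
  case True
  then obtain a where g: "generic x" and inf: "infinite {k. x k = a}" by blast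
  then have xS: "x \<in> S" by (simp add: generic_def)
  \<comment> \<open>Time 0 is removed so that the piece of the orbit before the cut is never
    empty.\<close>
  have "infinite ({k. x k = a} - {0})" using inf by simp
  then obtain r :: "nat \<Rightarrow> nat" where r: "strict_mono r" "\<And>k. r k \<in> {k. x k = a} - {0}"
    using infinite_enumerate by blast
  obtain p q where p: "walk 0 p (x 0)" and q: "walk a q 0" using ex_walk[OF tr] by blast
  define u where "u k = butlast p @ map x [0..<r k] @ butlast q" for k
  have u_ne: "u k \<noteq> []" for k using r(2)[of k] by (simp add: u_def)
  have loop_u: "loop (u k)" for k
  proof -
    have "walk 0 (butlast p @ map x [0..<Suc (r k)]) a"
      using walk_glue[OF p walk_orbit[OF xS, of "r k"]] r(2)[of k] by simp
    then have "loop (butlast (butlast p @ map x [0..<Suc (r k)]) @ butlast q)"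
      using q u_ne[of k] by (intro loop_butlast) (auto simp: butlast_append u_def)
    then show ?thesis by (simp add: butlast_append u_def)
  qed
  define c where "c = length (butlast p) + length (butlast q)"
  have len: "length (u k) = r k + c" for k by (simp add: u_def c_def)
  \<comment> \<open>The \<open>c\<close> closing symbols contribute at most \<open>c\<close>
    occurrences, the cut changes the count by at most the length of the word, and dividing by
    \<open>r k + c\<close> in place of \<open>r k\<close> costs another \<open>c\<close>.\<close>
  have bound: "\<bar>loop_freq (u k) n - cnt (word n) x (r k) / r k\<bar> \<le> (2 * c + length (word n)) / (real k + 1)" for k n
  proof -
    let ?w = "word n" and ?u = "periodic (u k)" and ?p = "length (butlast p)" and ?q = "length (butlast q)"
    have rk: "0 < r k" "real k + 1 \<le> r k" using r(2)[of k] strict_mono_imp_increasing[OF r(1), of k]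
    proof -
      have "Suc k \<le> r k"
      proof (induction k)
        case 0
        then show ?case using r(2)[of 0] by simp
      next
        case (Suc k)
        then show ?case using r(1) by (metis Suc_leI le_less_trans lessI not_less_eq_eq strict_mono_less)
      qed
      then show "0 < r k" "real k + 1 \<le> r k" by linarith+
    qed
    have uS: "?u \<in> S" by (rule periodic_in_S[OF loop_u])
    have "(shift ^^ ?p) ?u j = x j" if "j < r k" for j
    proof -
      have "(shift ^^ ?p) ?u j = u k ! (?p + j)" using that len[of k] by (simp add: periodic_def c_def)
      also have "\<dots> = x j" unfolding u_def using that by (simp only: nth_append_length_plus) (simp add: nth_append)
      finally show ?thesis .
    qed
    then have mid: "\<bar>cnt ?w ((shift ^^ ?p) ?u) (r k) - cnt ?w x (r k)\<bar> \<le> length ?w"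
      by (intro abs_cnt_diff_le_if_agree funpow_shift_in_S uS xS)
    have "cnt ?w ?u (length (u k)) = cnt ?w ?u ?p + cnt ?w ((shift ^^ ?p) ?u) (r k)
      + cnt ?w ((shift ^^ (?p + r k)) ?u) ?q"
    proof -
      have "length (u k) = (?p + r k) + ?q" by (simp add: len c_def)
      then show ?thesis by (simp only: cnt_add)
    qed
    then have D: "\<bar>cnt ?w ?u (length (u k)) - cnt ?w x (r k)\<bar> \<le> c + length ?w"
      using mid cnt_bounds[of ?w ?u ?p] cnt_bounds[of ?w "(shift ^^ (?p + r k)) ?u" ?q]
      by (simp add: c_def abs_le_iff)
    define X where "X = cnt ?w ?u (length (u k))"
    define Y where "Y = cnt ?w x (r k)"
    have Y: "0 \<le> Y" "Y \<le> r k" using cnt_bounds by (auto simp: Y_def)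
    have "X / (r k + c) - Y / r k = ((X - Y) - c * (Y / r k)) / (r k + c)"
      using rk by (simp add: field_simps)
    moreover have "\<bar>(X - Y) - c * (Y / r k)\<bar> \<le> 2 * c + length ?w"
    proof -
      have "0 \<le> Y / r k" "Y / r k \<le> 1" using Y rk by auto
      then have "0 \<le> c * (Y / r k)" "c * (Y / r k) \<le> real c * 1"
        by (intro mult_nonneg_nonneg mult_left_mono; simp)+
      then show ?thesis using D by (simp add: X_def Y_def abs_le_iff)
    qed
    ultimately have "\<bar>X / (r k + c) - Y / r k\<bar> \<le> (2 * c + length ?w) / (r k + c)"
      using rk by (simp add: abs_divide divide_right_mono)
    also have "\<dots> \<le> (2 * c + length ?w) / (real k + 1)"
      using rk by (intro divide_left_mono) auto
    finally show ?thesis by (simp add: loop_freq_def len X_def Y_def)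
  qed
  show ?thesis
  proof (rule in_closure_coordinatewise)
    show "loop_freq (u k) \<in> P" for k using loop_u by (auto simp: P_def)
    fix n
    have "(\<lambda>k. cnt (word n) x (r k) / r k) \<longlonglongrightarrow> freq x n"
      using LIMSEQ_subseq_LIMSEQ[OF generic_LIMSEQ[OF g] r(1)] by (simp add: comp_def)
    moreover have "(\<lambda>k. loop_freq (u k) n - cnt (word n) x (r k) / r k) \<longlonglongrightarrow> 0"
      using bound by (intro LIMSEQ_of_le_inverse) simp
    ultimately show "(\<lambda>k. loop_freq (u k) n) \<longlonglongrightarrow> freq x n"
      using tendsto_add by fastforce
  qed
qed

section \<open>Measures on periodic orbits\<close>

lemma LIMSEQ_cnt_periodic:
  assumes L: "0 < L" and per: "(shift ^^ L) x = x"
  shows "(\<lambda>n. cnt w x n / n) \<longlonglongrightarrow> cnt w x L / L"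
proof (rule LIMSEQ_of_le_inverse)
  fix n :: nat
  have mult: "(shift ^^ (q * L)) x = x \<and> cnt w x (q * L) = q * cnt w x L" for q
  proof (induction q)
    case (Suc q)
    have "(shift ^^ (q * L + L)) x = x" by (simp only: funpow_add comp_apply per Suc)
    moreover have "cnt w x (q * L + L) = q * cnt w x L + cnt w x L"
      by (simp only: cnt_add Suc)
    ultimately show ?case by (simp add: add.commute algebra_simps)
  qed simp
  let ?q = "n div L" and ?r = "n mod L" and ?f = "cnt w x L / L"
  have f: "0 \<le> ?f" "?f \<le> 1" using cnt_quotient_bounds by auto
  have "cnt w x (?q * L + ?r) = ?q * cnt w x L + cnt w x ?r"
    by (simp only: cnt_add mult)
  then have "cnt w x n - n * ?f = cnt w x ?r - ?r * ?f"
  proof -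
    assume "cnt w x (?q * L + ?r) = ?q * cnt w x L + cnt w x ?r"
    then have 1: "cnt w x n = ?q * cnt w x L + cnt w x ?r" by simp
    have "real n = ?q * real L + ?r" by (metis div_mult_mod_eq of_nat_add of_nat_mult)
    then have "n * ?f = ?q * cnt w x L + ?r * ?f" using L by (simp add: field_simps)
    with 1 show ?thesis by simp
  qed
  moreover have "0 \<le> ?r * ?f" "?r * ?f \<le> ?r"
    using mult_left_mono[OF f(2), of ?r] f(1) mult_nonneg_nonneg[of ?r ?f] by (simp_all only: mult_1_right of_nat_0_le_iff simp_thms)
  moreover have "?r \<le> L" using L by (simp add: less_imp_le)
  ultimately have *: "\<bar>cnt w x n - n * ?f\<bar> \<le> L"
    using cnt_bounds[of w x ?r] by (simp add: abs_le_iff)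
  show "\<bar>cnt w x n / n - ?f\<bar> \<le> 2 * real L / (real n + 1)"
  proof (cases "n = 0")
    case True
    have "1 \<le> real L" using L by simp
    then have "\<bar>?f\<bar> \<le> 2 * real L" using f by linarith
    then show ?thesis using True by simp
  next
    case False
    have "cnt w x n / n - ?f = (cnt w x n - n * ?f) / n" using False by (simp add: diff_divide_distrib)
    then have "\<bar>cnt w x n / n - ?f\<bar> = \<bar>cnt w x n - n * ?f\<bar> / n" by (simp only: abs_divide abs_of_nat)
    also have "\<dots> \<le> L / n" using * by (intro divide_right_mono) auto
    also have "\<dots> \<le> 2 * real L / (real n + 1)" using False by (intro divide_le_double_divide_Suc) auto
    finally show ?thesis .
  qed
qed

lemma freq_periodic:
  assumes u: "loop u"
  shows "freq ((shift ^^ k) (periodic u)) = loop_freq u"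
proof -
  have ne: "u \<noteq> []" using u by (simp add: loop_def)
  have "freq (periodic u) = loop_freq u"
  proof (rule freq_eqI(2)[OF periodic_in_S[OF u]])
    show "(\<lambda>k. cnt (word n) (periodic u) k / k) \<longlonglongrightarrow> loop_freq u n" for n
      unfolding loop_freq_def using ne shift_periodic[OF ne, of 1] by (intro LIMSEQ_cnt_periodic) auto
  qed
  then show ?thesis
    by (induction k) (simp_all add: freq_shift funpow_shift_in_S periodic_in_S[OF u])
qed

text \<open>The image of the uniform distribution on one period; the shift permutes the period
  cyclically. The last property is applied later to the set of points with a given frequency vector,
  and yields the ergodicity of the orbit measure.\<close>

lemma ex_orbit_measure:
  assumes u: "loop u"
  shows "\<exists>\<mu>\<in>Inv. coords \<mu> = loop_freq u \<and>
    (\<forall>A\<in>sets SB. (\<forall>k. (shift ^^ k) (periodic u) \<in> A) \<longrightarrow> emeasure \<mu> A = 1)"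
proof -
  let ?L = "length u" and ?o = "\<lambda>k. (shift ^^ k) (periodic u)"
  have ne: "u \<noteq> []" using u by (simp add: loop_def)
  have oS: "?o k \<in> S" for k by (intro funpow_shift_in_S periodic_in_S u)
  define Q where "Q = uniform_count_measure {..<?L}"
  interpret Q: prob_space Q
    unfolding Q_def using ne by (intro prob_space_uniform_count_measure) auto
  have m: "?o \<in> measurable Q SB" using oS by (auto simp: measurable_def Q_def space_uniform_count_measure sets_uniform_count_measure)
  define \<mu> where "\<mu> = distr Q SB ?o"
  interpret M: prob_space \<mu> unfolding \<mu>_def by (rule Q.prob_space_distr[OF m])
  have s: "sets \<mu> = sets SB" by (simp add: \<mu>_def)
  have meas: "measure \<mu> A = (\<Sum>k<?L. indicator A (?o k)) / ?L" if "A \<in> sets SB" for A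
  proof -
    have "measure \<mu> A = measure Q ({k. ?o k \<in> A} \<inter> {..<?L})"
      unfolding \<mu>_def using measure_distr[OF m that] by (simp add: Q_def space_uniform_count_measure vimage_def)
    also have "\<dots> = card ({k. ?o k \<in> A} \<inter> {..<?L}) / ?L"
      unfolding Q_def by (subst measure_uniform_count_measure) auto
    also have "real (card ({k. ?o k \<in> A} \<inter> {..<?L})) = (\<Sum>k<?L. indicator A (?o k))"
      by (simp add: indicator_def Int_commute)
    finally show ?thesis .
  qed
  have inv: "\<mu> \<in> Inv"
  proof (rule InvI[OF s])
    show "emeasure \<mu> S \<le> 1" by (rule M.emeasure_le_1)
    fix w
    have v: "shift -` cyl w \<inter> S \<in> sets SB" using measurable_sets[OF measurable_shift cyl_sets] by simp
    have per: "?o ?L = ?o 0" using shift_periodic[OF ne, of 1] by simp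
    have "measure \<mu> (shift -` cyl w \<inter> S) = (\<Sum>k<?L. indicator (cyl w) (?o (Suc k))) / ?L"
      using oS by (simp add: meas[OF v] indicator_def)
    also have "(\<Sum>k<?L. indicator (cyl w) (?o (Suc k)) :: real) = (\<Sum>k<?L. indicator (cyl w) (?o k))"
    proof -
      have "(\<Sum>k<Suc ?L. indicator (cyl w) (?o k) :: real)
        = indicator (cyl w) (?o 0) + (\<Sum>k<?L. indicator (cyl w) (?o (Suc k)))"
        by (rule sum.lessThan_Suc_shift)
      moreover have "(\<Sum>k<Suc ?L. indicator (cyl w) (?o k) :: real)
        = (\<Sum>k<?L. indicator (cyl w) (?o k)) + indicator (cyl w) (?o ?L)" by (rule sum.lessThan_Suc)
      ultimately show ?thesis unfolding per by linarith
    qed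
    finally have "measure \<mu> (shift -` cyl w \<inter> S) = measure \<mu> (cyl w)" by (simp add: meas)
    then show "emeasure \<mu> (shift -` cyl w \<inter> S) = emeasure \<mu> (cyl w)"
      by (simp add: M.emeasure_eq_measure)
  qed
  moreover have "coords \<mu> = loop_freq u"
    by (simp add: fun_eq_iff coords_def meas loop_freq_def cnt_def birkhoff_sum_def)
  moreover have "emeasure \<mu> A = 1" if "A \<in> sets SB" "\<forall>k. ?o k \<in> A" for A
    using that ne by (simp add: M.emeasure_eq_measure meas indicator_def)
  ultimately show ?thesis by blast
qed

lemma P_subset_K: "P \<subseteq> K"
  using ex_orbit_measure by (force simp: P_def K_def)

lemma freq_in_K:
  assumes "transitive_shift B" "F_property B"
  shows "freq x \<in> K"
  using freq_in_closure_P[OF assms] closure_minimal[OF P_subset_K closed_K[OF assms(2)]] by blast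

section \<open>Integrating the frequencies\<close>

lemma measurable_cnt[measurable]: "(\<lambda>x. cnt w x k) \<in> borel_measurable SB"
proof -
  have [measurable]: "(shift ^^ k) \<in> measurable SB SB" for k
    by (induction k) (auto simp: id_def intro: measurable_comp[OF _ measurable_shift])
  have "(\<lambda>x. indicator (cyl w) ((shift ^^ k) x) :: real) \<in> borel_measurable SB" for k
    by measurable
  then show ?thesis unfolding cnt_def birkhoff_sum_def by (intro borel_measurable_sum)
qed

lemma generic_sets[measurable]: "Measurable.pred SB generic"
proof -
  have eq: "generic x = (\<forall>n. convergent (\<lambda>k. cnt (word n) x k / k))" if "x \<in> space SB" for x
    using that by (simp add: generic_def)
  have "Measurable.pred SB (\<lambda>x. \<forall>n. convergent (\<lambda>k. cnt (word n) x k / k))"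
    unfolding Cauchy_convergent_iff[symmetric] pred_def
    by (intro sets.sets_Collect_countable_All sets_Collect_Cauchy) measurable
  then show ?thesis
    using measurable_cong[of SB generic "\<lambda>x. \<forall>n. convergent (\<lambda>k. cnt (word n) x k / k)", OF eq] by blast
qed

lemma measurable_freq[measurable]: "(\<lambda>x. freq x n) \<in> borel_measurable SB"
  unfolding freq_def by measurable

lemma AE_generic:
  assumes \<mu>: "\<mu> \<in> Inv"
  shows "AE x in \<mu>. generic x"
proof -
  interpret measure_preserving \<mu> shift by (rule measure_preserving_Inv[OF \<mu>])
  have "AE x in \<mu>. convergent (\<lambda>k. cnt (word n) x k / k)" for n
    unfolding cnt_def
  proof (rule birkhoff_averages_convergent)
    show "indicator (cyl (word n)) \<in> borel_measurable \<mu>"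
      using sets_Inv[OF \<mu>] by (intro borel_measurable_indicator) simp
    show "\<bar>indicator (cyl (word n)) x\<bar> \<le> (1::real)" for x by (simp add: indicator_def)
  qed
  then have "AE x in \<mu>. \<forall>n. convergent (\<lambda>k. cnt (word n) x k / k)" by (simp add: AE_all_countable)
  with AE_space show ?thesis
    by eventually_elim (simp add: generic_def space_Inv[OF \<mu>])
qed

text \<open>By invariance all averages have the integral \<open>coords \<mu> n\<close>; they are
  bounded by 1 and converge almost everywhere, so dominated convergence applies.\<close>

lemma
  assumes \<mu>: "\<mu> \<in> Inv"
  shows integrable_freq: "integrable \<mu> (\<lambda>x. freq x n)"
    and integral_freq: "(LINT x|\<mu>. freq x n) = coords \<mu> n"
proof -
  interpret measure_preserving \<mu> shift by (rule measure_preserving_Inv[OF \<mu>])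
  have s: "sets \<mu> = sets SB" by (rule sets_Inv[OF \<mu>])
  have meas: "f \<in> borel_measurable SB \<Longrightarrow> f \<in> borel_measurable \<mu>" for f :: "_ \<Rightarrow> real"
    by (simp add: measurable_cong_sets[OF s refl])
  show "integrable \<mu> (\<lambda>x. freq x n)"
    using freq_bounds by (intro integrable_bounded[where c=1] meas) auto
  \<comment> \<open>The average over 0 steps is 0 and would break the constancy of the
    integrals.\<close>
  let ?f = "\<lambda>k x. cnt (word n) x (Suc k) / Suc k"
  have "(\<lambda>k. LINT x|\<mu>. ?f k x) \<longlonglongrightarrow> (LINT x|\<mu>. freq x n)"
  proof (rule integral_dominated_convergence[where w="\<lambda>_. 1"])
    show "AE x in \<mu>. (\<lambda>k. ?f k x) \<longlonglongrightarrow> freq x n"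
      using AE_generic[OF \<mu>]
      by eventually_elim (rule LIMSEQ_Suc[OF generic_LIMSEQ])
    show "AE x in \<mu>. norm (?f k x) \<le> 1" for k
      using cnt_bounds[of "word n" _ "Suc k"] by (intro AE_I2) (simp add: abs_of_nonneg)
  qed (auto intro!: meas)
  moreover have "(LINT x|\<mu>. ?f k x) = coords \<mu> n" for k
  proof -
    have ind: "(indicator (cyl (word n)) :: _ \<Rightarrow> real) \<in> borel_measurable \<mu>" by (intro meas) simp
    have "integrable \<mu> (\<lambda>x. indicator (cyl (word n)) ((shift ^^ j) x) :: real)" for j
      using measurable_compose[OF funpow_T ind] by (intro integrable_bounded[where c=1]) auto
    then have "(LINT x|\<mu>. cnt (word n) x (Suc k)) = (\<Sum>j<Suc k. LINT x|\<mu>. indicator (cyl (word n)) ((shift ^^ j) x))"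
      unfolding cnt_def birkhoff_sum_def by (intro Bochner_Integration.integral_sum) auto
    also have "\<dots> = (\<Sum>j<Suc k. LINT x|\<mu>. indicator (cyl (word n)) x)"
      by (intro sum.cong refl integral_funpow ind)
    also have "\<dots> = Suc k * coords \<mu> n"
      using s by (simp add: coords_def)
    finally show ?thesis by simp
  qed
  ultimately show "(LINT x|\<mu>. freq x n) = coords \<mu> n"
    by (simp add: LIMSEQ_const_iff)
qed

end

lemma convex_sum_le_1:
  fixes D :: "'a::real_vector set"
  assumes D: "convex D" "0 \<in> D" and R: "finite R"
    and c: "\<And>l. l \<in> R \<Longrightarrow> 0 \<le> c l" "sum c R \<le> 1" and d: "\<And>l. l \<in> R \<Longrightarrow> d l \<in> D"
  shows "(\<Sum>l\<in>R. c l *\<^sub>R d l) \<in> D"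
proof (cases "sum c R = 0")
  case True
  then have "(\<Sum>l\<in>R. c l *\<^sub>R d l) = 0"
    using R c(1) sum_nonneg_eq_0_iff[of R c] by (intro sum.neutral) auto
  then show ?thesis using D by simp
next
  case False
  define s where "s = sum c R"
  have s: "0 < s" "s \<le> 1" using False c sum_nonneg[of R c] by (auto simp: s_def less_le)
  have "(\<Sum>l\<in>R. c l / s) = sum c R / s" by (rule sum_divide_distrib[symmetric])
  then have "(\<Sum>l\<in>R. c l / s) = 1" using s(1) unfolding s_def by simp
  then have "(\<Sum>l\<in>R. (c l / s) *\<^sub>R d l) \<in> D"
    using s(1) c(1) d by (intro convex_sum[OF R D(1)]) simp_all
  then have "(1 - s) *\<^sub>R 0 + s *\<^sub>R (\<Sum>l\<in>R. (c l / s) *\<^sub>R d l) \<in> D"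
    using s by (intro convexD[OF D(1) D(2)]) simp_all
  then show ?thesis using s by (simp add: scaleR_sum_right)
qed

context markov
begin

lemma measurable_Inv: "\<mu> \<in> Inv \<Longrightarrow> f \<in> measurable \<mu> N \<longleftrightarrow> f \<in> measurable SB N"
  by (simp add: measurable_cong_sets[OF sets_Inv refl])

section \<open>Density of the periodic orbits\<close>

text \<open>
  The barycenter of the frequency vectors under \<open>\<mu>\<close> is \<open>coords \<mu>\<close>; approximate the
  integral by a finite convex combination, the missing mass being put on 0.
\<close>

lemma K_subset_closure_P:
  assumes tr: "transitive_shift B" and F: "F_property B"
  shows "K \<subseteq> closure P"
proof
  fix y assume "y \<in> K"
  then obtain \<mu> where \<mu>: "\<mu> \<in> Inv" and y: "y = coords \<mu>" by (auto simp: K_def)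
  interpret finite_measure \<mu> by (rule finite_measure_Inv[OF \<mu>])
  have s: "sets \<mu> = sets SB" and sp: "space \<mu> = S" using sets_Inv space_Inv \<mu> by auto
  have "\<exists>z\<in>closure P. \<forall>n\<le>k. \<bar>z n - y n\<bar> \<le> 1 / (real k + 1)" for k :: nat
  proof -
    \<comment> \<open>The possible integer parts of \<open>(k + 1) * freq x n\<close> for
      \<open>n \<le> k\<close>. They divide \<open>S\<close> into finitely many cells, and inside a
      cell each of these coordinates varies by at most \<open>1 / (k + 1)\<close>.\<close>
    define R where "R = PiE {..k} (\<lambda>_. {0..int k + 1})"
    define fl where "fl x n = \<lfloor>(real k + 1) * freq x n\<rfloor>" for x n
    define E where "E l = {x \<in> S. \<forall>n\<le>k. fl x n = l n}" for l
    \<comment> \<open>On an empty cell this choice is arbitrary; such a cell has weight 0, and the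
      frequency vector of any point is in \<open>closure P\<close>.\<close>
    define g where "g l = (SOME x. x \<in> E l)" for l
    define c where "c l = measure \<mu> (E l)" for l
    define z where "z = (\<Sum>l\<in>R. c l *\<^sub>R freq (g l))"
    have finR: "finite R" unfolding R_def by (intro finite_PiE finite_atMost finite_atLeastAtMost_int)
    have E: "E l \<in> sets \<mu>" for l
    proof -
      have "{x \<in> space SB. l n \<le> (real k + 1) * freq x n \<and> (real k + 1) * freq x n < real_of_int (l n) + 1} \<in> sets SB" for n
        by measurable
      then have "{x \<in> space SB. fl x n = l n} \<in> sets SB" for n
        unfolding fl_def floor_eq_iff .
      then have "(\<Inter>n\<in>{..k}. {x \<in> space SB. fl x n = l n}) \<in> sets SB"
        by (intro sets.finite_INT) auto
      also have "(\<Inter>n\<in>{..k}. {x \<in> space SB. fl x n = l n}) = E l" by (auto simp: E_def)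
      finally show ?thesis using s by simp
    qed
    have flR: "restrict (fl x) {..k} \<in> R" for x
    proof -
      have "0 \<le> fl x n \<and> fl x n \<le> int k + 1" for n
      proof -
        have "(real k + 1) * freq x n \<le> (real k + 1) * 1"
          using freq_bounds by (intro mult_left_mono) auto
        then have "fl x n \<le> \<lfloor>real k + 1\<rfloor>" unfolding fl_def by (intro floor_mono) simp
        then show ?thesis using freq_bounds[of x n] by (simp add: fl_def)
      qed
      then show ?thesis by (auto simp: R_def)
    qed
    have ind: "indicator (E l) x = (if l = restrict (fl x) {..k} then 1 else 0 :: real)"
      if l: "l \<in> R" and x: "x \<in> S" for l x
    proof -
      have "l = restrict (fl x) {..k}" if "\<forall>n\<le>k. fl x n = l n"
        by (rule PiE_ext[OF l[unfolded R_def] flR[of x, unfolded R_def]]) (use that in simp)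
      moreover have "\<forall>n\<le>k. fl x n = l n" if "l = restrict (fl x) {..k}" using that by simp
      ultimately have "l = restrict (fl x) {..k} \<longleftrightarrow> (\<forall>n\<le>k. fl x n = l n)" by blast
      then show ?thesis using x by (simp only: E_def indicator_def mem_Collect_eq simp_thms if_True if_False)
          (simp only: of_bool_def)
    qed
    have "sum c R = measure \<mu> (\<Union>l\<in>R. E l)"
    proof -
      have "disjoint_family_on E R"
        unfolding disjoint_family_on_def
      proof (intro ballI impI, rule ccontr)
        fix l m assume lm: "l \<in> R" "m \<in> R" "l \<noteq> m" "E l \<inter> E m \<noteq> {}"
        then obtain x where "x \<in> E l" "x \<in> E m" by blast
        then have "x \<in> S" "indicator (E l) x = (1::real)" "indicator (E m) x = (1::real)"
          by (auto simp: E_def)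
        then show False using ind[of l x] ind[of m x] lm by (auto split: if_splits)
      qed
      then show ?thesis
        unfolding c_def using finR E by (intro finite_measure_finite_Union[symmetric]) auto
    qed
    then have c1: "sum c R \<le> 1" using measure_Inv_le_1[OF \<mu>] by simp
    have "z \<in> closure P"
      unfolding z_def
      by (intro convex_sum_le_1 convex_closure_P zero_in_closure_P[OF tr F] finR c1 freq_in_closure_P[OF tr F])
        (simp add: c_def)
    moreover have "\<bar>z n - y n\<bar> \<le> 1 / (real k + 1)" if n: "n \<le> k" for n
    proof -
      define h where "h x = (\<Sum>l\<in>R. indicator (E l) x * freq (g l) n)" for x
      have int: "integrable \<mu> (\<lambda>x. indicator (E l) x * freq (g l) n)" for l
        using E by (intro integrable_mult_left integrable_real_indicator) (auto simp: less_top[symmetric])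
      have int_h: "integrable \<mu> h"
        unfolding h_def using int by (intro Bochner_Integration.integrable_sum)
      have "(LINT x|\<mu>. h x) = (\<Sum>l\<in>R. c l * freq (g l) n)"
        unfolding h_def using int E by (subst Bochner_Integration.integral_sum) (auto simp: c_def)
      also have "\<dots> = z n" unfolding z_def by (induction R rule: infinite_finite_induct) (auto simp: scaleR_fun_def)
      finally have zh: "z n = (LINT x|\<mu>. h x)" ..
      have near: "\<bar>h x - freq x n\<bar> \<le> 1 / (real k + 1)" if x: "x \<in> S" for x
      proof -
        let ?l = "restrict (fl x) {..k}"
        have "h x = (\<Sum>l\<in>R. if l = ?l then freq (g l) n else 0)"
          unfolding h_def using ind x by (intro sum.cong) auto
        then have hx: "h x = freq (g ?l) n" using finR flR by simp
        have "x \<in> E ?l" using x by (simp add: E_def)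
        then have "g ?l \<in> E ?l" unfolding g_def by (rule someI[of "\<lambda>x. x \<in> E ?l"])
        then have "fl (g ?l) n = fl x n" using n by (simp add: E_def)
        then have "\<bar>(real k + 1) * freq (g ?l) n - (real k + 1) * freq x n\<bar> \<le> 1"
          unfolding fl_def by linarith
        then have "(real k + 1) * \<bar>freq (g ?l) n - freq x n\<bar> \<le> 1"
          by (simp add: right_diff_distrib[symmetric] abs_mult)
        then show ?thesis by (simp add: hx field_simps)
      qed
      have "z n - y n = (LINT x|\<mu>. h x - freq x n)"
        using int_h integrable_freq[OF \<mu>] by (simp add: zh y integral_freq[OF \<mu>, symmetric])
      also have "\<bar>\<dots>\<bar> \<le> (LINT x|\<mu>. \<bar>h x - freq x n\<bar>)" by (rule integral_abs_bound)
      also have "\<dots> \<le> (LINT x|\<mu>. 1 / (real k + 1))"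
        using near sp int_h integrable_freq[OF \<mu>] by (intro integral_mono) auto
      also have "\<dots> = 1 / (real k + 1) * measure \<mu> S" by (simp add: sp)
      also have "\<dots> \<le> 1 / (real k + 1) * 1"
        using measure_Inv_le_1[OF \<mu>] by (intro mult_left_mono) auto
      finally show ?thesis by simp
    qed
    ultimately show ?thesis by blast
  qed
  then obtain z where z: "\<And>k. z k \<in> closure P" "\<And>k n. n \<le> k \<Longrightarrow> \<bar>z k n - y n\<bar> \<le> 1 / (real k + 1)"
    by metis
  have "(\<lambda>k. z k n) \<longlonglongrightarrow> y n" for n
  proof (rule LIMSEQ_offset[of _ n], rule LIMSEQ_of_le_inverse)
    fix k :: nat
    have "\<bar>z (k + n) n - y n\<bar> \<le> 1 / (real (k + n) + 1)" by (rule z) simp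
    also have "\<dots> \<le> 1 / (real k + 1)" by (intro divide_left_mono) auto
    finally show "\<bar>z (k + n) n - y n\<bar> \<le> 1 / (real k + 1)" .
  qed
  then have "y \<in> closure (closure P)" by (rule in_closure_coordinatewise[OF z(1)])
  then show "y \<in> closure P" by simp
qed

section \<open>The measure belonging to a point\<close>

definition measure_at :: "(nat \<Rightarrow> real) \<Rightarrow> (nat \<Rightarrow> nat) measure" where
  "measure_at = inv_into Inv coords"

lemma measure_at_Inv: "y \<in> K \<Longrightarrow> measure_at y \<in> Inv"
  unfolding measure_at_def K_def by (rule inv_into_into)

lemma coords_measure_at: "y \<in> K \<Longrightarrow> coords (measure_at y) = y"
  unfolding measure_at_def K_def by (rule f_inv_into_f)

lemma measure_at_coords: "\<mu> \<in> Inv \<Longrightarrow> measure_at (coords \<mu>) = \<mu>"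
  unfolding measure_at_def by (rule inv_into_f_f[OF inj_coords])

abbreviation "BK \<equiv> borel_of (subtopology (euclidean :: (nat \<Rightarrow> real) topology) K)"

lemma space_BK[simp]: "space BK = K"
  by (simp add: borel_of_def space_measure_of_conv)

end

locale F_markov = markov +
  assumes transitive: "transitive_shift B"
    and F: "F_property B"
begin

lemma sets_BK: "sets BK = sets (restrict_space borel K)"
proof -
  have "{U. openin (subtopology euclidean K) U} = (\<inter>) K ` {U. open U}"
    by (auto simp: openin_open)
  then have "sets BK = sigma_sets K ((\<inter>) K ` {U. open U})"
    unfolding borel_of_def by (subst sets_measure_of) auto
  also have "\<dots> = (\<inter>) K ` sigma_sets UNIV {U. open U}"
  proof (rule sigma_sets_Int[symmetric])
    have "K \<in> sets borel" using closed_K[OF F] by simp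
    then show "K \<in> sigma_sets UNIV {U. open U}" by (simp add: borel_def)
  qed simp
  also have "\<dots> = sets (restrict_space borel K)"
    by (simp add: sets_restrict_space borel_def)
  finally show ?thesis .
qed

lemma measurable_BK_coordinate[measurable]: "(\<lambda>y. y n) \<in> borel_measurable BK"
proof -
  have "(\<lambda>y::nat \<Rightarrow> real. y n) \<in> borel_measurable borel"
    by (intro borel_measurable_continuous_onI continuous_on_product_coordinates)
  then have "(\<lambda>y. y n) \<in> borel_measurable (restrict_space borel K)" by (rule measurable_restrict_space1)
  then show ?thesis by (simp add: measurable_cong_sets[OF sets_BK refl])
qed

lemma measurable_into_BK:
  assumes "f \<in> space M \<rightarrow> K" "\<And>n. (\<lambda>x. f x n) \<in> borel_measurable M"
  shows "f \<in> measurable M BK"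
proof -
  have "f \<in> borel_measurable M" using assms(2) by (rule measurable_coordinatewise_then_product)
  then have "f \<in> measurable M (restrict_space borel K)"
    using assms(1) by (intro measurable_restrict_space2) auto
  then show ?thesis by (simp add: measurable_cong_sets[OF refl sets_BK])
qed

lemma freq_mem_K: "freq x \<in> K"
  by (rule freq_in_K[OF transitive F])

lemma measurable_freq_BK[measurable]: "freq \<in> measurable SB BK"
  using freq_mem_K by (intro measurable_into_BK) auto

lemma emeasure_measure_at_cyl:
  assumes "y \<in> K"
  shows "emeasure (measure_at y) (cyl (word n)) = ennreal (y n)"
proof -
  have "measure (measure_at y) (cyl (word n)) = y n"
    using fun_cong[OF coords_measure_at[OF assms], of n] by (simp add: coords_def)
  then show ?thesis
    using finite_measure.emeasure_eq_measure[OF finite_measure_Inv[OF measure_at_Inv[OF assms]]] by simp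
qed

text \<open>The value on a cylinder is a coordinate. The total mass is not a coordinate, but it is
  the countable sum of the values on the one-letter cylinders.\<close>

lemma measurable_measure_at[measurable]: "measure_at \<in> measurable BK (subprob_algebra SB)"
proof (rule measurable_subprob_algebra_generated[OF sets_SB' Int_stable_cylinders])
  show "insert {} (cylinders B) \<subseteq> Pow S" using cyl_subset by (auto simp: cylinders_def)
  have cyl: "(\<lambda>y. emeasure (measure_at y) (cyl w)) \<in> borel_measurable BK" if "w \<noteq> []" for w
  proof -
    obtain n where n: "word n = w" using word_surj[OF \<open>w \<noteq> []\<close>] by blast
    have eq: "emeasure (measure_at y) (cyl w) = ennreal (y n)" if "y \<in> space BK" for y
      using emeasure_measure_at_cyl[of y n] that by (simp add: n)
    have "(\<lambda>y. ennreal (y n)) \<in> borel_measurable BK" by measurable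
    then show ?thesis
      using measurable_cong[of BK "\<lambda>y. emeasure (measure_at y) (cyl w)" "\<lambda>y. ennreal (y n)", OF eq] by blast
  qed
  show "(\<lambda>y. emeasure (measure_at y) A) \<in> borel_measurable BK" if "A \<in> insert {} (cylinders B)" for A
    using that cyl by (auto simp: cylinders_def)
  have "emeasure (measure_at y) S = (\<Sum>a. emeasure (measure_at y) (cyl [a]))" if "y \<in> K" for y
  proof -
    have "(\<Sum>a. emeasure (measure_at y) (cyl [a])) = emeasure (measure_at y) (\<Union>a. cyl [a])"
      using disjoint_cyl sets_Inv[OF measure_at_Inv[OF that]]
      by (intro suminf_emeasure) (auto simp: disjoint_family_on_def)
    also have "(\<Union>a. cyl [a]) = S" by (auto simp: mem_cyl_singleton)
    finally show ?thesis ..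
  qed
  then have "(\<lambda>y. emeasure (measure_at y) S) \<in> borel_measurable BK
    \<longleftrightarrow> (\<lambda>y. \<Sum>a. emeasure (measure_at y) (cyl [a])) \<in> borel_measurable BK"
    by (intro measurable_cong) simp
  moreover have "(\<lambda>y. \<Sum>a. emeasure (measure_at y) (cyl [a])) \<in> borel_measurable BK"
    by (intro borel_measurable_suminf_order cyl) simp
  ultimately show "(\<lambda>y. emeasure (measure_at y) S) \<in> borel_measurable BK" by blast
  fix y assume "y \<in> space BK"
  then have y: "measure_at y \<in> Inv" by (simp add: measure_at_Inv)
  show "sets (measure_at y) = sets SB" by (rule sets_Inv[OF y])
  show "subprob_space (measure_at y)"
    using space_Inv[OF y] emeasure_Inv_le[OF y] S_nonempty by (intro subprob_spaceI) simp_all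
qed

end

context F_markov
begin

section \<open>Ergodic decomposition\<close>

lemma kernel_freq:
  assumes "\<mu> \<in> Inv"
  shows "(\<lambda>x. measure_at (freq x)) \<in> measurable \<mu> (subprob_algebra SB)"
  unfolding measurable_Inv[OF assms] by measurable

lemma measurable_emeasure_freq:
  assumes "\<mu> \<in> Inv" "E \<in> sets SB"
  shows "(\<lambda>x. emeasure (measure_at (freq x)) E) \<in> borel_measurable \<mu>"
  using measurable_compose[OF kernel_freq[OF assms(1)] measurable_emeasure_subprob_algebra[OF assms(2)]] by simp

lemma emeasure_measure_at_le_1: "y \<in> K \<Longrightarrow> emeasure (measure_at y) A \<le> 1"
  by (rule subprob_space_emeasure_Inv[OF measure_at_Inv])

lemma emeasure_cyl_Inv:
  assumes "\<mu> \<in> Inv"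
  shows "emeasure \<mu> (cyl (word n)) = ennreal (coords \<mu> n)"
  using finite_measure.emeasure_eq_measure[OF finite_measure_Inv[OF assms]] by (simp add: coords_def)

text \<open>The left side is the measure \<open>N \<bind> \<kappa>\<close>, which is determined by
  its values on cylinders. It is used with \<mu> and the frequency kernel for the ergodic
  decomposition, and with a representing measure for uniqueness.\<close>

lemma nn_integral_kernel_eq:
  assumes \<mu>: "\<mu> \<in> Inv" and N: "space N \<noteq> {}"
    and \<kappa>: "\<kappa> \<in> measurable N (subprob_algebra SB)"
    and cyl: "\<And>n. (\<integral>\<^sup>+x. emeasure (\<kappa> x) (cyl (word n)) \<partial>N) = emeasure \<mu> (cyl (word n))"
    and E: "E \<in> sets SB"
  shows "(\<integral>\<^sup>+x. emeasure (\<kappa> x) E \<partial>N) = emeasure \<mu> E"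
proof -
  have bind: "emeasure (N \<bind> \<kappa>) X = (\<integral>\<^sup>+x. emeasure (\<kappa> x) X \<partial>N)" if "X \<in> sets SB" for X
    by (rule emeasure_bind[OF N \<kappa> that])
  have "\<mu> = N \<bind> \<kappa>"
  proof (rule measure_eqI_cyl[OF sets_Inv[OF \<mu>] sets_bind_measurable[OF \<kappa> N]])
    show "emeasure \<mu> S \<noteq> \<infinity>" using emeasure_Inv_le[OF \<mu>] by (auto simp: top_unique)
    fix w :: "nat list" assume "w \<noteq> []"
    then obtain n where n: "word n = w" using word_surj by blast
    show "emeasure \<mu> (cyl w) = emeasure (N \<bind> \<kappa>) (cyl w)"
      using cyl[of n] by (simp add: bind n)
  qed
  then show ?thesis using bind[OF E] by simp
qed

lemma nn_integral_measure_at_freq: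
  assumes \<mu>: "\<mu> \<in> Inv" and E: "E \<in> sets SB"
  shows "(\<integral>\<^sup>+x. emeasure (measure_at (freq x)) E \<partial>\<mu>) = emeasure \<mu> E"
proof (rule nn_integral_kernel_eq[OF \<mu> _ kernel_freq[OF \<mu>] _ E])
  show "space \<mu> \<noteq> {}" using space_Inv[OF \<mu>] S_nonempty by simp
  fix n
  have "(\<integral>\<^sup>+x. emeasure (measure_at (freq x)) (cyl (word n)) \<partial>\<mu>) = (\<integral>\<^sup>+x. ennreal (freq x n) \<partial>\<mu>)"
    by (simp add: emeasure_measure_at_cyl freq_mem_K)
  also have "\<dots> = ennreal (LINT x|\<mu>. freq x n)"
    using freq_bounds by (intro nn_integral_eq_integral integrable_freq[OF \<mu>]) simp
  finally show "(\<integral>\<^sup>+x. emeasure (measure_at (freq x)) (cyl (word n)) \<partial>\<mu>) = emeasure \<mu> (cyl (word n))"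
    by (simp add: integral_freq[OF \<mu>] emeasure_cyl_Inv[OF \<mu>])
qed

text \<open>The factor \<open>c\<close> allows two uses: \<open>c = 1\<close> localises the
  decomposition to an invariant set, while a normalising factor produces the two parts into which a
  point that is not extreme splits.\<close>

lemma
  assumes \<mu>: "\<mu> \<in> Inv" and A: "A \<in> sets SB" and inv: "shift -` A \<inter> S = A"
    and c: "c * emeasure \<mu> A \<le> 1"
  defines "\<nu> \<equiv> scale_measure c (density \<mu> (indicator A))"
  shows restrict_Inv: "\<nu> \<in> Inv"
    and emeasure_restrict_Inv: "X \<in> sets SB \<Longrightarrow> emeasure \<nu> X = c * emeasure \<mu> (A \<inter> X)"
proof -
  have s: "sets \<mu> = sets SB" by (rule sets_Inv[OF \<mu>])
  have e: "emeasure \<nu> X = c * emeasure \<mu> (A \<inter> X)" if "X \<in> sets SB" for X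
    using A that by (simp add: \<nu>_def emeasure_restricted s)
  then show "X \<in> sets SB \<Longrightarrow> emeasure \<nu> X = c * emeasure \<mu> (A \<inter> X)" by blast
  have AS: "A \<subseteq> S" using sets.sets_into_space[OF A] by simp
  show "\<nu> \<in> Inv"
  proof (rule InvI)
    show "sets \<nu> = sets SB" by (simp add: \<nu>_def s)
    have "A \<inter> S = A" using AS by blast
    then show "emeasure \<nu> S \<le> 1" using e[of S] sets.top[of SB] c by simp
    fix w
    have v: "shift -` X \<inter> S \<in> sets SB" if "X \<in> sets SB" for X
      using measurable_sets[OF measurable_shift that] by simp
    have "A \<inter> (shift -` cyl w \<inter> S) = shift -` (A \<inter> cyl w) \<inter> S" using inv by blast
    then have "emeasure \<nu> (shift -` cyl w \<inter> S) = c * emeasure \<mu> (shift -` (A \<inter> cyl w) \<inter> S)"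
      using e[OF v[of "cyl w"]] by simp
    also have "emeasure \<mu> (shift -` (A \<inter> cyl w) \<inter> S) = emeasure \<mu> (A \<inter> cyl w)"
    proof -
      have "A \<inter> cyl w \<in> sets \<mu>" using A s by simp
      then show ?thesis using \<mu> unfolding inv_subprob_measures_def by blast
    qed
    finally show "emeasure \<nu> (shift -` cyl w \<inter> S) = emeasure \<nu> (cyl w)" using e by simp
  qed
qed

text \<open>The restriction of \<mu> to \<open>A\<close> is again invariant, and its decomposition
  uses the same kernel because \<open>freq\<close> depends only on the point.\<close>

lemma nn_integral_invariant_set:
  assumes \<mu>: "\<mu> \<in> Inv" and A: "A \<in> sets SB" and inv: "shift -` A \<inter> S = A" and E: "E \<in> sets SB"
  shows "(\<integral>\<^sup>+x. indicator A x * emeasure (measure_at (freq x)) E \<partial>\<mu>) = emeasure \<mu> (A \<inter> E)"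
proof -
  let ?\<nu> = "scale_measure 1 (density \<mu> (indicator A))"
  have c: "1 * emeasure \<mu> A \<le> 1" using subprob_space_emeasure_Inv[OF \<mu>] by simp
  have "emeasure \<mu> (A \<inter> E) = emeasure ?\<nu> E"
    by (simp only: emeasure_restrict_Inv[OF \<mu> A inv c E] mult_1)
  also have "\<dots> = (\<integral>\<^sup>+x. emeasure (measure_at (freq x)) E \<partial>?\<nu>)"
    by (rule nn_integral_measure_at_freq[OF restrict_Inv[OF \<mu> A inv c] E, symmetric])
  also have "\<dots> = (\<integral>\<^sup>+x. emeasure (measure_at (freq x)) E \<partial>density \<mu> (indicator A))"
    by (simp only: scale_measure_1)
  also have "\<dots> = (\<integral>\<^sup>+x. indicator A x * emeasure (measure_at (freq x)) E \<partial>\<mu>)"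
    using A sets_Inv[OF \<mu>] measurable_emeasure_freq[OF \<mu> E]
    by (intro nn_integral_density) (auto intro!: borel_measurable_indicator)
  finally show ?thesis ..
qed

definition freq_le :: "nat \<Rightarrow> real \<Rightarrow> (nat \<Rightarrow> nat) set" where
  "freq_le n q = {x \<in> S. freq x n \<le> q}"

lemma freq_le_sets[measurable]: "freq_le n q \<in> sets SB"
proof -
  have "freq_le n q = {x \<in> space SB. freq x n \<le> q}" by (simp add: freq_le_def)
  also have "\<dots> \<in> sets SB" by measurable
  finally show ?thesis .
qed

lemma freq_le_invariant: "shift -` freq_le n q \<inter> S = freq_le n q"
  using freq_shift shift_in_S by (auto simp: freq_le_def)

lemma invariant_Diff: "shift -` A \<inter> S = A \<Longrightarrow> shift -` (S - A) \<inter> S = S - A"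
  using shift_in_S by blast

text \<open>With \<open>E = S - A\<close> the integral in \<open>nn_integral_invariant_set\<close>
  is the measure of the empty set.\<close>

lemma AE_emeasure_outside_invariant:
  assumes \<mu>: "\<mu> \<in> Inv" and A: "A \<in> sets SB" and inv: "shift -` A \<inter> S = A"
  shows "AE x in \<mu>. x \<in> A \<longrightarrow> emeasure (measure_at (freq x)) (S - A) = 0"
proof -
  have SA: "S - A \<in> sets SB" using A sets.Diff[OF sets.top[of SB] A] by simp
  have "(\<integral>\<^sup>+x. indicator A x * emeasure (measure_at (freq x)) (S - A) \<partial>\<mu>) = 0"
    unfolding nn_integral_invariant_set[OF \<mu> A inv SA] by simp
  moreover have "(\<lambda>x. indicator A x * emeasure (measure_at (freq x)) (S - A)) \<in> borel_measurable \<mu>"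
  proof -
    have [measurable]: "indicator A \<in> borel_measurable \<mu>"
      using A sets_Inv[OF \<mu>] by (intro borel_measurable_indicator) simp
    show ?thesis using measurable_emeasure_freq[OF \<mu> SA] by measurable
  qed
  ultimately have "AE x in \<mu>. indicator A x * emeasure (measure_at (freq x)) (S - A) = 0"
    by (simp add: nn_integral_0_iff_AE)
  then show ?thesis by eventually_elim (auto simp: indicator_def)
qed

text \<open>A frequency vector may lose mass at single points. But the masses are at most 1 and
  their integral is the whole mass of \<mu>, so almost none of them is below 1.\<close>

lemma AE_emeasure_total:
  assumes \<mu>: "\<mu> \<in> Inv"
  shows "AE x in \<mu>. emeasure (measure_at (freq x)) S = 1"
proof -
  have SS: "S \<in> sets SB" using sets.top[of SB] by simp
  note m = measurable_emeasure_freq[OF \<mu> SS]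
  have fin: "emeasure \<mu> S \<noteq> \<infinity>" using emeasure_Inv_le[OF \<mu>] by (auto simp: top_unique)
  have "(\<integral>\<^sup>+x. 1 - emeasure (measure_at (freq x)) S \<partial>\<mu>) = (\<integral>\<^sup>+x. 1 \<partial>\<mu>) - (\<integral>\<^sup>+x. emeasure (measure_at (freq x)) S \<partial>\<mu>)"
    using fin nn_integral_measure_at_freq[OF \<mu> SS] emeasure_measure_at_le_1[OF freq_mem_K]
    by (intro nn_integral_diff m) auto
  also have "\<dots> = 0"
    unfolding nn_integral_measure_at_freq[OF \<mu> SS] using fin space_Inv[OF \<mu>] by simp
  finally have "AE x in \<mu>. 1 - emeasure (measure_at (freq x)) S = 0"
    using m by (subst (asm) nn_integral_0_iff_AE) auto
  then show ?thesis
  proof eventually_elim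
    case (elim x)
    then have "1 \<le> emeasure (measure_at (freq x)) S" by (simp add: diff_eq_0_iff_ennreal)
    with emeasure_measure_at_le_1[OF freq_mem_K] show ?case by (rule antisym)
  qed
qed

lemma eq_freq_sets[measurable]: "{x \<in> S. freq x = y} \<in> sets SB"
proof -
  have "{x \<in> S. freq x = y} = {x \<in> space SB. \<forall>n. freq x n = y n}" by (simp add: fun_eq_iff)
  also have "\<dots> \<in> sets SB" by measurable
  finally show ?thesis .
qed

text \<open>Use the invariant sets \<open>freq_le n q\<close> with rational \<open>q\<close> and
  their complements, which are countably many. For almost every \<open>x\<close>, almost every
  \<open>z\<close> with respect to the measure at \<open>freq x\<close> lies on the same side of
  each of them as \<open>x\<close>, and this forces \<open>freq z = freq x\<close>.\<close>

lemma AE_ergodic: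
  assumes \<mu>: "\<mu> \<in> Inv"
  shows "AE x in \<mu>. emeasure (measure_at (freq x)) {z \<in> S. freq z = freq x} = 1"
proof -
  have 1: "AE x in \<mu>. \<forall>n. \<forall>q\<in>\<rat>. x \<in> freq_le n q \<longrightarrow> emeasure (measure_at (freq x)) (S - freq_le n q) = 0"
    unfolding AE_all_countable AE_ball_countable[OF countable_rat]
    using AE_emeasure_outside_invariant[OF \<mu> freq_le_sets freq_le_invariant] by blast
  have "AE x in \<mu>. x \<in> S - freq_le n q \<longrightarrow> emeasure (measure_at (freq x)) (S - (S - freq_le n q)) = 0" for n q
    using sets.Diff[OF sets.top[of SB] freq_le_sets] 
    by (intro AE_emeasure_outside_invariant[OF \<mu> _ invariant_Diff[OF freq_le_invariant]]) simp
  then have 2: "AE x in \<mu>. \<forall>n. \<forall>q\<in>\<rat>. x \<in> S - freq_le n q \<longrightarrow> emeasure (measure_at (freq x)) (S - (S - freq_le n q)) = 0"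
    unfolding AE_all_countable AE_ball_countable[OF countable_rat] by blast
  show ?thesis
    using 1 2 AE_emeasure_total[OF \<mu>] AE_space
  proof eventually_elim
    case (elim x)
    let ?m = "measure_at (freq x)"
    have m: "?m \<in> Inv" by (rule measure_at_Inv[OF freq_mem_K])
    have s: "sets ?m = sets SB" and sp: "space ?m = S" using sets_Inv[OF m] space_Inv[OF m] by auto
    have xS: "x \<in> S" using elim(4) space_Inv[OF \<mu>] by simp
    have nullI: "AE z in ?m. z \<notin> N" if "emeasure ?m N = 0" "N \<in> sets SB" for N
      using that s by (intro AE_not_in null_setsI) auto
    have sD: "S - freq_le n q \<in> sets SB" for n q using sets.Diff[OF sets.top[of SB] freq_le_sets] by simp
    have "AE z in ?m. freq x n \<le> q \<longrightarrow> freq z n \<le> q" if "q \<in> \<rat>" for n q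
    proof (cases "freq x n \<le> q")
      case True
      then have "emeasure ?m (S - freq_le n q) = 0" using elim(1) that xS by (simp add: freq_le_def)
      from nullI[OF this sD] AE_space show ?thesis by eventually_elim (auto simp: freq_le_def sp)
    qed simp
    moreover have "AE z in ?m. freq z n \<le> q \<longrightarrow> freq x n \<le> q" if "q \<in> \<rat>" for n q
    proof (cases "freq x n \<le> q")
      case False
      have eq: "S - (S - freq_le n q) = freq_le n q" by (auto simp: freq_le_def)
      have "x \<in> S - freq_le n q" using xS False by (simp add: freq_le_def)
      then have "emeasure ?m (S - (S - freq_le n q)) = 0" using elim(2) that by blast
      then have "emeasure ?m (freq_le n q) = 0" by (simp only: eq)
      from nullI[OF this freq_le_sets] AE_space show ?thesis by eventually_elim (auto simp: freq_le_def sp)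
    qed simp
    ultimately have "AE z in ?m. \<forall>n. \<forall>q\<in>\<rat>. freq x n \<le> q \<longleftrightarrow> freq z n \<le> q"
      unfolding AE_all_countable AE_ball_countable[OF countable_rat] iff_conv_conj_imp AE_conj_iff by blast
    then have AE: "AE z in ?m. freq z = freq x"
    proof eventually_elim
      case (elim z)
      have "freq z n = freq x n" for n
      proof (rule ccontr)
        assume "freq z n \<noteq> freq x n"
        then consider "freq z n < freq x n" | "freq x n < freq z n" by linarith
        then show False
        proof cases
          case 1
          then obtain q where "q \<in> \<rat>" "freq z n < q" "q < freq x n" using Rats_dense_in_real by blast
          then show False using elim[rule_format, of q n] by simp
        next
          case 2
          then obtain q where "q \<in> \<rat>" "freq x n < q" "q < freq z n" using Rats_dense_in_real by blast
          then show False using elim[rule_format, of q n] by simp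
        qed
      qed
      then show ?case by (simp add: fun_eq_iff)
    qed
    have "emeasure ?m {z \<in> S. freq z = freq x} = emeasure ?m S"
      using AE sets.top[of SB] eq_freq_sets s by (intro emeasure_eq_AE) (auto elim: eventually_mono)
    then show ?case using elim(3) by simp
  qed
qed

text \<open>Ergodicity in terms of frequencies: almost every point has \<open>y\<close> itself as
  its frequency vector. In this form the set is accessible to measurability arguments, and
  \<open>extreme_points_K\<close> identifies it with the nonzero extreme points.\<close>

definition ergodic_points :: "(nat \<Rightarrow> real) set" where
  "ergodic_points = {y \<in> K. emeasure (measure_at y) {x \<in> S. freq x = y} = 1}"

text \<open>The relation \<open>freq x = y\<close> is jointly measurable in \<open>x\<close> and
  \<open>y\<close>, so the kernel \<open>measure_at\<close> evaluates its sections
  measurably.\<close>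

lemma ergodic_points_sets: "ergodic_points \<in> sets BK"
proof -
  have *: "{p \<in> space (BK \<Otimes>\<^sub>M SB). \<forall>n. freq (snd p) n = fst p n} \<in> sets (BK \<Otimes>\<^sub>M SB)"
    by measurable
  moreover have "{p \<in> space (BK \<Otimes>\<^sub>M SB). \<forall>n. freq (snd p) n = fst p n} = (SIGMA y:space BK. {x \<in> S. freq x = y})"
    by (auto simp: space_pair_measure fun_eq_iff)
  ultimately have "(\<lambda>y. emeasure (measure_at y) {x \<in> S. freq x = y}) \<in> borel_measurable BK"
    using measurable_measure_at by (intro emeasure_measurable_subprob_algebra2[where N=SB]) simp_all
  then have "{y \<in> space BK. emeasure (measure_at y) {x \<in> S. freq x = y} = 1} \<in> sets BK"
    by measurable
  then show ?thesis by (simp add: ergodic_points_def)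
qed

lemma zero_Inv: "null_measure SB \<in> Inv"
  by (rule InvI) simp_all

lemma coords_zero: "coords (null_measure SB) = 0"
  by (simp add: coords_def fun_eq_iff measure_def)

lemma zero_in_K: "0 \<in> K"
  using zero_Inv coords_zero unfolding K_def by (metis imageI)

lemma measure_at_zero: "measure_at 0 = null_measure SB"
  using measure_at_coords[OF zero_Inv] by (simp add: coords_zero)

lemma zero_not_ergodic: "0 \<notin> ergodic_points"
  by (simp add: ergodic_points_def measure_at_zero)

end

section \<open>Continuous linear functionals on real sequences\<close>

lemma sum_fun_apply: "(\<Sum>j\<in>J. f j) i = (\<Sum>j\<in>J. f j i)"
  for f :: "'a \<Rightarrow> 'b \<Rightarrow> real"
  by (induction J rule: infinite_finite_induct) auto

lemma linear_coordinate: "linear (\<lambda>z::nat \<Rightarrow> real. z n)"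
  by (rule linearI) (simp_all add: scaleR_fun_def)

text \<open>
  A neighbourhood of 0 on which the functional is bounded restricts only finitely many
  coordinates, and the functional vanishes where these vanish.
\<close>

lemma continuous_linear_functional_finite_sum:
  fixes f :: "(nat \<Rightarrow> real) \<Rightarrow> real"
  assumes lin: "linear f" and cont: "continuous_on UNIV f"
  shows "\<exists>J c. finite J \<and> (\<forall>z. f z = (\<Sum>j\<in>J. z j * c j))"
proof -
  have "open (f -` ball 0 1)" using open_vimage[OF open_ball cont] by simp
  then have op: "openin (product_topology (\<lambda>_. euclidean) UNIV) (f -` ball 0 1)"
    by (simp add: euclidean_product_topology)
  have "0 \<in> f -` ball 0 1" using linear_0[OF lin] by simp
  from product_topology_open_contains_basis[OF op this]
  obtain X where X: "0 \<in> PiE UNIV X" "finite {i. X i \<noteq> UNIV}" "PiE UNIV X \<subseteq> f -` ball 0 1"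
    by auto
  define J where "J = {i. X i \<noteq> UNIV}"
  have zero: "f z = 0" if z: "\<And>j. j \<in> J \<Longrightarrow> z j = 0" for z
  proof (rule ccontr)
    assume nz: "f z \<noteq> 0"
    define t where "t = 1 / f z"
    have "(t *\<^sub>R z) i \<in> X i" for i
    proof (cases "i \<in> J")
      case True
      then have "(t *\<^sub>R z) i = 0" using z by (simp add: scaleR_fun_def)
      moreover have "0 \<in> X i" using X(1) by (simp add: PiE_iff)
      ultimately show ?thesis by simp
    qed (simp add: J_def)
    then have "t *\<^sub>R z \<in> PiE UNIV X" by (simp add: PiE_iff)
    then have "f (t *\<^sub>R z) \<in> ball 0 1" using X(3) by blast
    then have "\<bar>t * f z\<bar> < 1" using linear_scale[OF lin, of t z] by (simp add: dist_real_def)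
    then show False using nz by (simp add: t_def)
  qed
  define e where "e j = (\<lambda>i. if i = j then 1 else 0 :: real)" for j :: nat
  have "f z = (\<Sum>j\<in>J. z j * f (e j))" for z
  proof -
    have "f (z - (\<Sum>j\<in>J. z j *\<^sub>R e j)) = 0"
    proof (rule zero)
      fix i assume i: "i \<in> J"
      have "(\<Sum>j\<in>J. z j *\<^sub>R e j) i = (\<Sum>j\<in>J. if j = i then z i else 0)"
        unfolding sum_fun_apply by (intro sum.cong) (auto simp: scaleR_fun_def e_def)
      also have "\<dots> = z i" using i X(2) by (simp add: J_def)
      finally show "(z - (\<Sum>j\<in>J. z j *\<^sub>R e j)) i = 0" by simp
    qed
    then have "f z = f (\<Sum>j\<in>J. z j *\<^sub>R e j)" using linear_diff[OF lin] by simp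
    also have "\<dots> = (\<Sum>j\<in>J. z j * f (e j))"
      by (simp add: linear_sum[OF lin] linear_scale[OF lin])
    finally show ?thesis .
  qed
  moreover have "finite J" using X(2) by (simp add: J_def)
  ultimately show ?thesis by (intro exI[of _ J] exI[of _ "\<lambda>j. f (e j)"] conjI allI)
qed

lemma locally_convex_space_sequences:
  "locally_convex_space (euclidean :: (nat \<Rightarrow> real) topology)"
  unfolding locally_convex_space_def
proof (intro conjI allI impI)
  show "Hausdorff_space (euclidean :: (nat \<Rightarrow> real) topology)" by simp
  have coordinatewise: "continuous_map Z euclidean f"
    if "\<And>i. continuous_map Z euclideanreal (\<lambda>p. f p i)"
    for Z :: "'b topology" and f :: "'b \<Rightarrow> nat \<Rightarrow> real"
    using continuous_map_componentwise_UNIV[of Z "\<lambda>_. euclidean" f] that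
    by (simp add: euclidean_product_topology)
  have coord: "continuous_map euclidean euclideanreal (\<lambda>z::nat \<Rightarrow> real. z i)" for i
    by simp
  show "continuous_map (prod_topology euclidean euclidean) euclidean (\<lambda>(x, y). x + y :: nat \<Rightarrow> real)"
  proof (rule coordinatewise)
    fix i
    have "continuous_map (prod_topology euclidean euclidean) euclideanreal
      (\<lambda>p::(nat \<Rightarrow> real) \<times> (nat \<Rightarrow> real). fst p i + snd p i)"
      by (intro continuous_map_add continuous_map_compose[OF continuous_map_fst coord, unfolded comp_def]
          continuous_map_compose[OF continuous_map_snd coord, unfolded comp_def])
    then show "continuous_map (prod_topology euclidean euclidean) euclideanreal
      (\<lambda>p::(nat \<Rightarrow> real) \<times> (nat \<Rightarrow> real). (case p of (x, y) \<Rightarrow> x + y) i)"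
      by (simp add: case_prod_unfold)
  qed
  show "continuous_map (prod_topology euclideanreal euclidean) euclidean (\<lambda>(c, x). c *\<^sub>R x :: nat \<Rightarrow> real)"
  proof (rule coordinatewise)
    fix i
    have "continuous_map (prod_topology euclideanreal euclidean) euclideanreal
      (\<lambda>p::real \<times> (nat \<Rightarrow> real). fst p * snd p i)"
      by (intro continuous_map_real_mult continuous_map_fst
          continuous_map_compose[OF continuous_map_snd coord, unfolded comp_def])
    then show "continuous_map (prod_topology euclideanreal euclidean) euclideanreal
      (\<lambda>p::real \<times> (nat \<Rightarrow> real). (case p of (c, x) \<Rightarrow> c *\<^sub>R x) i)"
      by (simp add: case_prod_unfold scaleR_fun_def)
  qed
  fix U :: "(nat \<Rightarrow> real) set" assume U: "openin euclidean U \<and> 0 \<in> U"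
  then have "openin (product_topology (\<lambda>_. euclidean) UNIV) U" "0 \<in> U"
    by (simp_all add: euclidean_product_topology)
  from product_topology_open_contains_basis[OF this]
  obtain X where X: "0 \<in> PiE UNIV X" "\<And>i. open (X i)" "finite {i. X i \<noteq> UNIV}" "PiE UNIV X \<subseteq> U"
    by auto
  have "\<exists>r>0. ball 0 r \<subseteq> X i" for i
    using X(1) X(2)[of i] open_contains_ball[of "X i"] by (auto simp: PiE_iff)
  then obtain r where r: "\<And>i. r i > 0" "\<And>i. ball (0::real) (r i) \<subseteq> X i" by metis
  \<comment> \<open>Only the finitely many restricted sides are shrunk to intervals, so the box
    remains open in the product topology.\<close>
  define Y where "Y i = (if X i = UNIV then UNIV else ball (0::real) (r i))" for i
  define V where "V = PiE UNIV Y"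
  have mem: "x \<in> V \<longleftrightarrow> (\<forall>i. x i \<in> Y i)" for x by (simp add: V_def PiE_iff)
  have "openin (product_topology (\<lambda>_. euclidean) UNIV) V"
    unfolding V_def
  proof (rule product_topology_basis)
    show "openin euclidean (Y i)" for i by (simp add: Y_def)
    show "finite {i. Y i \<noteq> topspace euclidean}"
      by (rule finite_subset[OF _ X(3)]) (auto simp: Y_def)
  qed
  then have "openin euclidean V" by (simp add: euclidean_product_topology)
  moreover have "convex V"
    unfolding convex_alt
  proof (intro ballI allI impI)
    fix x y and u :: real assume *: "x \<in> V" "y \<in> V" "0 \<le> u \<and> u \<le> 1"
    have "convex (Y i)" for i by (simp add: Y_def)
    then have "(1 - u) * x i + u * y i \<in> Y i" for i
      using * unfolding mem convex_alt by (metis real_scaleR_def)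
    then show "(1 - u) *\<^sub>R x + u *\<^sub>R y \<in> V" unfolding mem by (simp add: scaleR_fun_def)
  qed
  moreover have "0 \<in> V" unfolding mem using r(1) by (simp add: Y_def)
  moreover have "V \<subseteq> U"
  proof -
    have "V \<subseteq> PiE UNIV X" unfolding V_def using r(2) by (intro PiE_mono) (auto simp: Y_def)
    then show ?thesis using X(4) by blast
  qed
  ultimately show "\<exists>V. openin euclidean V \<and> convex V \<and> 0 \<in> V \<and> V \<subseteq> U" by blast
qed simp

context F_markov
begin

section \<open>Extreme points\<close>

lemma extreme_point_zero: "0 extreme_point_of K"
  unfolding extreme_point_of_def
proof (intro conjI zero_in_K ballI notI)
  fix a b assume ab: "a \<in> K" "b \<in> K" "0 \<in> open_segment a b"
  then obtain u where u: "a \<noteq> b" "0 < u" "u < 1" "0 = (1 - u) *\<^sub>R a + u *\<^sub>R b"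
    by (auto simp: in_segment)
  have "a n = 0 \<and> b n = 0" for n
  proof -
    have "(1 - u) * a n + u * b n = 0" using fun_cong[OF u(4), of n] by (simp add: scaleR_fun_def)
    moreover have "0 \<le> (1 - u) * a n" "0 \<le> u * b n" using K_bounds ab u by simp_all
    ultimately have "(1 - u) * a n = 0" "u * b n = 0" by linarith+
    then show ?thesis using u by simp
  qed
  then show False using u(1) by (auto simp: fun_eq_iff)
qed

lemma coords_eq_if_AE_freq_eq:
  assumes \<mu>: "\<mu> \<in> Inv" and AE: "AE x in \<mu>. freq x = y" and one: "measure \<mu> S = 1"
  shows "coords \<mu> = y"
proof
  fix n
  have "coords \<mu> n = (LINT x|\<mu>. freq x n)" by (rule integral_freq[OF \<mu>, symmetric])
  also have "\<dots> = (LINT x|\<mu>. y n)"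
    using AE integrable_freq[OF \<mu>, of n] by (intro integral_cong_AE) (auto elim: eventually_mono)
  also have "\<dots> = y n" using one space_Inv[OF \<mu>] by simp
  finally show "coords \<mu> n = y n" .
qed

text \<open>In a proper convex combination, both components must give mass 1 to the set of points
  with frequency vector \<open>y\<close>. Integrating the frequencies then shows that both
  components have coordinate vector \<open>y\<close>.\<close>

lemma extreme_point_if_ergodic:
  assumes "y \<in> ergodic_points"
  shows "y extreme_point_of K"
  unfolding extreme_point_of_def
proof (intro conjI ballI notI)
  show y: "y \<in> K" using assms by (simp add: ergodic_points_def)
  fix a b assume a: "a \<in> K" and b: "b \<in> K" and "y \<in> open_segment a b"
  then obtain u where u: "a \<noteq> b" "0 < u" "u < 1" "y = (1 - u) *\<^sub>R a + u *\<^sub>R b"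
    by (auto simp: in_segment)
  let ?a = "measure_at a" and ?b = "measure_at b" and ?y = "measure_at y"
  note inv = measure_at_Inv[OF a] measure_at_Inv[OF b]
  interpret A: finite_measure ?a by (rule finite_measure_Inv[OF inv(1)])
  interpret B: finite_measure ?b by (rule finite_measure_Inv[OF inv(2)])
  have yc: "?y = convex_comb_measure u ?a ?b"
    using measure_at_coords[OF convex_comb_Inv[OF inv, of u]] coords_convex_comb[OF inv, of u] u
    by (simp add: coords_measure_at a b)
  have comb: "emeasure ?y X = ennreal (1 - u) * emeasure ?a X + ennreal u * emeasure ?b X"
    if "X \<in> sets SB" for X
    unfolding yc convex_comb_measure_def
    using that sets_Inv[OF inv(1)] sets_Inv[OF inv(2)] by (intro emeasure_measure_of_combination) simp_all
  let ?E = "{x \<in> S. freq x = y}"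
  have one: "ennreal (1 - u) * emeasure ?a ?E + ennreal u * emeasure ?b ?E = 1"
    using comb[OF eq_freq_sets, of y] assms by (simp add: ergodic_points_def)
  have "ennreal ((1 - u) * measure ?a ?E + u * measure ?b ?E) = ennreal 1"
    using one u by (simp add: A.emeasure_eq_measure B.emeasure_eq_measure ennreal_mult)
  then have sum1: "(1 - u) * measure ?a ?E + u * measure ?b ?E = 1"
    using u by (subst (asm) ennreal_inj) simp_all
  have le: "measure ?a ?E \<le> 1" "measure ?b ?E \<le> 1"
    using measure_Inv_le_1[OF inv(1)] measure_Inv_le_1[OF inv(2)] by simp_all
  have "(1 - u) * (1 - measure ?a ?E) + u * (1 - measure ?b ?E) = 0"
    using sum1 by (simp add: algebra_simps)
  moreover have "0 \<le> (1 - u) * (1 - measure ?a ?E)" "0 \<le> u * (1 - measure ?b ?E)"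
    using u le by simp_all
  ultimately have "(1 - u) * (1 - measure ?a ?E) = 0" "u * (1 - measure ?b ?E) = 0"
    by (simp_all only: add_nonneg_eq_0_iff)
  then have E1: "measure ?a ?E = 1" "measure ?b ?E = 1" using u by simp_all
  have "coords \<nu> = y" if \<nu>: "\<nu> \<in> Inv" and E: "measure \<nu> ?E = 1" for \<nu>
  proof (rule coords_eq_if_AE_freq_eq[OF \<nu>])
    interpret N: finite_measure \<nu> by (rule finite_measure_Inv[OF \<nu>])
    have s: "sets \<nu> = sets SB" and sp: "space \<nu> = S" using sets_Inv space_Inv \<nu> by auto
    have "measure \<nu> ?E \<le> measure \<nu> S" using s sets.top[of SB] by (intro N.finite_measure_mono) auto
    then show S1: "measure \<nu> S = 1" using E measure_Inv_le_1[OF \<nu>, of S] by simp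
    have "measure \<nu> (S - ?E) = measure \<nu> S - measure \<nu> ?E"
      using s sets.top[of SB] by (intro N.finite_measure_Diff) auto
    then have "S - ?E \<in> null_sets \<nu>"
      using E S1 s sets.Diff[OF sets.top[of SB] eq_freq_sets[of y]]
      by (intro null_setsI) (simp_all add: N.emeasure_eq_measure)
    then show "AE x in \<nu>. freq x = y" by (rule AE_I') (auto simp: sp)
  qed
  from this[OF inv(1) E1(1)] this[OF inv(2) E1(2)] show False
    using u(1) by (simp add: coords_measure_at a b)
qed

text \<open>A set of measure strictly between 0 and 1 splits the point into its two normalised parts.\<close>

lemma extreme_point_invariant_set:
  assumes ext: "y extreme_point_of K" and A: "A \<in> sets SB" and inv: "shift -` A \<inter> S = A"
  shows "measure (measure_at y) A = 0 \<or> measure (measure_at y) A = 1"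
proof (rule ccontr)
  have y: "y \<in> K" using ext by (simp add: extreme_point_of_def)
  define \<mu> where "\<mu> = measure_at y"
  have \<mu>: "\<mu> \<in> Inv" unfolding \<mu>_def by (rule measure_at_Inv[OF y])
  interpret finite_measure \<mu> by (rule finite_measure_Inv[OF \<mu>])
  have s: "sets \<mu> = sets SB" by (rule sets_Inv[OF \<mu>])
  have SS: "S \<in> sets SB" using sets.top[of SB] by simp
  have SA: "S - A \<in> sets SB" using sets.Diff[OF SS A] .
  have AS: "A \<subseteq> S" using sets.sets_into_space[OF A] by simp
  define \<alpha> where "\<alpha> = measure \<mu> A"
  assume "\<not> (measure (measure_at y) A = 0 \<or> measure (measure_at y) A = 1)"
  then have \<alpha>: "0 < \<alpha>" "\<alpha> < 1"
    using measure_Inv_le_1[OF \<mu>, of A] measure_nonneg[of \<mu> A] by (auto simp: \<alpha>_def \<mu>_def less_le)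
  have mS: "measure \<mu> (S - A) = measure \<mu> S - \<alpha>"
    unfolding \<alpha>_def using A SS AS s by (intro finite_measure_Diff) auto
  then have mS1: "measure \<mu> (S - A) \<le> 1 - \<alpha>" using measure_Inv_le_1[OF \<mu>, of S] by simp
  define \<nu>1 where "\<nu>1 = scale_measure (ennreal (1 / \<alpha>)) (density \<mu> (indicator A))"
  \<comment> \<open>The divisor is \<open>1 - \<alpha>\<close> and not the measure of
    \<open>S - A\<close>, which may be smaller because \<mu> may have mass below 1. The weights
    \<alpha> and \<open>1 - \<alpha>\<close> then add up to 1, and \<nu>2 is still a sub-probability
    measure.\<close>
  define \<nu>2 where "\<nu>2 = scale_measure (ennreal (1 / (1 - \<alpha>))) (density \<mu> (indicator (S - A)))"
  have c1: "ennreal (1 / \<alpha>) * emeasure \<mu> A \<le> 1"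
    using \<alpha> by (simp add: emeasure_eq_measure \<alpha>_def[symmetric] ennreal_mult'[symmetric])
  have c2: "ennreal (1 / (1 - \<alpha>)) * emeasure \<mu> (S - A) \<le> 1"
    using \<alpha> mS1 by (simp add: emeasure_eq_measure ennreal_mult'[symmetric] field_simps)
  note I1 = restrict_Inv[OF \<mu> A inv c1, folded \<nu>1_def]
  note I2 = restrict_Inv[OF \<mu> SA invariant_Diff[OF inv] c2, folded \<nu>2_def]
  have m1: "measure \<nu>1 X = measure \<mu> (A \<inter> X) / \<alpha>" if "X \<in> sets SB" for X
  proof (rule measure_eq_emeasure_eq_ennreal)
    show "emeasure \<nu>1 X = ennreal (measure \<mu> (A \<inter> X) / \<alpha>)"
      unfolding emeasure_restrict_Inv[OF \<mu> A inv c1 that, folded \<nu>1_def]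
      using \<alpha> by (simp add: emeasure_eq_measure ennreal_mult'[symmetric])
  qed (use \<alpha> in simp)
  have m2: "measure \<nu>2 X = measure \<mu> ((S - A) \<inter> X) / (1 - \<alpha>)" if "X \<in> sets SB" for X
  proof (rule measure_eq_emeasure_eq_ennreal)
    show "emeasure \<nu>2 X = ennreal (measure \<mu> ((S - A) \<inter> X) / (1 - \<alpha>))"
      unfolding emeasure_restrict_Inv[OF \<mu> SA invariant_Diff[OF inv] c2 that, folded \<nu>2_def]
      using \<alpha> by (simp add: emeasure_eq_measure ennreal_mult'[symmetric])
  qed (use \<alpha> in simp)
  have "(S - A) \<inter> A = {}" by blast
  then have "measure \<nu>1 A = 1" "measure \<nu>2 A = 0"
    using m1[OF A] m2[OF A] \<alpha> by (simp_all add: \<alpha>_def)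
  then have ne: "\<nu>1 \<noteq> \<nu>2" by auto
  then have "coords \<nu>1 \<noteq> coords \<nu>2" using inj_coords I1 I2 by (auto dest: inj_onD)
  moreover have "y = (1 - (1 - \<alpha>)) *\<^sub>R coords \<nu>1 + (1 - \<alpha>) *\<^sub>R coords \<nu>2"
  proof
    fix n
    let ?C = "cyl (word n)"
    have "measure \<mu> ?C = measure \<mu> (A \<inter> ?C) + measure \<mu> ((S - A) \<inter> ?C)"
    proof -
      have "?C = (A \<inter> ?C) \<union> ((S - A) \<inter> ?C)" using cyl_subset[of "word n"] by blast
      moreover have "measure \<mu> ((A \<inter> ?C) \<union> ((S - A) \<inter> ?C)) = measure \<mu> (A \<inter> ?C) + measure \<mu> ((S - A) \<inter> ?C)"
        using A SA s by (intro finite_measure_Union) auto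
      ultimately show ?thesis by simp
    qed
    moreover have "measure \<mu> ?C = y n"
      using fun_cong[OF coords_measure_at[OF y], of n] by (simp add: coords_def \<mu>_def)
    ultimately show "y n = ((1 - (1 - \<alpha>)) *\<^sub>R coords \<nu>1 + (1 - \<alpha>) *\<^sub>R coords \<nu>2) n"
      using \<alpha> by (simp add: scaleR_fun_def coords_def m1 m2)
  qed
  ultimately have "y \<in> open_segment (coords \<nu>1) (coords \<nu>2)"
    using \<alpha> unfolding in_segment by (intro conjI exI[of _ "1 - \<alpha>"]) simp_all
  then show False using ext I1 I2 unfolding extreme_point_of_def K_def by blast
qed

text \<open>Invariant sets have measure 0 or 1. For \<open>S\<close> this gives mass 1, as
  \<open>y\<close> is not 0. The sets where \<open>freq x n\<close> lies strictly below, or strictly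
  above, \<open>y n\<close> cannot have measure 1, since the mean of \<open>freq x n\<close> is
  \<open>y n\<close>; hence both are null sets.\<close>

lemma ergodic_if_extreme_point:
  assumes ext: "y extreme_point_of K" and nz: "y \<noteq> 0"
  shows "y \<in> ergodic_points"
proof -
  have y: "y \<in> K" using ext by (simp add: extreme_point_of_def)
  define \<mu> where "\<mu> = measure_at y"
  have \<mu>: "\<mu> \<in> Inv" unfolding \<mu>_def by (rule measure_at_Inv[OF y])
  have y_coords: "y = coords \<mu>" by (simp add: \<mu>_def coords_measure_at[OF y])
  interpret finite_measure \<mu> by (rule finite_measure_Inv[OF \<mu>])
  have s: "sets \<mu> = sets SB" and sp: "space \<mu> = S" using sets_Inv space_Inv \<mu> by auto
  have SS: "S \<in> sets SB" using sets.top[of SB] by simp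
  have "measure \<mu> S \<noteq> 0"
  proof
    assume 0: "measure \<mu> S = 0"
    have "y n = 0" for n
    proof -
      have "measure \<mu> (cyl (word n)) \<le> measure \<mu> S"
        using SS s by (intro finite_measure_mono cyl_subset) simp
      then show ?thesis using 0 measure_nonneg[of \<mu> "cyl (word n)"] by (simp add: y_coords coords_def)
    qed
    then show False using nz by (simp add: fun_eq_iff)
  qed
  moreover have "shift -` S \<inter> S = S" using shift_in_S by auto
  ultimately have S1: "measure \<mu> S = 1"
    using extreme_point_invariant_set[OF ext SS] by (simp add: \<mu>_def)
  have no_gap: False
    if int: "integrable \<mu> d" "(LINT x|\<mu>. d x) = 0" and pos: "AE x in \<mu>. 0 < d x" for d :: "_ \<Rightarrow> real"
  proof -
    have "AE x in \<mu>. 0 \<le> d x" using pos by eventually_elim simp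
    then have "AE x in \<mu>. d x = 0" using int integral_nonneg_eq_0_iff_AE by blast
    with pos have "AE x in \<mu>. False" by eventually_elim simp
    then have "emeasure \<mu> (space \<mu>) = 0" using AE_iff_measurable[of "space \<mu>" \<mu> "\<lambda>_. False"] by simp
    then show False using S1 sp by (simp add: measure_def)
  qed
  have int_y: "(LINT x|\<mu>. y n - freq x n) = 0" "integrable \<mu> (\<lambda>x. y n - freq x n)" for n
    using integrable_freq[OF \<mu>, of n] integral_freq[OF \<mu>, of n] S1 sp y_coords by simp_all
  have int_y': "(LINT x|\<mu>. freq x n - y n) = 0" "integrable \<mu> (\<lambda>x. freq x n - y n)" for n
    using integrable_freq[OF \<mu>, of n] integral_freq[OF \<mu>, of n] S1 sp y_coords by simp_all
  have AE_full: "AE x in \<mu>. x \<in> A" if "measure \<mu> A = 1" "A \<in> sets SB" for A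
  proof -
    have "measure \<mu> (S - A) = measure \<mu> S - measure \<mu> A"
      using that SS s sets.sets_into_space[OF that(2)] by (intro finite_measure_Diff) auto
    then have "S - A \<in> null_sets \<mu>"
      using that S1 s sets.Diff[OF SS that(2)] by (intro null_setsI) (simp_all add: emeasure_eq_measure)
    then show ?thesis by (rule AE_I') (auto simp: sp)
  qed
  have AE_empty: "AE x in \<mu>. x \<notin> A" if "measure \<mu> A = 0" "A \<in> sets SB" for A
    using that s by (intro AE_not_in null_setsI) (simp_all add: emeasure_eq_measure)
  have "AE x in \<mu>. freq x n = y n" for n
  proof -
    let ?L = "{x \<in> S. freq x n < y n}" and ?G = "{x \<in> S. y n < freq x n}"
    have "{x \<in> space SB. freq x n < y n} \<in> sets SB" "{x \<in> space SB. y n < freq x n} \<in> sets SB"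
      by measurable
    then have sets: "?L \<in> sets SB" "?G \<in> sets SB" by simp_all
    have inv: "shift -` ?L \<inter> S = ?L" "shift -` ?G \<inter> S = ?G" using freq_shift shift_in_S by auto
    have "measure \<mu> ?L \<noteq> 1"
    proof
      assume "measure \<mu> ?L = 1"
      from AE_full[OF this sets(1)] have "AE x in \<mu>. 0 < y n - freq x n" by eventually_elim simp
      then show False by (rule no_gap[OF int_y(2,1)])
    qed
    then have L: "measure \<mu> ?L = 0"
      using extreme_point_invariant_set[OF ext sets(1) inv(1)] by (simp add: \<mu>_def)
    have "measure \<mu> ?G \<noteq> 1"
    proof
      assume "measure \<mu> ?G = 1"
      from AE_full[OF this sets(2)] have "AE x in \<mu>. 0 < freq x n - y n" by eventually_elim simp
      then show False by (rule no_gap[OF int_y'(2,1)])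
    qed
    then have G: "measure \<mu> ?G = 0"
      using extreme_point_invariant_set[OF ext sets(2) inv(2)] by (simp add: \<mu>_def)
    show ?thesis
      using AE_empty[OF L sets(1)] AE_empty[OF G sets(2)] AE_space
      by eventually_elim (simp add: sp)
  qed
  then have "AE x in \<mu>. \<forall>n. freq x n = y n" by (simp add: AE_all_countable)
  then have "emeasure \<mu> {x \<in> S. freq x = y} = emeasure \<mu> S"
    using SS eq_freq_sets s by (intro emeasure_eq_AE) (auto elim: eventually_mono simp: fun_eq_iff)
  also have "\<dots> = 1" using S1 by (simp add: emeasure_eq_measure)
  finally show ?thesis using y by (simp add: ergodic_points_def \<mu>_def)
qed

lemma extreme_points_K: "{e. e extreme_point_of K} = insert 0 ergodic_points"
  using extreme_point_zero extreme_point_if_ergodic ergodic_if_extreme_point by blast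

lemma zero_singleton_sets: "{0} \<in> sets BK"
proof -
  have "{0} = {y \<in> space BK. \<forall>n. y n = 0}" using zero_in_K by (auto simp: fun_eq_iff)
  also have "\<dots> \<in> sets BK" by measurable
  finally show ?thesis .
qed

lemma extreme_points_sets: "insert 0 ergodic_points \<in> sets BK"
  using sets.Un[OF zero_singleton_sets ergodic_points_sets] by simp

section \<open>Representing measures\<close>

text \<open>A continuous linear functional is a linear combination of finitely many coordinates, so
  the coordinates suffice to test a barycenter.\<close>

lemma represents_iff:
  "represents euclidean K \<rho> y \<longleftrightarrow>
    sets \<rho> = sets BK \<and> emeasure \<rho> K = 1 \<and> (\<forall>n. y n = (LINT z|\<rho>. z n))"
proof (cases "sets \<rho> = sets BK \<and> emeasure \<rho> K = 1")
  case True
  then have s: "sets \<rho> = sets BK" and one: "emeasure \<rho> K = 1" by auto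
  have sp: "space \<rho> = K" using sets_eq_imp_space_eq[OF s] by simp
  interpret prob_space \<rho> using one sp by (intro prob_spaceI) simp
  have coord: "integrable \<rho> (\<lambda>z. z n)" for n
    using K_bounds sp measurable_BK_coordinate[of n]
    by (intro integrable_const_bound[where B=1]) (auto simp: measurable_cong_sets[OF s refl])
  have "f y = (LINT z|\<rho>. f z)"
    if f: "linear f" "continuous_map euclidean euclideanreal f" and eq: "\<forall>n. y n = (LINT z|\<rho>. z n)"
    for f :: "(nat \<Rightarrow> real) \<Rightarrow> real"
  proof -
    obtain J c where J: "finite J" "\<And>z. f z = (\<Sum>j\<in>J. z j * c j)"
      using continuous_linear_functional_finite_sum[OF f(1)] f(2) by auto
    have "(LINT z|\<rho>. f z) = (\<Sum>j\<in>J. (LINT z|\<rho>. z j) * c j)"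
      unfolding J(2) using coord by (subst Bochner_Integration.integral_sum) auto
    then show ?thesis using J(2)[of y] eq by simp
  qed
  moreover have "continuous_map euclidean euclideanreal (\<lambda>z::nat \<Rightarrow> real. z n)" for n
    by simp
  ultimately show ?thesis
    unfolding represents_def using True linear_coordinate by blast
qed (auto simp: represents_def)

lemma represents_nn_integral:
  assumes "represents euclidean K \<rho> y" "y \<in> K"
  shows "(\<integral>\<^sup>+z. ennreal (z n) \<partial>\<rho>) = ennreal (y n)"
proof -
  have s: "sets \<rho> = sets BK" and one: "emeasure \<rho> K = 1" and eq: "y n = (LINT z|\<rho>. z n)"
    using assms(1) by (auto simp: represents_iff)
  have sp: "space \<rho> = K" using sets_eq_imp_space_eq[OF s] by simp
  interpret prob_space \<rho> using one sp by (intro prob_spaceI) simp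
  have "integrable \<rho> (\<lambda>z. z n)"
    using K_bounds sp measurable_BK_coordinate[of n]
    by (intro integrable_const_bound[where B=1]) (auto simp: measurable_cong_sets[OF s refl])
  then have "(\<integral>\<^sup>+z. ennreal (z n) \<partial>\<rho>) = ennreal (LINT z|\<rho>. z n)"
    using K_bounds sp by (intro nn_integral_eq_integral) auto
  then show ?thesis using eq by simp
qed

lemma ex_representing_measure:
  assumes y: "y \<in> K"
  shows "\<exists>\<rho>. represents euclidean K \<rho> y \<and> emeasure \<rho> (insert 0 ergodic_points) = 1"
proof -
  define \<mu> where "\<mu> = measure_at y"
  have \<mu>: "\<mu> \<in> Inv" unfolding \<mu>_def by (rule measure_at_Inv[OF y])
  define s where "s = emeasure \<mu> S"
  have s1: "s \<le> 1" unfolding s_def by (rule emeasure_Inv_le[OF \<mu>])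
  then have s2: "s + (1 - s) = 1" by (simp add: add_diff_inverse_ennreal)
  define D where "D = distr \<mu> BK freq"
  \<comment> \<open>An atom at 0 raises the mass to 1 without changing the mean of any
    coordinate.\<close>
  define Z where "Z = return BK (0 :: nat \<Rightarrow> real)"
  define \<rho> where "\<rho> = measure_of (space D) (sets D) (\<lambda>A. 1 * emeasure D A + (1 - s) * emeasure Z A)"
  have sD: "sets D = sets BK" "space D = K" and sZ: "sets Z = sets D" by (simp_all add: D_def Z_def)
  have s\<rho>: "sets \<rho> = sets BK" unfolding \<rho>_def sD(1)[symmetric] by (rule sets.sets_measure_of_eq)
  have freq_meas: "freq \<in> measurable \<mu> BK" unfolding measurable_Inv[OF \<mu>] by measurable
  have e: "emeasure \<rho> A = emeasure \<mu> (freq -` A \<inter> S) + (1 - s) * indicator A 0" if "A \<in> sets BK" for A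
  proof -
    have "emeasure \<rho> A = 1 * emeasure D A + (1 - s) * emeasure Z A"
      unfolding \<rho>_def using that sD by (intro emeasure_measure_of_combination sZ) simp
    then show ?thesis
      using that freq_meas by (simp add: D_def Z_def emeasure_distr space_Inv[OF \<mu>])
  qed
  have "emeasure \<rho> K = 1"
  proof -
    have "freq -` K \<inter> S = S" using freq_mem_K by auto
    then show ?thesis using e[of K] sets.top[of BK] zero_in_K s2 by (simp add: s_def)
  qed
  moreover have "y n = (LINT z|\<rho>. z n)" for n
  proof -
    have m: "(\<lambda>z. ennreal (z n)) \<in> borel_measurable BK" by measurable
    have "(\<integral>\<^sup>+z. ennreal (z n) \<partial>\<rho>) = 1 * (\<integral>\<^sup>+z. ennreal (z n) \<partial>D) + (1 - s) * (\<integral>\<^sup>+z. ennreal (z n) \<partial>Z)"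
      unfolding \<rho>_def using m by (intro nn_integral_measure_of_combination sZ) (simp add: measurable_cong_sets[OF sD(1) refl])
    also have "(\<integral>\<^sup>+z. ennreal (z n) \<partial>Z) = ennreal ((0 :: nat \<Rightarrow> real) n)"
      unfolding Z_def using m zero_in_K by (intro nn_integral_return) simp_all
    also have "(\<integral>\<^sup>+z. ennreal (z n) \<partial>D) = (\<integral>\<^sup>+x. ennreal (freq x n) \<partial>\<mu>)"
      unfolding D_def using m freq_meas by (intro nn_integral_distr) auto
    also have "\<dots> = ennreal (LINT x|\<mu>. freq x n)"
      using freq_bounds by (intro nn_integral_eq_integral integrable_freq[OF \<mu>]) simp
    also have "\<dots> = ennreal (y n)" by (simp only: integral_freq[OF \<mu>]) (simp only: \<mu>_def coords_measure_at[OF y])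
    finally have nn: "(\<integral>\<^sup>+z. ennreal (z n) \<partial>\<rho>) = ennreal (y n)" by simp
    have "space \<rho> = K" using sets_eq_imp_space_eq[OF s\<rho>] by simp
    then have "(LINT z|\<rho>. z n) = enn2real (\<integral>\<^sup>+z. ennreal (z n) \<partial>\<rho>)"
      using K_bounds measurable_BK_coordinate[of n]
      by (intro integral_eq_nn_integral) (auto simp: measurable_cong_sets[OF s\<rho> refl])
    then show ?thesis using nn K_bounds[OF y] by simp
  qed
  ultimately have "represents euclidean K \<rho> y" by (simp add: represents_iff s\<rho>)
  moreover have "emeasure \<rho> (insert 0 ergodic_points) = 1"
  proof -
    have m: "freq -` insert 0 ergodic_points \<inter> S \<in> sets SB"
      using measurable_sets[OF measurable_freq_BK extreme_points_sets] by simp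
    have "AE x in \<mu>. freq x \<in> ergodic_points"
      using AE_ergodic[OF \<mu>] by eventually_elim (simp add: ergodic_points_def freq_mem_K)
    then have "emeasure \<mu> (freq -` insert 0 ergodic_points \<inter> S) = emeasure \<mu> S"
      using m sets.top[of SB] sets_Inv[OF \<mu>] by (intro emeasure_eq_AE) (auto elim: eventually_mono)
    then show ?thesis using e[OF extreme_points_sets] s2 by (simp add: s_def)
  qed
  ultimately show ?thesis by blast
qed

text \<open>For an ergodic point \<open>z\<close>, the measure at \<open>z\<close> gives the set of
  points with frequency vector in \<open>A\<close> mass 1 if \<open>z\<close> is in \<open>A\<close>
  and mass 0 otherwise; for \<open>z = 0\<close> the mass is 0. Integrated over \<open>z\<close>,
  this is the mass of \<open>A - {0}\<close>. The average of the measures at \<open>z\<close> is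
  also the measure at \<open>y\<close>, so \<rho> is determined away from 0.\<close>

lemma representing_measure_Diff_zero:
  assumes y: "y \<in> K" and rep: "represents euclidean K \<rho> y"
    and ext: "emeasure \<rho> (insert 0 ergodic_points) = 1" and A: "A \<in> sets BK"
  shows "emeasure \<rho> (A - {0}) = emeasure (measure_at y) (freq -` A \<inter> S)"
proof -
  have s: "sets \<rho> = sets BK" and one: "emeasure \<rho> K = 1" using rep by (auto simp: represents_iff)
  have sp: "space \<rho> = K" using sets_eq_imp_space_eq[OF s] by simp
  interpret prob_space \<rho> using one sp by (intro prob_spaceI) simp
  have E: "freq -` A \<inter> S \<in> sets SB" using measurable_sets[OF measurable_freq_BK A] by simp
  have \<kappa>: "measure_at \<in> measurable \<rho> (subprob_algebra SB)"
    using measurable_measure_at by (simp add: measurable_cong_sets[OF s refl])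
  have AE: "AE z in \<rho>. z \<in> insert 0 ergodic_points"
  proof -
    have "prob (insert 0 ergodic_points) = 1" using ext by (simp add: measure_def)
    then show ?thesis using extreme_points_sets s by (simp add: prob_eq_1)
  qed
  have "(\<integral>\<^sup>+z. emeasure (measure_at z) (freq -` A \<inter> S) \<partial>\<rho>) = emeasure (measure_at y) (freq -` A \<inter> S)"
  proof (rule nn_integral_kernel_eq[OF measure_at_Inv[OF y] _ \<kappa> _ E])
    show "space \<rho> \<noteq> {}" using zero_in_K by (auto simp: sp)
    fix n
    have "(\<integral>\<^sup>+z. emeasure (measure_at z) (cyl (word n)) \<partial>\<rho>) = (\<integral>\<^sup>+z. ennreal (z n) \<partial>\<rho>)"
      by (intro nn_integral_cong) (simp add: emeasure_measure_at_cyl sp)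
    then show "(\<integral>\<^sup>+z. emeasure (measure_at z) (cyl (word n)) \<partial>\<rho>) = emeasure (measure_at y) (cyl (word n))"
      by (simp add: represents_nn_integral[OF rep y] emeasure_measure_at_cyl y)
  qed
  also have "(\<integral>\<^sup>+z. emeasure (measure_at z) (freq -` A \<inter> S) \<partial>\<rho>) = (\<integral>\<^sup>+z. indicator (A - {0}) z \<partial>\<rho>)"
  proof (rule nn_integral_cong_AE)
    show "AE z in \<rho>. emeasure (measure_at z) (freq -` A \<inter> S) = indicator (A - {0}) z"
      using AE
    proof eventually_elim
      case (elim z)
      show ?case
      proof (cases "z = 0")
        case True
        then show ?thesis by (simp add: measure_at_zero)
      next
        case False
        then have z: "z \<in> K" and e1: "emeasure (measure_at z) {x \<in> S. freq x = z} = 1"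
          using elim by (auto simp: ergodic_points_def)
        have inv: "measure_at z \<in> Inv" by (rule measure_at_Inv[OF z])
        interpret M: finite_measure "measure_at z" by (rule finite_measure_Inv[OF inv])
        have sz: "sets (measure_at z) = sets SB" by (rule sets_Inv[OF inv])
        show ?thesis
        proof (cases "z \<in> A")
          case True
          have "1 \<le> emeasure (measure_at z) (freq -` A \<inter> S)"
            unfolding e1[symmetric] using E sz True by (intro emeasure_mono) auto
          then show ?thesis
            using emeasure_measure_at_le_1[OF z] True False by (auto intro: antisym)
        next
          case zA: False
          have "emeasure (measure_at z) (freq -` A \<inter> S) + emeasure (measure_at z) {x \<in> S. freq x = z}
            = emeasure (measure_at z) ((freq -` A \<inter> S) \<union> {x \<in> S. freq x = z})"
            using E sz zA eq_freq_sets by (intro plus_emeasure) auto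
          also have "\<dots> \<le> 1" by (rule emeasure_measure_at_le_1[OF z])
          finally have "measure (measure_at z) (freq -` A \<inter> S) + 1 \<le> 1"
            using e1 by (simp add: M.emeasure_eq_measure ennreal_plus[symmetric] ennreal_1[symmetric] del: ennreal_plus ennreal_1)
          then have "measure (measure_at z) (freq -` A \<inter> S) = 0" using measure_nonneg[of "measure_at z"] by (simp add: antisym)
          then show ?thesis using zA by (simp add: M.emeasure_eq_measure)
        qed
      qed
    qed
  qed
  also have "\<dots> = emeasure \<rho> (A - {0})"
    using sets.Diff[OF A zero_singleton_sets] s by simp
  finally show ?thesis .
qed

text \<open>Away from 0 the preceding lemma expresses both measures through \<open>y\<close> alone,
  and the mass of 0 is what is missing to 1.\<close>

lemma representing_measure_unique:
  assumes y: "y \<in> K"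
    and rep: "represents euclidean K \<rho> y" "represents euclidean K \<rho>' y"
    and ext: "emeasure \<rho> (insert 0 ergodic_points) = 1" "emeasure \<rho>' (insert 0 ergodic_points) = 1"
  shows "\<rho> = \<rho>'"
proof (rule measure_eqI)
  have s: "sets \<rho> = sets BK" "sets \<rho>' = sets BK" and one: "emeasure \<rho> K = 1" "emeasure \<rho>' K = 1"
    using rep by (auto simp: represents_iff)
  then show "sets \<rho> = sets \<rho>'" by simp
  have KK: "K \<in> sets BK" using sets.top[of BK] by simp
  have diff: "emeasure \<rho> (A - {0}) = emeasure \<rho>' (A - {0})" if "A \<in> sets BK" for A
    using representing_measure_Diff_zero[OF y rep(1) ext(1) that]
      representing_measure_Diff_zero[OF y rep(2) ext(2) that] by simp
  have split: "emeasure \<tau> A = emeasure \<tau> (A - {0}) + (if 0 \<in> A then emeasure \<tau> {0} else 0)"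
    if "A \<in> sets BK" "sets \<tau> = sets BK" for A and \<tau> :: "(nat \<Rightarrow> real) measure"
  proof (cases "0 \<in> A")
    case True
    have "emeasure \<tau> (A - {0}) + emeasure \<tau> {0} = emeasure \<tau> ((A - {0}) \<union> {0})"
      using that zero_singleton_sets by (intro plus_emeasure) auto
    then show ?thesis using True by (simp add: insert_absorb)
  qed simp
  have zero: "emeasure \<rho> {0} = emeasure \<rho>' {0}"
  proof -
    have "emeasure \<rho> (K - {0}) + emeasure \<rho> {0} = emeasure \<rho> (K - {0}) + emeasure \<rho>' {0}"
      using split[OF KK s(1)] split[OF KK s(2)] diff[OF KK] one zero_in_K by simp
    moreover have "emeasure \<rho> (K - {0}) \<noteq> top"
      using emeasure_mono[of "K - {0}" K \<rho>] one KK s by (auto simp: top_unique)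
    ultimately show ?thesis by (simp add: ennreal_add_left_cancel)
  qed
  fix A assume "A \<in> sets \<rho>"
  then have A: "A \<in> sets BK" using s by simp
  show "emeasure \<rho> A = emeasure \<rho>' A"
    unfolding split[OF A s(1)] split[OF A s(2)] by (simp only: diff[OF A] zero)
qed

text \<open>All points of a periodic orbit have the same frequency vector, and the orbit measure is
  concentrated on the orbit.\<close>

lemma P_subset_ergodic: "P \<subseteq> ergodic_points"
proof
  fix y assume "y \<in> P"
  then obtain u where u: "loop u" "y = loop_freq u" by (auto simp: P_def)
  obtain \<mu> where \<mu>: "\<mu> \<in> Inv" "coords \<mu> = loop_freq u"
    and full: "\<And>A. A \<in> sets SB \<Longrightarrow> (\<forall>k. (shift ^^ k) (periodic u) \<in> A) \<Longrightarrow> emeasure \<mu> A = 1"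
    using ex_orbit_measure[OF u(1)] by blast
  have m: "measure_at y = \<mu>" using measure_at_coords[OF \<mu>(1)] \<mu>(2) u(2) by simp
  have "emeasure \<mu> {x \<in> S. freq x = y} = 1"
    using freq_periodic[OF u(1)] funpow_shift_in_S[OF periodic_in_S[OF u(1)]] u(2)
    by (intro full eq_freq_sets) simp
  then show "y \<in> ergodic_points" using P_subset_K \<open>y \<in> P\<close> by (auto simp: ergodic_points_def m)
qed

lemma ex_loop: "\<exists>u. loop u"
  using ex_long_loop[OF transitive F] by blast

lemma poulsen_simplex_K: "poulsen_simplex euclidean K"
  unfolding poulsen_simplex_def metrizable_choquet_simplex_def extreme_points_K
proof (intro conjI ballI)
  show "locally_convex_space (euclidean :: (nat \<Rightarrow> real) topology)"
    by (rule locally_convex_space_sequences)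
  show "compactin euclidean K" using compact_K[OF F] by simp
  show "convex K" by (rule convex_K)
  show "metrizable_space (subtopology euclidean K)"
    by (intro metrizable_space_subtopology metrizable_space_euclidean)
  show "\<exists>!\<rho>. represents euclidean K \<rho> y \<and> emeasure \<rho> (insert 0 ergodic_points) = 1" if "y \<in> K" for y
    using ex_representing_measure[OF that] representing_measure_unique[OF that] by blast
  obtain u where "loop u" using ex_loop by blast
  then have "loop_freq u \<in> ergodic_points" using P_subset_ergodic by (auto simp: P_def)
  then have "loop_freq u \<in> K" "0 \<noteq> loop_freq u"
    using zero_not_ergodic by (auto simp: ergodic_points_def)
  then show "\<exists>x\<in>K. \<exists>y\<in>K. x \<noteq> y" using zero_in_K by blast
  have "K \<subseteq> closure P" by (rule K_subset_closure_P[OF transitive F])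
  also have "\<dots> \<subseteq> closure (insert 0 ergodic_points)" using P_subset_ergodic by (intro closure_mono) blast
  finally show "K \<subseteq> euclidean closure_of insert 0 ergodic_points" by simp
qed

end

theorem theorem1p2:
  fixes B :: "nat \<Rightarrow> nat \<Rightarrow> nat"
  assumes "transition_matrix B"
    and "transitive_shift B"
    and "F_property B"
  shows "(\<exists>(X :: (nat \<Rightarrow> real) topology) K h.
            poulsen_simplex X K \<and>
            homeomorphic_map (cylinder_convergence_topology B) (subtopology X K) h \<and>
            affine_on_measures (inv_subprob_measures B) h)
         \<and> compact_space (cylinder_convergence_topology B)"
proof -
  interpret F_markov B by unfold_locales (use assms in auto)
  show ?thesis
    using poulsen_simplex_K homeomorphic_map_coords affine_coords
      compact_space_cylinder_convergence[OF F] by blast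
qed

end
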